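(* Let $(X,m,\rho)$ be a bounded complete Ahlfors $Q$-regular metric measure space with a fixed dyadic system, $T$ the associated tree, $\Lambda:\partial T\to X$ the associated map. Let $1<p<\infty$, $0<s<1$, and let $\mathrm{Cap}$ be the capacity on $\overline T=T\cup\partial T$ associated with the exponent $p$ and the weight $\pi_s(\alpha)=m(\overline{Q_\alpha})^{\frac{sp'-1}{p'-1}}$, $\alpha\in T$. Then there are constants $0<C_1<C_2$ such that, for all compact subsets $K$ of $\partial T$, $$C_1\,\mathrm{Cap}(K)\le\mathrm{Cap}_X(\Lambda(K))\le C_2\,\mathrm{Cap}(K),$$ and, for all closed subsets $F$ of $X$, $$C_1\,\mathrm{Cap}(\Lambda^{-1}(F))\le\mathrm{Cap}_X(F)\le C_2\,\mathrm{Cap}(\Lambda^{-1}(F)).$$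
   Context: Ahlfors regularity: $(X,\rho)$ is a complete metric space, $0<\mathrm{diam}(X)<\infty$, $m\ge0$ is Borel, and $c_1r^Q\le m(B(x,r))\le c_2r^Q$ for all $x\in X$, $0\le r\le\mathrm{diam}(X)$, with constants $0<c_1<c_2$, $Q>0$. Dyadic system (exists by a theorem of M. Christ, up to rescaling the distance): constants $\delta\in(0,1)$, $a_0,c_4>0$, index sets $I_k$ ($k\in\mathbb N=\{0,1,\dots\}$), and open sets $Q^k_\alpha\subseteq X$ ($\alpha\in I_k$) with: (i) $m(X\setminus\bigcup_{\alpha\in I_k}Q^k_\alpha)=0$ for all $k$; (ii) if $l\ge k$, $\alpha\in I_k$, $\beta\in I_l$, then $Q^l_\beta\subseteq Q^k_\alpha$ or $Q^l_\beta\cap Q^k_\alpha=\emptyset$, and distinct sets with the same $k$ are disjoint; (iii) for $l>k$ and $\beta\in I_l$ there is a unique $\alpha\in I_k$ with $Q^l_\beta\subseteq Q^k_\alpha$; (iv) $\mathrm{diam}(Q^k_\alpha)\le c_4\delta^k$; (v) $B(z^k_\alpha,a_0\delta^k)\subseteq Q^k_\alpha$ for a distinguished point $z^k_\alpha\in Q^k_\alpha$; moreover $I_0=\{o\}$ and $Q^0_o=X$. Tree $T$: vertices are the pairs $(k,\alpha)$, $\alpha\in I_k$ (written $\alpha$, level $d(\alpha)=k$, $Q_\alpha=Q^k_\alpha$), root $o$; $\alpha,\beta$ are joined by an edge if $d(\beta)=d(\alpha)+1$ and $Q_\beta\subseteq Q_\alpha$, or vice versa. $\partial T$ is the set of infinite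 geodesics $\xi=(\xi_n)_{n\ge0}$ with $\xi_0=o$, $d(\xi_n)=n$, with the topology having as basis the sets $\partial S(\alpha)$ of geodesics passing through $\alpha$. $\Lambda(\xi)$ is the unique point of $\bigcap_n\overline{Q_{\xi_n}}$. Capacity on $X$: $\frac1p+\frac1{p'}=1$; $K(x,y)=[m(B(x,\rho(x,y)))+m(B(y,\rho(x,y)))]^{-s}$ (with $0^{-s}=+\infty$), $\mathcal E_X(\omega)=\int_X\left(\int_XK(x,y)\,d\omega(y)\right)^{p'}dm(x)$, and for compact $E\subseteq X$, $\mathrm{Cap}_X(E)=\sup\,\omega(E)^p/\mathcal E_X(\omega)^{p-1}$ over nonzero finite nonnegative Borel measures $\omega$ with $\mathrm{supp}(\omega)\subseteq E$ (the quotient is $0$ if $\mathcal E_X(\omega)=\infty$; $\sup\emptyset=0$). Capacity on $\overline T$ with weight $\pi:T\to(0,\infty)$: for $\xi\in\overline T$ let $P(\xi)\subseteq T$ be the set of vertices of the geodesic from $o$ to $\xi$ (including $o$, and $\xi$ if $\xi\in T$), $I\varphi(\xi)=\sum_{y\in P(\xi)}\varphi(y)$, and for $E\subseteq\overline T$ $$\mathrm{Cap}(E)=\inf\Big\{\sum_{x\in T}\varphi(x)^p\pi(x):\ \varphi\ge0,\ I\varphi\ge1\text{ on }E\Big\}.$$ For closed $E$ this equals $\sup\{\omega(E)^p/\mathcal E(\omega)^{p-1}:\ \mathrm{supp}(\omega)\subseteq E\}$, where $\mathcal E(\omega)=\sum_{\alpha\in T}\omega(S(\alpha))^{p'}\pi(\alpha)^{1-p'}$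 and $S(\alpha)=\{\xi\in\overline T:\alpha\in P(\xi)\}$. *)

theory Defs
  imports "HOL-Analysis.Analysis"
begin

text \<open>
  The space \<open>X\<close> is the universe of a type \<open>'a\<close> of class \<open>complete_space\<close>. Throughout,
  \<open>B(x,r)\<close> is the closed ball \<open>cball x r\<close>, so that regularity at \<open>r = diam X\<close> bounds \<open>m(X)\<close>;
  with open balls the upper bound would not exclude \<open>m(X) = \<infinity>\<close> (infinitely many copies of a
  Cantor set at mutual distance \<open>diam X\<close>). For the kernel, and for the inner balls of the
  dyadic cubes, the choice only changes constants.
\<close>

locale ahlfors_regular =
  fixes m :: "'a::complete_space measure" and D c1 c2 :: real
  assumes bounded_space: "bounded (UNIV :: 'a set)"
    and diameter_pos: "0 < diameter (UNIV :: 'a set)"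
    and sets_m: "sets m = sets borel"
    and constants: "0 < c1" "c1 < c2" "0 < D"
    and regular: "\<And>x r. 0 \<le> r \<Longrightarrow> r \<le> diameter (UNIV :: 'a set) \<Longrightarrow>
      ennreal (c1 * r powr D) \<le> emeasure m (cball x r) \<and>
      emeasure m (cball x r) \<le> ennreal (c2 * r powr D)"

locale dyadic_system =
  fixes m :: "'a::complete_space measure"
    and I :: "nat \<Rightarrow> 'i set" and Q :: "nat \<Rightarrow> 'i \<Rightarrow> 'a set" and z :: "nat \<Rightarrow> 'i \<Rightarrow> 'a"
    and rt :: 'i and \<delta> a0 c4 :: real
  assumes constants: "0 < \<delta>" "\<delta> < 1" "0 < a0" "0 < c4"
    and open_cube: "\<And>k \<alpha>. \<alpha> \<in> I k \<Longrightarrow> open (Q k \<alpha>)"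
    and full_measure: "\<And>k. emeasure m (UNIV - (\<Union>\<alpha>\<in>I k. Q k \<alpha>)) = 0"
    and nested: "\<And>k l \<alpha> \<beta>. k \<le> l \<Longrightarrow> \<alpha> \<in> I k \<Longrightarrow> \<beta> \<in> I l \<Longrightarrow>
      Q l \<beta> \<subseteq> Q k \<alpha> \<or> Q l \<beta> \<inter> Q k \<alpha> = {}"
    and disjoint: "\<And>k \<alpha> \<beta>. \<alpha> \<in> I k \<Longrightarrow> \<beta> \<in> I k \<Longrightarrow> \<alpha> \<noteq> \<beta> \<Longrightarrow> Q k \<alpha> \<inter> Q k \<beta> = {}"
    and unique_ancestor: "\<And>k l \<beta>. k < l \<Longrightarrow> \<beta> \<in> I l \<Longrightarrow> \<exists>!\<alpha>. \<alpha> \<in> I k \<and> Q l \<beta> \<subseteq> Q k \<alpha>"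
    and diameter_cube: "\<And>k \<alpha>. \<alpha> \<in> I k \<Longrightarrow> diameter (Q k \<alpha>) \<le> c4 * \<delta> ^ k"
    and centre: "\<And>k \<alpha>. \<alpha> \<in> I k \<Longrightarrow> z k \<alpha> \<in> Q k \<alpha>"
    and inner_ball: "\<And>k \<alpha>. \<alpha> \<in> I k \<Longrightarrow> cball (z k \<alpha>) (a0 * \<delta> ^ k) \<subseteq> Q k \<alpha>"
    and root: "I 0 = {rt}" "Q 0 rt = UNIV"


subsection \<open>The tree and its boundary\<close>

type_synonym 'i vertex = "nat \<times> 'i"
type_synonym 'i ray = "nat \<Rightarrow> 'i vertex"

abbreviation level :: "'i vertex \<Rightarrow> nat" where
  "level \<equiv> fst"

definition tree :: "(nat \<Rightarrow> 'i set) \<Rightarrow> 'i vertex set" where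
  "tree I = {(k, \<alpha>). \<alpha> \<in> I k}"

definition cube :: "(nat \<Rightarrow> 'i \<Rightarrow> 'a set) \<Rightarrow> 'i vertex \<Rightarrow> 'a set" where
  "cube Q v = Q (fst v) (snd v)"

definition tree_edge :: "(nat \<Rightarrow> 'i \<Rightarrow> 'a set) \<Rightarrow> 'i vertex \<Rightarrow> 'i vertex \<Rightarrow> bool" where
  "tree_edge Q v w \<longleftrightarrow>
     (level w = level v + 1 \<and> cube Q w \<subseteq> cube Q v) \<or>
     (level v = level w + 1 \<and> cube Q v \<subseteq> cube Q w)"

definition walk :: "(nat \<Rightarrow> 'i set) \<Rightarrow> (nat \<Rightarrow> 'i \<Rightarrow> 'a set) \<Rightarrow> 'i ray \<Rightarrow> nat \<Rightarrow> bool" where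
  "walk I Q \<gamma> n \<longleftrightarrow> (\<forall>i\<le>n. \<gamma> i \<in> tree I) \<and> (\<forall>i<n. tree_edge Q (\<gamma> i) (\<gamma> (Suc i)))"

text \<open>\<open>geodesic I Q \<gamma> n\<close>: the initial segment \<open>\<gamma> 0, \<dots>, \<gamma> n\<close> is a shortest walk between its ends.\<close>

definition geodesic :: "(nat \<Rightarrow> 'i set) \<Rightarrow> (nat \<Rightarrow> 'i \<Rightarrow> 'a set) \<Rightarrow> 'i ray \<Rightarrow> nat \<Rightarrow> bool" where
  "geodesic I Q \<gamma> n \<longleftrightarrow> walk I Q \<gamma> n \<and>
     (\<forall>\<gamma>' n'. walk I Q \<gamma>' n' \<and> \<gamma>' 0 = \<gamma> 0 \<and> \<gamma>' n' = \<gamma> n \<longrightarrow> n \<le> n')"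

definition tree_boundary ::
  "(nat \<Rightarrow> 'i set) \<Rightarrow> (nat \<Rightarrow> 'i \<Rightarrow> 'a set) \<Rightarrow> 'i \<Rightarrow> 'i ray set" where
  "tree_boundary I Q rt =
     {\<xi>. \<xi> 0 = (0, rt) \<and> (\<forall>n. geodesic I Q \<xi> n) \<and> (\<forall>n. level (\<xi> n) = n)}"

definition boundary_shadow ::
  "(nat \<Rightarrow> 'i set) \<Rightarrow> (nat \<Rightarrow> 'i \<Rightarrow> 'a set) \<Rightarrow> 'i \<Rightarrow> 'i vertex \<Rightarrow> 'i ray set" where
  "boundary_shadow I Q rt v = {\<xi> \<in> tree_boundary I Q rt. v \<in> range \<xi>}"

text \<open>
  \<open>topology_generated_by\<close> takes a subbasis; any two shadows are nested or disjoint,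
  so the shadows (together with the empty set) form a basis of this topology.
\<close>

definition boundary_topology ::
  "(nat \<Rightarrow> 'i set) \<Rightarrow> (nat \<Rightarrow> 'i \<Rightarrow> 'a set) \<Rightarrow> 'i \<Rightarrow> 'i ray topology" where
  "boundary_topology I Q rt = topology_generated_by (boundary_shadow I Q rt ` tree I)"

definition boundary_map :: "(nat \<Rightarrow> 'i \<Rightarrow> 'a::topological_space set) \<Rightarrow> 'i ray \<Rightarrow> 'a" where
  "boundary_map Q \<xi> = (THE x. x \<in> (\<Inter>n. closure (cube Q (\<xi> n))))"


subsection \<open>Capacity on the closure of the tree\<close>

text \<open>A point of the closure of the tree is \<open>Inl v\<close> for a vertex \<open>v\<close>, \<open>Inr \<xi>\<close> for a boundary point.\<close>

fun geodesic_vertices :: "(nat \<Rightarrow> 'i set) \<Rightarrow> (nat \<Rightarrow> 'i \<Rightarrow> 'a set) \<Rightarrow> 'i \<Rightarrow>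
    'i vertex + 'i ray \<Rightarrow> 'i vertex set" where
  "geodesic_vertices I Q rt (Inl v) =
     {\<gamma> i | \<gamma> n i. geodesic I Q \<gamma> n \<and> \<gamma> 0 = (0, rt) \<and> \<gamma> n = v \<and> i \<le> n}"
| "geodesic_vertices I Q rt (Inr \<xi>) = range \<xi>"

definition tree_potential :: "(nat \<Rightarrow> 'i set) \<Rightarrow> (nat \<Rightarrow> 'i \<Rightarrow> 'a set) \<Rightarrow> 'i \<Rightarrow>
    ('i vertex \<Rightarrow> real) \<Rightarrow> 'i vertex + 'i ray \<Rightarrow> ennreal" where
  "tree_potential I Q rt \<phi> \<xi> = (\<Sum>\<^sub>\<infinity>y\<in>geodesic_vertices I Q rt \<xi>. ennreal (\<phi> y))"

definition tree_cap :: "(nat \<Rightarrow> 'i set) \<Rightarrow> (nat \<Rightarrow> 'i \<Rightarrow> 'a set) \<Rightarrow> 'i \<Rightarrow>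
    real \<Rightarrow> ('i vertex \<Rightarrow> real) \<Rightarrow> ('i vertex + 'i ray) set \<Rightarrow> ennreal" where
  "tree_cap I Q rt p w E =
     (INF \<phi> \<in> {\<phi>. (\<forall>x\<in>tree I. 0 \<le> \<phi> x) \<and> (\<forall>\<xi>\<in>E. 1 \<le> tree_potential I Q rt \<phi> \<xi>)}.
        \<Sum>\<^sub>\<infinity>x\<in>tree I. ennreal (\<phi> x powr p * w x))"

definition dyadic_weight :: "'a::topological_space measure \<Rightarrow> (nat \<Rightarrow> 'i \<Rightarrow> 'a set) \<Rightarrow>
    real \<Rightarrow> real \<Rightarrow> 'i vertex \<Rightarrow> real" where
  "dyadic_weight m Q s p' v = measure m (closure (cube Q v)) powr ((s * p' - 1) / (p' - 1))"


subsection \<open>Capacity on the metric space\<close>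

text \<open>Only used for exponents \<open>a > 0\<close>.\<close>

definition ennpow :: "ennreal \<Rightarrow> real \<Rightarrow> ennreal" where
  "ennpow t a = (if t = \<infinity> then \<infinity> else ennreal (enn2real t powr a))"

text \<open>On \<open>ennreal\<close>, \<open>inverse 0 = \<infinity>\<close>; in particular the kernel is \<open>\<infinity>\<close> on the diagonal.\<close>

definition kernel :: "'a::metric_space measure \<Rightarrow> real \<Rightarrow> 'a \<Rightarrow> 'a \<Rightarrow> ennreal" where
  "kernel m s x y = inverse (ennpow
     (emeasure m (cball x (dist x y)) + emeasure m (cball y (dist x y))) s)"

definition space_energy ::
  "'a::metric_space measure \<Rightarrow> real \<Rightarrow> real \<Rightarrow> 'a measure \<Rightarrow> ennreal" where
  "space_energy m s p' \<omega> = (\<integral>\<^sup>+x. ennpow (\<integral>\<^sup>+y. kernel m s x y \<partial>\<omega>) p' \<partial>m)"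

definition measure_support :: "'a::topological_space measure \<Rightarrow> 'a set" where
  "measure_support \<omega> = {x. \<forall>U. open U \<and> x \<in> U \<longrightarrow> emeasure \<omega> U \<noteq> 0}"

text \<open>
  On \<open>ennreal\<close>, dividing a finite number by \<open>\<infinity>\<close> gives \<open>0\<close>, and the supremum of the empty set is \<open>0\<close>.
\<close>

definition space_cap ::
  "'a::metric_space measure \<Rightarrow> real \<Rightarrow> real \<Rightarrow> real \<Rightarrow> 'a set \<Rightarrow> ennreal" where
  "space_cap m s p p' E =
     (SUP \<omega> \<in> {\<omega>. sets \<omega> = sets borel \<and> finite_measure \<omega> \<and> emeasure \<omega> (space \<omega>) \<noteq> 0 \<and>
                  measure_support \<omega> \<subseteq> E}.
        ennpow (emeasure \<omega> E) p / ennpow (space_energy m s p' \<omega>) (p - 1))"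

end

theory Submission
  imports Defs
begin

text \<open>
  The kernel is comparable to \<open>dist x y powr - (s * D)\<close>, hence to the sum of
  \<open>\<delta> powr - (n * s * D)\<close> over the scales \<open>n\<close> with \<open>dist x y \<le> R * \<delta> ^ n\<close>, \<open>R\<close> the
  diameter; in particular it dominates the sum over the \<open>n\<close> at which \<open>x\<close> and \<open>y\<close> share a cube.

  Upper bound: if \<open>\<omega>\<close> lives on the space and \<open>\<phi>\<close> is admissible on the tree, then \<open>\<omega> E\<close> is at most
  the sum of \<open>\<phi> v * \<omega> (closure (C v))\<close>, because every point of \<open>E\<close> is the end of a ray along which
  \<open>\<phi>\<close> sums to at least \<open>1\<close>. Hoelder's inequality bounds this by the \<open>\<phi>\<close>-cost and the tree energy
  of \<open>\<omega>\<close>, and the latter is at most a multiple of the energy on the space since \<open>p' > 1\<close>.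

  Lower bound: on a tree the extremal problem is solved by the series and parallel laws of
  resistor networks. No minimax theorem is needed: on finite trees these laws give an admissible
  function of cost equal to the recursively computed capacity, and in the limit they give a unit
  flow carried by \<open>K\<close> whose energy is at most the dual power of that capacity. The flow is
  transported to the space as the image of Lebesgue measure on the unit interval, and
  Wolff's inequality bounds its energy there by the tree energy.
\<close>

text \<open>Two mismatches between tree and space shape the proof. Close points may lie in cubes
  whose last common ancestor is the root, so the tree does not see that they are close; in the lower
  bound every cube is therefore accompanied by its neighbours in the same layer, at most
  \<open>N0\<close> of them by a packing argument. Moreover the cubes of a layer miss an
  \<open>m\<close>-null set, which \<open>\<omega>\<close> may charge; integrals in \<open>m\<close>
  therefore run over the open cubes, disjoint within a layer, while \<open>\<omega>\<close> is
  evaluated on their closures, which cover everything but may overlap. Write \<open>q\<close> for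
  the dual exponent and \<open>\<beta> ^ n\<close> for the size of the kernel at scale
  \<open>n\<close>. The exponent of the weight is the one for which the dual weight of a cube of
  level \<open>n\<close> is comparable to \<open>(\<beta> ^ n) powr q\<close> times its measure, so
  that the tree energy is the diagonal part of the space energy. Since \<open>s > 0\<close>,
  \<open>\<beta> > 1\<close> and the deepest common scale dominates the kernel sum. Since
  \<open>s < 1\<close>, \<open>\<theta> = \<beta> * \<delta> powr D < 1\<close>, and this decay
  reduces the off-diagonal part to the diagonal one.\<close>

section \<open>Inequalities for real sums\<close>

text \<open>A unit drop of potential is split as \<open>t + (1 - t)\<close> between two elements in
  series with conductances \<open>a\<close> and \<open>b\<close>. The value of \<open>t\<close> is
  the minimiser of the cost, found from
  \<open>t powr (p - 1) * a = (1 - t) powr (p - 1) * b\<close>; the right-hand side is the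
  conductance of the pair, later called \<open>ser\<close>.\<close>

lemma powr_real_combination:
  fixes a b p :: real
  assumes "0 < a" "0 \<le> b" "1 < p"
  shows "(b powr (1/(p-1)) / (a powr (1/(p-1)) + b powr (1/(p-1)))) powr p * a
    + (1 - b powr (1/(p-1)) / (a powr (1/(p-1)) + b powr (1/(p-1)))) powr p * b
    = a * b / (a powr (1/(p-1)) + b powr (1/(p-1))) powr (p-1)"
proof (cases "b = 0")
  case True
  then show ?thesis using assms by simp
next
  case False
  define r where "r = 1/(p-1)"
  define A where "A = a powr r"
  define B where "B = b powr r"
  have b: "b > 0" using False assms by simp
  have pos: "A > 0" "B > 0" "A + B > 0" using assms b by (auto simp: A_def B_def add_pos_pos)
  have rp: "r * p = r + 1" "r * (p-1) = 1" using assms by (auto simp: r_def field_simps)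
  have Ap: "A powr p = A * a" "B powr p = B * b"
    using assms b by (auto simp: A_def B_def powr_powr rp powr_add)
  have "(B / (A + B)) powr p * a + (1 - B / (A + B)) powr p * b
    = (B powr p * a + A powr p * b) / (A + B) powr p"
  proof -
    have "1 - B / (A+B) = A / (A+B)" using pos by (simp add: field_simps)
    then show ?thesis using pos by (simp add: powr_divide add_divide_distrib)
  qed
  also have "\<dots> = a * b * (A + B) / (A+B) powr p"
    by (simp add: Ap algebra_simps)
  also have "\<dots> = a * b / (A+B) powr (p-1)"
    using pos by (simp add: powr_diff field_simps)
  finally show ?thesis by (simp add: A_def B_def r_def)
qed

lemma powr_sum_superadditive:
  fixes f :: "'b \<Rightarrow> real"
  assumes "1 \<le> q" "finite A" "\<And>x. x \<in> A \<Longrightarrow> 0 \<le> f x"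
  shows "(\<Sum>x\<in>A. f x powr q) \<le> (\<Sum>x\<in>A. f x) powr q"
proof -
  let ?S = "\<Sum>x\<in>A. f x"
  have S: "0 \<le> ?S" using assms by (simp add: sum_nonneg)
  have split: "x powr q = x * x powr (q-1)" if "0 \<le> x" for x :: real
    using that assms(1) by (cases "x = 0") (auto simp: powr_diff)
  have "(\<Sum>x\<in>A. f x powr q) \<le> (\<Sum>x\<in>A. f x * ?S powr (q-1))"
  proof (rule sum_mono)
    fix x assume x: "x \<in> A"
    have "f x \<le> ?S" using x assms by (intro member_le_sum) auto
    then have "f x powr (q-1) \<le> ?S powr (q-1)" using assms x by (intro powr_mono2) auto
    then show "f x powr q \<le> f x * ?S powr (q-1)"
      using split[of "f x"] assms(3)[OF x] by (simp add: mult_left_mono)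
  qed
  also have "\<dots> = ?S powr q" using split[OF S] by (simp add: sum_distrib_right)
  finally show ?thesis .
qed

text \<open>Compare every term with the largest one. This loses a factor \<open>card A\<close>
  against Hoelder's inequality, harmless where it is applied to a bounded number of
  neighbours.\<close>

lemma powr_sum_le_card:
  fixes f :: "'b \<Rightarrow> real"
  assumes "1 \<le> q" "finite A" "\<And>x. x \<in> A \<Longrightarrow> 0 \<le> f x"
  shows "(\<Sum>x\<in>A. f x) powr q \<le> real (card A) powr q * (\<Sum>x\<in>A. f x powr q)"
proof (cases "A = {}")
  case True then show ?thesis using assms by simp
next
  case False
  obtain y where y: "y \<in> A" "\<forall>x\<in>A. f x \<le> f y"
  proof -
    have "Max (f ` A) \<in> f ` A" using False assms by (intro Max_in) auto
    then obtain y where "y \<in> A" "Max (f ` A) = f y" by auto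
    moreover have "\<forall>x\<in>A. f x \<le> Max (f ` A)" using assms by auto
    ultimately show thesis using that by metis
  qed
  have "(\<Sum>x\<in>A. f x) \<le> real (card A) * f y" using sum_bounded_above[of A f "f y"] y by auto
  then have "(\<Sum>x\<in>A. f x) powr q \<le> (real (card A) * f y) powr q"
    using assms by (intro powr_mono2) (auto intro: sum_nonneg)
  also have "\<dots> = real (card A) powr q * f y powr q" using assms y by (simp add: powr_mult)
  also have "\<dots> \<le> real (card A) powr q * (\<Sum>x\<in>A. f x powr q)"
    using y assms by (intro mult_left_mono member_le_sum) auto
  finally show ?thesis .
qed

lemma sum_power_le_geometric:
  fixes t :: real
  assumes "0 \<le> t" "t < 1" "finite A"
  shows "(\<Sum>n\<in>A. t ^ n) \<le> 1 / (1 - t)"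
proof -
  have "(\<Sum>n\<in>A. t ^ n) \<le> (\<Sum>n. t ^ n)"
    using assms by (intro sum_le_suminf) (auto intro: summable_geometric)
  then show ?thesis using assms by (simp add: suminf_geometric)
qed

text \<open>Young's inequality for \<open>s * (s + a) powr (q - 1)\<close> takes the place of the
  mean value theorem. Applied to successive partial sums, the estimate telescopes.\<close>

lemma powr_diff_le:
  fixes s a q :: real
  assumes "0 \<le> s" "0 \<le> a" "1 < q"
  shows "(s + a) powr q \<le> s powr q + q * a * (s + a) powr (q - 1)"
proof -
  have split: "x powr q = x * x powr (q-1)" if "0 \<le> x" for x :: real
    using that assms by (cases "x = 0") (auto simp: powr_diff)
  define p where "p = q / (q - 1)"
  have p: "p > 1" "1/p + 1/q = 1" "(q - 1) * p = q" using assms by (auto simp: p_def field_simps)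
  have "s * (s+a) powr (q-1) \<le> s powr q / q + ((s+a) powr (q-1)) powr p / p"
    using Youngs_inequality[of q p s "(s+a) powr (q-1)"] assms p by (simp add: add.commute)
  also have "((s+a) powr (q-1)) powr p = (s+a) powr q" by (simp add: powr_powr p)
  finally have "(s+a) powr q \<le> a * (s+a) powr (q-1) + s powr q / q + (s+a) powr q / p"
    using split[of "s+a"] assms by (simp add: algebra_simps)
  moreover have "(s+a) powr q / p = (s+a) powr q - (s+a) powr q / q"
    using p assms by (simp add: p_def field_simps)
  ultimately have "(s+a) powr q / q \<le> a * (s+a) powr (q-1) + s powr q / q" by linarith
  then have "q * ((s+a) powr q / q) \<le> q * (a * (s+a) powr (q-1) + s powr q / q)"
    using assms by (intro mult_left_mono) auto
  then show ?thesis using assms by (simp add: algebra_simps)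
qed

text \<open>Telescoping with \<open>powr_diff_le\<close> leaves \<open>a n\<close> times the power
  \<open>q - 1\<close> of a partial sum. Expanding that power by subadditivity would require
  \<open>q <= 2\<close>; a growing geometric weight on the earlier terms makes one argument serve
  for all \<open>q > 1\<close>, at the price of the free parameter \<open>t\<close>.\<close>

lemma powr_sum_le_double_sum:
  fixes a :: "nat \<Rightarrow> real"
  assumes q: "1 < q" and t: "0 < t" "t < 1" and a: "\<And>n. 0 \<le> a n"
  shows "(\<Sum>n<N. a n) powr q \<le> q * (1 / (1 - t)) powr (q - 1) *
    (\<Sum>n<N. \<Sum>j\<le>n. (t powr (q - 1)) powr (- real (n - j)) * (a n * a j powr (q - 1)))"
proof -
  let ?c = "(1 / (1 - t)) powr (q - 1)"
  have step: "(\<Sum>j\<le>n. a j) powr (q-1) \<le> ?c * (\<Sum>j\<le>n. (t powr (q - 1)) powr (- real (n - j)) * a j powr (q-1))" for n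
  proof -
    define b where "b j = t powr (- real (n - j)) * a j" for j
    have b0: "0 \<le> b j" for j using a by (simp add: b_def)
    \<comment> \<open>\<open>b i\<close> is the largest weighted term; bounding every
      \<open>b j\<close> by it turns the partial sum into a geometric series.\<close>
    obtain i where i: "i \<le> n" "\<forall>j\<le>n. b j \<le> b i"
    proof -
      have "Max (b ` {..n}) \<in> b ` {..n}" by (intro Max_in) auto
      then obtain i where "i \<in> {..n}" "Max (b ` {..n}) = b i" by blast
      then have "i \<le> n" "Max (b ` {..n}) = b i" by simp_all
      moreover have "\<forall>j\<le>n. b j \<le> Max (b ` {..n})" by auto
      ultimately show thesis using that by metis
    qed
    have ab: "a j = t ^ (n - j) * b j" for j
      using t by (simp add: b_def powr_minus powr_realpow)
    have "(\<Sum>j\<le>n. a j) \<le> (\<Sum>j\<le>n. t ^ (n - j) * b i)"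
      unfolding ab using i t by (intro sum_mono mult_left_mono) auto
    also have "\<dots> = (\<Sum>j\<le>n. t ^ j) * b i"
      unfolding sum_distrib_right[symmetric]
      by (subst sum.nat_diff_reindex[symmetric, of _ "Suc n", unfolded lessThan_Suc_atMost]) simp
    also have "\<dots> \<le> 1 / (1 - t) * b i"
      using t b0 by (intro mult_right_mono sum_power_le_geometric) auto
    finally have "(\<Sum>j\<le>n. a j) powr (q-1) \<le> (1 / (1 - t) * b i) powr (q-1)"
      using q a by (intro powr_mono2) (auto intro: sum_nonneg)
    also have "\<dots> = ?c * b i powr (q-1)" using b0 t by (subst powr_mult) auto
    also have "\<dots> \<le> ?c * (\<Sum>j\<le>n. b j powr (q-1))"
      using i by (intro mult_left_mono member_le_sum) auto
    also have "(\<Sum>j\<le>n. b j powr (q-1)) = (\<Sum>j\<le>n. (t powr (q - 1)) powr (- real (n - j)) * a j powr (q-1))"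
      using a by (intro sum.cong) (auto simp: b_def powr_mult powr_powr mult.commute)
    finally show ?thesis .
  qed
  have "(\<Sum>n<N. a n) powr q \<le> (\<Sum>n<N. q * (a n * (\<Sum>j\<le>n. a j) powr (q-1)))"
  proof (induction N)
    case 0 then show ?case using q by simp
  next
    case (Suc N)
    have "(\<Sum>n<Suc N. a n) powr q \<le> (\<Sum>n<N. a n) powr q + q * a N * (\<Sum>n<Suc N. a n) powr (q-1)"
      using powr_diff_le[of "\<Sum>n<N. a n" "a N" q] a q by (simp add: sum_nonneg)
    then show ?case using Suc by (simp add: lessThan_Suc_atMost[symmetric] mult.assoc)
  qed
  also have "\<dots> \<le> (\<Sum>n<N. q * (a n * (?c * (\<Sum>j\<le>n. (t powr (q - 1)) powr (- real (n - j)) * a j powr (q-1)))))"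
    using q a step by (intro sum_mono mult_left_mono) auto
  also have "\<dots> = q * ?c * (\<Sum>n<N. \<Sum>j\<le>n. (t powr (q - 1)) powr (- real (n - j)) * (a n * a j powr (q - 1)))"
    by (simp add: sum_distrib_left mult_ac)
  finally show ?thesis .
qed

text \<open>The minimum and the maximum appear because the exponent of interest,
  \<open>1 - s * q\<close>, may have either sign.\<close>

lemma powr_two_sided:
  fixes x u A B e :: real
  assumes "0 < A" "0 < u" "A * u \<le> x" "x \<le> B * u"
  shows "min (A powr e) (B powr e) * u powr e \<le> x powr e"
    "x powr e \<le> max (A powr e) (B powr e) * u powr e"
proof -
  define y where "y = x / u"
  have y: "A \<le> y" "y \<le> B" "0 < y" using assms by (auto simp: y_def field_simps intro: less_le_trans[OF mult_pos_pos])
  have x: "x powr e = y powr e * u powr e" using assms y by (simp add: y_def powr_mult[symmetric])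
  have "min (A powr e) (B powr e) \<le> y powr e \<and> y powr e \<le> max (A powr e) (B powr e)"
  proof (cases "0 \<le> e")
    case True
    then have "A powr e \<le> y powr e" "y powr e \<le> B powr e" using y assms by (auto intro: powr_mono2)
    then show ?thesis by auto
  next
    case False
    then have "y powr e \<le> A powr e" "B powr e \<le> y powr e" using y assms by (auto intro: powr_mono2')
    then show ?thesis by auto
  qed
  then show "min (A powr e) (B powr e) * u powr e \<le> x powr e"
    "x powr e \<le> max (A powr e) (B powr e) * u powr e"
    unfolding x by (auto intro: mult_right_mono)
qed

lemma Hoelder_sum:
  fixes f g :: "'b \<Rightarrow> real"
  assumes "1 < p" "1/p + 1/q = 1" "finite A"
    "\<And>x. x \<in> A \<Longrightarrow> 0 \<le> f x" "\<And>x. x \<in> A \<Longrightarrow> 0 \<le> g x"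
  shows "(\<Sum>x\<in>A. f x * g x) \<le> (\<Sum>x\<in>A. f x powr p) powr (1/p) * (\<Sum>x\<in>A. g x powr q) powr (1/q)"
proof -
  let ?S = "\<Sum>x\<in>A. f x powr p" and ?W = "\<Sum>x\<in>A. g x powr q"
  have "1/p < 1" using assms by simp
  then have "0 < 1/q" using assms by linarith
  then have q0: "0 < q" by simp
  have "1/q < 1" using assms by (smt (verit) divide_pos_pos)
  then have q1: "1 < q" using q0 by simp
  have S0: "0 \<le> ?S" and W0: "0 \<le> ?W" by (auto intro: sum_nonneg)
  show ?thesis
  proof (cases "?S = 0 \<or> ?W = 0")
    case True
    then have "(\<forall>x\<in>A. f x powr p = 0) \<or> (\<forall>x\<in>A. g x powr q = 0)"
      using assms(3) by (auto simp: sum_nonneg_eq_0_iff)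
    then have "(\<forall>x\<in>A. f x * g x = 0)" by auto
    then have "(\<Sum>x\<in>A. f x * g x) = 0" by (intro sum.neutral) auto
    then show ?thesis by simp
  next
    case False
    then have S: "0 < ?S" and W: "0 < ?W" using S0 W0 by auto
    define s where "s = ?S powr (1/p)"
    define w where "w = ?W powr (1/q)"
    have s: "0 < s" "s powr p = ?S" using S assms(1) by (auto simp: s_def powr_powr)
    have w: "0 < w" "w powr q = ?W" using W q1 by (auto simp: w_def powr_powr)
    have "(\<Sum>x\<in>A. (f x / s) * (g x / w)) \<le> (\<Sum>x\<in>A. (f x / s) powr p / p + (g x / w) powr q / q)"
      using assms s w q1 by (intro sum_mono Youngs_inequality) auto
    also have "\<dots> = (\<Sum>x\<in>A. f x powr p / ?S / p + g x powr q / ?W / q)"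
      using assms s(1) w(1) by (intro sum.cong) (auto simp: powr_divide s(2) w(2))
    also have "\<dots> = ?S / ?S / p + ?W / ?W / q"
      by (simp only: sum.distrib sum_divide_distrib)
    also have "\<dots> = 1" using S W assms by simp
    finally have "(\<Sum>x\<in>A. f x * g x) / (s * w) \<le> 1"
      by (simp add: sum_divide_distrib)
    then show ?thesis using s(1) w(1) unfolding s_def[symmetric] w_def[symmetric] by (simp add: field_simps)
  qed
qed

text \<open>Half-open intervals are laid end to end. An element of weight 0 receives an empty
  interval, so a label that is actually taken has positive weight; \<open>flow_measure\<close>
  relies on this.\<close>

lemma interval_partition:
  fixes \<mu> :: "'b \<Rightarrow> real"
  assumes "finite A" "\<And>w. w \<in> A \<Longrightarrow> 0 \<le> \<mu> w"
  shows "\<exists>f. (\<forall>t\<in>{x..<x + sum \<mu> A}. f t \<in> A) \<and>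
    (\<forall>w\<in>A. \<exists>y. {t \<in> {x..<x + sum \<mu> A}. f t = w} = {y..<y + \<mu> w})"
  using assms
proof (induction A rule: finite_induct)
  case empty then show ?case by simp
next
  case (insert u A)
  let ?e = "x + sum \<mu> A"
  have "\<exists>f. (\<forall>t\<in>{x..<?e}. f t \<in> A) \<and> (\<forall>w\<in>A. \<exists>y. {t \<in> {x..<?e}. f t = w} = {y..<y + \<mu> w})"
    using insert by blast
  then obtain f where f: "\<And>t. t \<in> {x..<?e} \<Longrightarrow> f t \<in> A"
    "\<And>w. w \<in> A \<Longrightarrow> \<exists>y. {t \<in> {x..<?e}. f t = w} = {y..<y + \<mu> w}" by blast
  have s: "sum \<mu> (insert u A) = \<mu> u + sum \<mu> A" "0 \<le> \<mu> u" "0 \<le> sum \<mu> A"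
    using insert by (auto intro: sum_nonneg)
  let ?g = "\<lambda>t. if t < ?e then f t else u"
  let ?J = "{x..<x + sum \<mu> (insert u A)}"
  have "?g t \<in> insert u A" if "t \<in> ?J" for t using f(1)[of t] that by auto
  moreover have "\<exists>y. {t \<in> ?J. ?g t = w} = {y..<y + \<mu> w}" if "w \<in> insert u A" for w
  proof (cases "w = u")
    case True
    have "{t \<in> ?J. ?g t = u} = {?e..<?e + \<mu> u}" using f(1) insert(2) s by force
    then show ?thesis using True by blast
  next
    case False
    then have "w \<in> A" using that by blast
    from f(2)[OF this] obtain y where y: "{t \<in> {x..<?e}. f t = w} = {y..<y + \<mu> w}" by blast
    have "{t \<in> ?J. ?g t = w} = {t \<in> {x..<?e}. f t = w}" using False s by auto
    then show ?thesis using y by auto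
  qed
  ultimately show ?case by (intro exI[of _ ?g] conjI ballI) blast+
qed

section \<open>Extended nonnegative reals\<close>

lemma ennpow_ennreal: "0 \<le> x \<Longrightarrow> ennpow (ennreal x) a = ennreal (x powr a)"
  by (simp add: ennpow_def)

lemma ennpow_mono: "0 \<le> a \<Longrightarrow> x \<le> y \<Longrightarrow> ennpow x a \<le> ennpow y a"
  by (cases x; cases y) (auto simp: ennpow_ennreal top_unique ennpow_def intro!: ennreal_leI powr_mono2)

text \<open>As an adjunction this carries \<open>ennpow\<close> past suprema without any continuity
  argument.\<close>

lemma ennpow_le_iff:
  assumes "0 < a"
  shows "ennpow x a \<le> y \<longleftrightarrow> x \<le> ennpow y (1/a)"
proof (cases x)
  case (real x')
  show ?thesis
  proof (cases y)
    case (real y')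
    have "x' powr a \<le> y' \<longleftrightarrow> x' \<le> y' powr (1/a)"
    proof
      assume "x' powr a \<le> y'"
      then have "(x' powr a) powr (1/a) \<le> y' powr (1/a)" using assms by (intro powr_mono2) auto
      then show "x' \<le> y' powr (1/a)" using assms \<open>0 \<le> x'\<close> by (simp add: powr_powr)
    next
      assume "x' \<le> y' powr (1/a)"
      then have "x' powr a \<le> (y' powr (1/a)) powr a" using assms \<open>0 \<le> x'\<close> by (intro powr_mono2) auto
      then show "x' powr a \<le> y'" using assms \<open>0 \<le> y'\<close> by (simp add: powr_powr)
    qed
    then show ?thesis using real \<open>0 \<le> x'\<close> \<open>x = _\<close> by (simp add: ennpow_ennreal)
  qed (auto simp: ennpow_def)
qed (auto simp: ennpow_def top_unique)

lemma ennpow_SUP_le: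
  assumes "0 < a"
  shows "ennpow (SUP n. f n) a \<le> (SUP n. ennpow (f n) a)"
  unfolding ennpow_le_iff[OF assms]
  by (intro SUP_least) (auto simp: ennpow_le_iff[OF assms, symmetric] intro: SUP_upper)

lemma ennreal_le_mult_INF:
  fixes X :: ennreal and f :: "'b \<Rightarrow> ennreal"
  assumes "0 < c" "\<And>i. i \<in> A \<Longrightarrow> X \<le> ennreal c * f i"
  shows "X \<le> ennreal c * (INF i\<in>A. f i)"
proof -
  have cancel: "ennreal c * (ennreal (1/c) * y) = y" "ennreal (1/c) * (ennreal c * y) = y" for y
    using assms(1) by (simp_all add: mult.assoc[symmetric] ennreal_mult[symmetric])
  have "ennreal (1/c) * X \<le> f i" if "i \<in> A" for i
    using mult_left_mono[OF assms(2)[OF that], of "ennreal (1/c)"] by (simp add: cancel)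
  then have "ennreal (1/c) * X \<le> (INF i\<in>A. f i)" by (rule INF_greatest)
  from mult_left_mono[OF this, of "ennreal c"] show ?thesis by (simp add: cancel)
qed

lemma ennreal_inverse_antimono:
  fixes x y :: ennreal
  assumes "x \<le> y" shows "inverse y \<le> inverse x"
proof (cases "x = 0 \<or> y = \<infinity>")
  case True then show ?thesis by auto
next
  case False
  then obtain a b where "x = ennreal a" "y = ennreal b" "0 < a" "0 < b"
    using assms by (cases x; cases y) (auto simp: top_unique)
  then show ?thesis using assms by (simp add: inverse_ennreal le_imp_inverse_le)
qed

lemma sum_le_infsum_ennreal:
  fixes f :: "'b \<Rightarrow> ennreal"
  assumes "finite F" "F \<subseteq> A" shows "sum f F \<le> infsum f A"
  using assms by (subst nonneg_infsum_complete) (auto intro!: SUP_upper)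

section \<open>Geometry of dyadic cubes\<close>

locale dyadic_space =
  A: ahlfors_regular m D c1 c2 + S: dyadic_system m I Q z rt \<delta> a0 c4
  for m :: "'a::complete_space measure" and D c1 c2 :: real
    and I :: "nat \<Rightarrow> 'i set" and Q :: "nat \<Rightarrow> 'i \<Rightarrow> 'a set" and z :: "nat \<Rightarrow> 'i \<Rightarrow> 'a"
    and rt :: 'i and \<delta> a0 c4 :: real
begin

abbreviation C :: "'i vertex \<Rightarrow> 'a set" where "C \<equiv> cube Q"

definition R :: real where "R = diameter (UNIV :: 'a set)"
text \<open>Regularity bounds balls from below only up to radius \<open>R\<close>; with this
  \<open>a\<close> the inner balls of radius \<open>a * \<delta> ^ n\<close> stay in that range at
  every level.\<close>

definition a :: real where "a = min a0 R"
definition ctr :: "'i vertex \<Rightarrow> 'a" where "ctr v = z (fst v) (snd v)"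
definition layer :: "nat \<Rightarrow> 'i vertex set" where "layer n = {v \<in> tree I. level v = n}"
definition desc :: "nat \<Rightarrow> 'i vertex \<Rightarrow> 'i vertex set" where
  "desc n v = {w \<in> layer n. C w \<subseteq> C v}"
text \<open>If \<open>x\<close> lies in \<open>C v\<close> at level \<open>n\<close>, these are all
  the cubes of the layer whose closures the ball of radius \<open>R * \<delta> ^ n\<close> about
  \<open>x\<close> can meet. The factor \<open>R\<close> makes that ball the whole space at level
  0.\<close>

definition nbrs :: "'i vertex \<Rightarrow> 'i vertex set" where
  "nbrs v = {w \<in> layer (level v).
     \<exists>x\<in>closure (C v). \<exists>y\<in>closure (C w). dist x y \<le> R * \<delta> ^ level v}"

lemma R_pos: "0 < R" using A.diameter_pos by (simp add: R_def)

lemma a_pos: "0 < a" and a_le: "a \<le> R" "a \<le> a0"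
  using R_pos S.constants by (auto simp: a_def)

lemma dist_le_R: "dist x (y::'a) \<le> R"
  unfolding R_def by (rule diameter_bounded_bound[OF A.bounded_space]) auto

lemma delta_pow: "0 < \<delta> ^ n" "\<delta> ^ n \<le> 1"
  using S.constants by (auto simp: power_le_one)

lemma space_m: "space m = UNIV"
  using sets_eq_imp_space_eq[OF A.sets_m] by simp

lemma c12: "0 < c1" "0 < c2" "0 < D"
  using A.constants by auto

lemma cball_R: "R \<le> r \<Longrightarrow> cball x r = (UNIV :: 'a set)"
  using dist_le_R order_trans by fastforce

lemma emeasure_cball_le: "0 \<le> r \<Longrightarrow> emeasure m (cball x r) \<le> ennreal (c2 * r powr D)"
proof (cases "r \<le> R")
  case True assume "0 \<le> r" then show ?thesis using True A.regular[of r x] by (simp add: R_def)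
next
  case False
  have "emeasure m (cball x r) = emeasure m (cball x R)" using False by (simp add: cball_R)
  also have "\<dots> \<le> ennreal (c2 * R powr D)" using A.regular[of R x] R_pos by (simp add: R_def)
  also have "\<dots> \<le> ennreal (c2 * r powr D)"
    using False R_pos A.constants by (intro ennreal_leI mult_left_mono powr_mono2) auto
  finally show ?thesis .
qed

lemma finite_m: "finite_measure m"
proof
  have "emeasure m (space m) = emeasure m (cball undefined R)" by (simp add: space_m cball_R)
  also have "\<dots> \<le> ennreal (c2 * R powr D)" using R_pos by (intro emeasure_cball_le) auto
  also have "\<dots> < \<infinity>" by simp
  finally show "emeasure m (space m) \<noteq> \<infinity>" by simp
qed

sublocale M: finite_measure m by (rule finite_m)

lemma measure_cball_le: "0 \<le> r \<Longrightarrow> measure m (cball x r) \<le> c2 * r powr D"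
  using emeasure_cball_le[of r x] A.constants by (simp add: M.emeasure_eq_measure)

lemma measure_cball_ge: "0 \<le> r \<Longrightarrow> r \<le> R \<Longrightarrow> c1 * r powr D \<le> measure m (cball x r)"
  using A.regular[of r x] A.constants by (simp add: M.emeasure_eq_measure R_def)

lemma borel_m: "open U \<Longrightarrow> U \<in> sets m" "closed U \<Longrightarrow> U \<in> sets m"
  by (auto simp: A.sets_m)

lemma open_measure_pos: "open U \<Longrightarrow> x \<in> U \<Longrightarrow> 0 < measure m U"
proof -
  assume U: "open U" "x \<in> U"
  then obtain e where e: "e > 0" "cball x e \<subseteq> U" using open_contains_cball by blast
  define r where "r = min e R"
  have r: "0 < r" "r \<le> R" "cball x r \<subseteq> U" using e R_pos by (auto simp: r_def)
  have "0 < c1 * r powr D" using r A.constants by simp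
  also have "\<dots> \<le> measure m (cball x r)" using r by (intro measure_cball_ge) auto
  also have "\<dots> \<le> measure m U" using r U by (intro M.finite_measure_mono borel_m) auto
  finally show ?thesis .
qed

section \<open>Layers of cubes and ancestors\<close>

lemma layerD: "v \<in> layer n \<Longrightarrow> v \<in> tree I \<and> level v = n"
  by (simp add: layer_def)

lemma layer_iff: "v \<in> layer n \<longleftrightarrow> fst v = n \<and> snd v \<in> I n"
  by (auto simp: layer_def tree_def)

lemma tree_layer: "v \<in> tree I \<Longrightarrow> v \<in> layer (level v)"
  by (simp add: layer_def)

lemma layer_0: "layer 0 = {(0, rt)}"
  by (auto simp: layer_iff S.root)

lemma C_root: "C (0, rt) = UNIV"
  by (simp add: cube_def S.root)

lemma open_C: "v \<in> tree I \<Longrightarrow> open (C v)"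
  by (auto simp: cube_def tree_def S.open_cube)

lemma ctr_in: "v \<in> layer n \<Longrightarrow> ctr v \<in> C v"
  by (auto simp: cube_def layer_iff ctr_def S.centre)

lemma ctr_in_closure: "v \<in> layer n \<Longrightarrow> ctr v \<in> closure (C v)"
  using ctr_in closure_subset by blast

lemma layer_tree: "v \<in> layer n \<Longrightarrow> v \<in> tree I"
  by (simp add: layer_def)

lemma cball_ctr: "v \<in> layer n \<Longrightarrow> cball (ctr v) (a * \<delta> ^ n) \<subseteq> C v"
proof -
  assume "v \<in> layer n"
  then have "cball (ctr v) (a0 * \<delta> ^ n) \<subseteq> C v"
    using S.inner_ball[of "snd v" n] by (simp add: layer_iff cube_def ctr_def)
  moreover have "a * \<delta> ^ n \<le> a0 * \<delta> ^ n" using a_le delta_pow by (intro mult_right_mono) (auto intro: less_imp_le)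
  ultimately show ?thesis by (meson order_trans subset_cball)
qed

lemma dist_closure_C: 
  assumes "v \<in> layer n" "x \<in> closure (C v)" "y \<in> closure (C v)"
  shows "dist x y \<le> c4 * \<delta> ^ n"
proof -
  have b: "bounded (C v)" using A.bounded_space by (rule bounded_subset) simp
  have "dist x y \<le> diameter (closure (C v))"
    using assms b by (intro diameter_bounded_bound bounded_closure)
  also have "\<dots> = diameter (C v)" using b by (rule diameter_closure)
  also have "\<dots> \<le> c4 * \<delta> ^ n" using S.diameter_cube[of "snd v" n] assms(1) by (auto simp: layer_iff cube_def)
  finally show ?thesis .
qed

lemma C_nested: "v \<in> layer k \<Longrightarrow> w \<in> layer l \<Longrightarrow> k \<le> l \<Longrightarrow> C w \<subseteq> C v \<or> C w \<inter> C v = {}"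
  using S.nested[of k l "snd v" "snd w"] by (auto simp: layer_iff cube_def)

lemma C_disjoint: "v \<in> layer k \<Longrightarrow> w \<in> layer k \<Longrightarrow> v \<noteq> w \<Longrightarrow> C v \<inter> C w = {}"
  using S.disjoint[of "snd v" k "snd w"] by (simp add: layer_iff cube_def prod_eq_iff)

lemma C_eq: "v \<in> layer k \<Longrightarrow> w \<in> layer k \<Longrightarrow> x \<in> C v \<Longrightarrow> x \<in> C w \<Longrightarrow> v = w"
  using C_disjoint by blast

lemma ancestor_ex1: 
  assumes "w \<in> layer l" "k \<le> l" shows "\<exists>!v. v \<in> layer k \<and> C w \<subseteq> C v"
proof (cases "k = l")
  case True
  show ?thesis
  proof (rule ex1I[of _ w])
    fix v assume v: "v \<in> layer k \<and> C w \<subseteq> C v"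
    have "ctr w \<in> C v" using v ctr_in[OF assms(1)] by blast
    then show "v = w" using C_eq[of v k w] v assms True ctr_in[OF assms(1)] by blast
  qed (use assms True in simp)
next
  case False
  then obtain \<alpha> where al: "\<alpha> \<in> I k" "Q l (snd w) \<subseteq> Q k \<alpha>"
    using S.unique_ancestor[of k l "snd w"] assms by (auto simp: layer_iff)
  have al': "(k, \<alpha>) \<in> layer k" "C w \<subseteq> C (k, \<alpha>)"
    using al assms(1) by (simp_all add: layer_iff cube_def)
  show ?thesis
  proof (rule ex1I[of _ "(k, \<alpha>)"])
    fix v assume v: "v \<in> layer k \<and> C w \<subseteq> C v"
    then show "v = (k, \<alpha>)" using C_eq[OF _ al'(1), of v "ctr w"] al' ctr_in[OF assms(1)] by blast
  qed (use al' in simp)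
qed

definition anc :: "nat \<Rightarrow> 'i vertex \<Rightarrow> 'i vertex" where
  "anc k w = (THE v. v \<in> layer k \<and> C w \<subseteq> C v)"

lemma anc: assumes "w \<in> layer l" "k \<le> l" shows "anc k w \<in> layer k" "C w \<subseteq> C (anc k w)"
  using theI'[OF ancestor_ex1[OF assms]] by (auto simp: anc_def)

lemma anc_eqI: assumes "w \<in> layer l" "k \<le> l" "v \<in> layer k" "C w \<subseteq> C v" shows "anc k w = v"
  using ancestor_ex1[OF assms(1,2)] anc[OF assms(1,2)] assms by blast

lemma anc_eq_iff:
  assumes "w \<in> layer l" "k \<le> l" "v \<in> layer k"
  shows "anc k w = v \<longleftrightarrow> w \<in> desc l v"
  using anc_eqI[OF assms] anc[OF assms(1,2)] assms(1) by (metis (no_types, lifting) desc_def mem_Collect_eq)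

section \<open>Measures of cubes and packing bounds\<close>

lemma measure_C_ge: "v \<in> layer n \<Longrightarrow> c1 * a powr D * (\<delta> ^ n) powr D \<le> measure m (C v)"
proof -
  assume v: "v \<in> layer n"
  have "c1 * (a * \<delta> ^ n) powr D \<le> measure m (cball (ctr v) (a * \<delta> ^ n))"
    using a_pos a_le delta_pow[of n] by (intro measure_cball_ge) (simp_all add: order_trans[OF mult_left_le])
  also have "\<dots> \<le> measure m (C v)"
    using cball_ctr[OF v] open_C layer_tree[OF v] by (intro M.finite_measure_mono borel_m) auto
  finally show ?thesis using a_pos delta_pow[of n] by (simp add: powr_mult mult.assoc)
qed

lemma measure_closure_C_le: "v \<in> layer n \<Longrightarrow> measure m (closure (C v)) \<le> c2 * c4 powr D * (\<delta> ^ n) powr D"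
proof -
  assume v: "v \<in> layer n"
  have "closure (C v) \<subseteq> cball (ctr v) (c4 * \<delta> ^ n)" using dist_closure_C[OF v ctr_in_closure[OF v]] by (simp add: subset_iff)
  then have "measure m (closure (C v)) \<le> measure m (cball (ctr v) (c4 * \<delta> ^ n))"
    by (intro M.finite_measure_mono borel_m) auto
  also have "\<dots> \<le> c2 * (c4 * \<delta> ^ n) powr D"
    using S.constants delta_pow[of n] by (intro measure_cball_le) auto
  finally show ?thesis using S.constants delta_pow[of n] by (simp add: powr_mult mult.assoc)
qed

lemma measure_C_le_closure: "v \<in> tree I \<Longrightarrow> measure m (C v) \<le> measure m (closure (C v))"
  by (intro M.finite_measure_mono borel_m closure_subset closed_closure)

lemma measure_C_le: "v \<in> layer n \<Longrightarrow> measure m (C v) \<le> c2 * c4 powr D * (\<delta> ^ n) powr D"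
  using measure_C_le_closure[of v] measure_closure_C_le[of v n] layerD[of v n] by linarith

text \<open>Packing: the inner balls of the cubes are disjoint, lie in one ball of radius
  \<open>(B + a) * \<delta> ^ n\<close>, and all have measure comparable to
  \<open>(\<delta> ^ n) powr D\<close>, which cancels.\<close>

lemma card_cubes_near:
  assumes A: "A \<subseteq> layer n" and near: "\<And>v. v \<in> A \<Longrightarrow> dist x (ctr v) \<le> B * \<delta> ^ n" and B: "0 \<le> B"
  shows "finite A \<and> real (card A) \<le> c2 * (B + a) powr D / (c1 * a powr D)"
proof -
  define N where "N = c2 * (B + a) powr D / (c1 * a powr D)"
  have fin: "real (card F) \<le> N" if F: "finite F" "F \<subseteq> A" for F
  proof -
    have pos: "0 < c1 * a powr D * (\<delta> ^ n) powr D" using c12 a_pos S.constants by simp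
    have sets: "cball (ctr v) (a * \<delta> ^ n) \<in> sets m" for v by (intro borel_m(2)) simp
    have "real (card F) * (c1 * a powr D * (\<delta> ^ n) powr D)
      \<le> (\<Sum>v\<in>F. measure m (cball (ctr v) (a * \<delta> ^ n)))"
    proof -
      have "c1 * a powr D * (\<delta> ^ n) powr D \<le> measure m (cball (ctr v) (a * \<delta> ^ n))" for v
        using measure_cball_ge[of "a * \<delta> ^ n" "ctr v"] a_pos a_le delta_pow[of n] R_pos
        by (simp add: powr_mult mult.assoc order_trans[OF mult_left_le])
      then show ?thesis using sum_bounded_below[of F "c1 * a powr D * (\<delta> ^ n) powr D"] by simp
    qed
    also have "\<dots> = measure m (\<Union>v\<in>F. cball (ctr v) (a * \<delta> ^ n))"
    proof (rule M.finite_measure_finite_Union[symmetric])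
      show "disjoint_family_on (\<lambda>v. cball (ctr v) (a * \<delta> ^ n)) F"
        unfolding disjoint_family_on_def
      proof (intro ballI impI)
        fix v w assume "v \<in> F" "w \<in> F" "v \<noteq> w"
        then show "cball (ctr v) (a * \<delta> ^ n) \<inter> cball (ctr w) (a * \<delta> ^ n) = {}"
          using C_disjoint[of v n w] cball_ctr[of v n] cball_ctr[of w n] F A by blast
      qed
    qed (use F sets in auto)
    also have "\<dots> \<le> measure m (cball x ((B + a) * \<delta> ^ n))"
    proof (intro M.finite_measure_mono borel_m(2) closed_cball UN_least subsetI)
      fix v y assume v: "v \<in> F" "y \<in> cball (ctr v) (a * \<delta> ^ n)"
      have "dist x y \<le> dist x (ctr v) + dist (ctr v) y" by (rule dist_triangle)
      also have "\<dots> \<le> B * \<delta> ^ n + a * \<delta> ^ n" using v near[of v] F by auto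
      finally show "y \<in> cball x ((B + a) * \<delta> ^ n)" by (simp add: algebra_simps)
    qed
    also have "\<dots> \<le> c2 * ((B + a) * \<delta> ^ n) powr D"
      using B a_pos delta_pow[of n] by (intro measure_cball_le) auto
    also have "\<dots> = c2 * (B + a) powr D * (\<delta> ^ n) powr D"
      using B a_pos delta_pow[of n] by (simp add: powr_mult)
    also have "\<dots> = N * (c1 * a powr D * (\<delta> ^ n) powr D)"
      using A.constants a_pos by (simp add: N_def)
    finally show ?thesis using pos by (simp only: mult_le_cancel_right_pos)
  qed
  \<comment> \<open>Finiteness of \<open>A\<close> is not known beforehand; it follows from the
    uniform bound for its finite subsets.\<close>
  have "finite A \<and> card A \<le> nat \<lfloor>N\<rfloor>"
  proof (rule finite_if_finite_subsets_card_bdd)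
    fix F assume "F \<subseteq> A" "finite F"
    then show "card F \<le> nat \<lfloor>N\<rfloor>" using fin by (simp add: le_nat_floor)
  qed
  then show ?thesis using fin[of A] by (simp add: N_def)
qed

lemma finite_layer: "finite (layer n)"
proof -
  \<comment> \<open>With \<open>B = R / \<delta> ^ n\<close> every centre counts as near, whatever
    the base point.\<close>
  have "finite (layer n) \<and> real (card (layer n)) \<le> c2 * (R / \<delta> ^ n + a) powr D / (c1 * a powr D)"
    using dist_le_R R_pos S.constants by (intro card_cubes_near[where x = undefined]) auto
  then show ?thesis ..
qed

lemma finite_desc: "finite (desc n v)"
  using finite_layer by (simp add: desc_def)

text \<open>The constant of \<open>card_cubes_near\<close> for \<open>B = 2 * c4 + R\<close>: the
  path from centre to centre crosses two cubes and the gap between them.\<close>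

definition N0 :: real where
  "N0 = c2 * (2 * c4 + R + a) powr D / (c1 * a powr D)"

lemma card_nbrs: assumes "v \<in> tree I" shows "finite (nbrs v)" "real (card (nbrs v)) \<le> N0"
proof -
  let ?n = "level v"
  have v: "v \<in> layer ?n" "ctr v \<in> closure (C v)"
    using tree_layer[OF assms] ctr_in_closure by blast+
  have "finite (nbrs v) \<and> real (card (nbrs v)) \<le> c2 * ((2 * c4 + R) + a) powr D / (c1 * a powr D)"
  proof (rule card_cubes_near[where x = "ctr v"])
    show "nbrs v \<subseteq> layer ?n" by (auto simp: nbrs_def)
    fix w assume w: "w \<in> nbrs v"
    then obtain x y where xy: "x \<in> closure (C v)" "y \<in> closure (C w)" "dist x y \<le> R * \<delta> ^ ?n"
      by (auto simp: nbrs_def)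
    have w': "w \<in> layer ?n" "ctr w \<in> closure (C w)"
      using w ctr_in_closure unfolding nbrs_def by blast+
    have "dist (ctr v) (ctr w) \<le> dist (ctr v) x + dist x y + dist y (ctr w)"
      by (meson dist_triangle order_trans add_right_mono dist_triangle_le le_refl)
    also have "\<dots> \<le> c4 * \<delta> ^ ?n + R * \<delta> ^ ?n + c4 * \<delta> ^ ?n"
      using dist_closure_C[OF v(1) v(2) xy(1)] dist_closure_C[OF w'(1) xy(2) w'(2)] xy(3) by linarith
    finally show "dist (ctr v) (ctr w) \<le> (2 * c4 + R) * \<delta> ^ ?n" by (simp add: algebra_simps)
  qed (use S.constants R_pos in auto)
  then show "finite (nbrs v)" "real (card (nbrs v)) \<le> N0" by (auto simp: N0_def add.assoc)
qed

lemma N0_nonneg: "0 \<le> N0"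
  using A.constants by (auto simp: N0_def)

lemma nbrs_sym: "v \<in> tree I \<Longrightarrow> w \<in> nbrs v \<Longrightarrow> v \<in> nbrs w"
  by (fastforce simp: nbrs_def layer_def dist_commute)

section \<open>Regrouping by ancestors; covering by children\<close>

lemma sum_layer_desc:
  fixes f :: "'i vertex \<Rightarrow> 'b::comm_monoid_add"
  assumes "k \<le> l"
  shows "(\<Sum>w\<in>layer l. f w) = (\<Sum>v\<in>layer k. \<Sum>w\<in>desc l v. f w)"
proof -
  have "(\<Sum>v\<in>layer k. \<Sum>w\<in>{w \<in> layer l. anc k w = v}. f w) = (\<Sum>w\<in>layer l. f w)"
    using anc assms by (intro sum.group finite_layer) auto
  moreover have "{w \<in> layer l. anc k w = v} = desc l v" if "v \<in> layer k" for v
    using anc_eq_iff[OF _ assms that] by (auto simp: desc_def)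
  ultimately show ?thesis by simp
qed

lemma sum_desc_desc:
  fixes f :: "'i vertex \<Rightarrow> 'b::comm_monoid_add"
  assumes "u \<in> layer j" "j \<le> k" "k \<le> l"
  shows "(\<Sum>w\<in>desc l u. f w) = (\<Sum>v\<in>desc k u. \<Sum>w\<in>desc l v. f w)"
proof -
  have "(\<Sum>v\<in>desc k u. \<Sum>w\<in>{w \<in> desc l u. anc k w = v}. f w) = (\<Sum>w\<in>desc l u. f w)"
  proof (intro sum.group finite_desc)
    show "anc k ` desc l u \<subseteq> desc k u"
    proof (rule image_subsetI)
      fix w assume w: "w \<in> desc l u"
      then have w': "w \<in> layer l" "C w \<subseteq> C u" by (auto simp: desc_def)
      have an: "anc k w \<in> layer k" "C w \<subseteq> C (anc k w)" using anc[OF w'(1) assms(3)] .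
      have "ctr w \<in> C w" using w' ctr_in by blast
      then show "anc k w \<in> desc k u" using C_nested[OF assms(1) an(1) assms(2)] an w' 
        by (auto simp: desc_def)
    qed
  qed
  moreover have "{w \<in> desc l u. anc k w = v} = desc l v" if "v \<in> desc k u" for v
    using anc_eq_iff[OF _ assms(3), of _ v] that by (auto simp: desc_def)
  ultimately show ?thesis by simp
qed

lemma desc_self: assumes v: "v \<in> layer n" shows "desc n v = {v}"
proof -
  have "w = v" if "w \<in> layer n" "C w \<subseteq> C v" for w
    using C_eq[OF that(1) v] ctr_in[OF that(1)] that(2) by blast
  then show ?thesis using v by (auto simp only: desc_def)
qed

lemma AE_layer: "AE x in m. x \<in> (\<Union>v\<in>layer n. C v)"
proof (rule AE_I)
  have eq: "(\<Union>v\<in>layer n. C v) = (\<Union>\<alpha>\<in>I n. Q n \<alpha>)"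
  proof -
    have "layer n = Pair n ` I n" by (auto simp: layer_iff)
    then show ?thesis by (simp add: cube_def)
  qed
  show "{x \<in> space m. \<not> x \<in> (\<Union>v\<in>layer n. C v)} \<subseteq> UNIV - (\<Union>\<alpha>\<in>I n. Q n \<alpha>)"
    unfolding eq by auto
  show "emeasure m (UNIV - (\<Union>\<alpha>\<in>I n. Q n \<alpha>)) = 0" by (rule S.full_measure)
  show "UNIV - (\<Union>\<alpha>\<in>I n. Q n \<alpha>) \<in> sets m"
    using S.open_cube by (intro borel_m) (auto simp: Compl_eq_Diff_UNIV[symmetric] intro!: open_UN)
qed

text \<open>Children exhaust their parent only up to a null set, but by regularity a nonempty open
  set has positive measure, so their union is dense in the parent. Being a finite union, its closure
  is the union of the closures.\<close>

lemma closure_C_children: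
  assumes v: "v \<in> layer n" and x: "x \<in> closure (C v)"
  obtains w where "w \<in> desc (Suc n) v" "x \<in> closure (C w)"
proof -
  let ?U = "closure (\<Union>w\<in>desc (Suc n) v. C w)"
  have "C v \<subseteq> ?U"
  proof (rule ccontr)
    assume "\<not> C v \<subseteq> ?U"
    then obtain y where y: "y \<in> C v - ?U" by auto
    have op: "open (C v - ?U)" using open_C[OF layer_tree[OF v]] by (simp add: open_Diff)
    have pos: "0 < measure m (C v - ?U)" using open_measure_pos[OF op y] .
    have "emeasure m (C v - ?U) = 0"
    proof (rule AE_iff_measurable[THEN iffD1, rotated 2])
      show "AE x in m. \<not> x \<in> C v - ?U"
        using AE_layer[of "Suc n"]
      proof eventually_elim
        case (elim x)
        then obtain w where w: "w \<in> layer (Suc n)" "x \<in> C w" by blast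
        show "\<not> x \<in> C v - ?U"
        proof (cases "C w \<subseteq> C v")
          case True
          then have "w \<in> desc (Suc n) v" using w by (simp add: desc_def)
          then show ?thesis using w closure_subset[of "\<Union>w\<in>desc (Suc n) v. C w"] by auto
        next
          case False
          then show ?thesis using C_nested[OF v w(1)] w by auto
        qed
      qed
    qed (use op space_m in \<open>auto intro: borel_m\<close>)
    then show False using pos by (simp add: M.emeasure_eq_measure)
  qed
  then have "closure (C v) \<subseteq> ?U" by (simp add: closure_minimal)
  also have "?U \<subseteq> (\<Union>w\<in>desc (Suc n) v. closure (C w))"
    using finite_desc closure_subset by (intro closure_minimal closed_UN) (blast, auto)
  finally show thesis using x that by auto
qed

section \<open>The boundary of the tree\<close>

abbreviation bd :: "'i ray set" where "bd \<equiv> tree_boundary I Q rt"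
abbreviation Lam :: "'i ray \<Rightarrow> 'a" where "Lam \<equiv> boundary_map Q"

lemma ray_layer: "\<xi> \<in> bd \<Longrightarrow> \<xi> n \<in> layer n"
  by (auto simp: tree_boundary_def geodesic_def walk_def layer_def)

lemma ray_desc: "\<xi> \<in> bd \<Longrightarrow> \<xi> (Suc n) \<in> desc (Suc n) (\<xi> n)"
proof -
  assume \<xi>: "\<xi> \<in> bd"
  then have "tree_edge Q (\<xi> n) (\<xi> (Suc n))" "level (\<xi> n) = n" "level (\<xi> (Suc n)) = Suc n"
    by (auto simp: tree_boundary_def geodesic_def walk_def)
  then show ?thesis using ray_layer[OF \<xi>, of "Suc n"] by (simp add: desc_def tree_edge_def)
qed

lemma desc_layer: "w \<in> desc n v \<Longrightarrow> w \<in> layer n" "w \<in> desc n v \<Longrightarrow> C w \<subseteq> C v"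
  by (simp_all add: desc_def)

lemma desc_chain_mono:
  assumes "\<And>n. \<xi> (Suc n) \<in> desc (Suc n) (\<xi> n)" "n \<le> k"
  shows "C (\<xi> k) \<subseteq> C (\<xi> n)"
  using assms(2) by (induction rule: dec_induct) (use desc_layer(2)[OF assms(1)] in blast)+

lemma ray_mono: "\<xi> \<in> bd \<Longrightarrow> n \<le> k \<Longrightarrow> C (\<xi> k) \<subseteq> C (\<xi> n)"
  using desc_chain_mono[of \<xi>] ray_desc by blast

lemma walk_level: "walk I Q \<gamma> n \<Longrightarrow> level (\<gamma> n) \<le> level (\<gamma> 0) + n"
proof (induction n)
  case (Suc n)
  have "walk I Q \<gamma> n" "tree_edge Q (\<gamma> n) (\<gamma> (Suc n))" using Suc(2) by (auto simp: walk_def)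
  then show ?case using Suc(1) by (auto simp: tree_edge_def)
qed simp

text \<open>An edge changes the level by one, so level \<open>n\<close> cannot be reached from the
  root in fewer than \<open>n\<close> steps; hence a chain of children is automatically
  geodesic.\<close>

lemma rayI:
  assumes 0: "\<xi> 0 = (0, rt)" and d: "\<And>n. \<xi> (Suc n) \<in> desc (Suc n) (\<xi> n)"
  shows "\<xi> \<in> bd"
proof -
  have lay: "\<xi> n \<in> layer n" for n
    using desc_layer(1)[OF d] by (cases n) (simp_all add: 0 layer_0)
  have lev: "level (\<xi> n) = n" for n using lay layerD by blast
  have "walk I Q \<xi> n" for n
    using layer_tree[OF lay] desc_layer(2)[OF d] by (auto simp: walk_def tree_edge_def lev)
  moreover have "n \<le> n'" if "walk I Q \<gamma>' n'" "\<gamma>' 0 = \<xi> 0" "\<gamma>' n' = \<xi> n" for \<gamma>' n n'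
    using walk_level[OF that(1)] that lev[of n] lev[of 0] by simp
  ultimately show ?thesis by (auto simp: tree_boundary_def 0 lev geodesic_def)
qed

lemma delta_to_0: "(\<lambda>n. c * \<delta> ^ n) \<longlonglongrightarrow> 0"
  using S.constants by (intro tendsto_mult_right_zero LIMSEQ_realpow_zero) auto

text \<open>Completeness gives a limit of the centres, and the shrinking diameters give its
  uniqueness; together they make the definite description in \<open>boundary_map\<close>
  meaningful.\<close>

lemma ray_limit:
  assumes "\<xi> \<in> bd"
  shows "Lam \<xi> \<in> closure (C (\<xi> n))" and "(\<And>n. x \<in> closure (C (\<xi> n))) \<Longrightarrow> x = Lam \<xi>"
proof -
  have lay: "\<xi> n \<in> layer n" for n using ray_layer[OF assms] .
  have in_cl: "ctr (\<xi> k) \<in> closure (C (\<xi> n))" if "n \<le> k" for n k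
    using ray_mono[OF assms that] ctr_in[OF lay] closure_subset by blast
  have "Cauchy (\<lambda>n. ctr (\<xi> n))"
  proof (rule metric_CauchyI)
    fix e :: real assume "0 < e"
    then obtain N where N: "c4 * \<delta> ^ N < e"
      using order_tendstoD(2)[OF delta_to_0, of e c4] by (auto simp: eventually_sequentially)
    have "dist (ctr (\<xi> i)) (ctr (\<xi> j)) < e" if "N \<le> i" "N \<le> j" for i j
      using dist_closure_C[OF lay in_cl[OF that(1)] in_cl[OF that(2)]] N by linarith
    then show "\<exists>N. \<forall>i\<ge>N. \<forall>j\<ge>N. dist (ctr (\<xi> i)) (ctr (\<xi> j)) < e" by blast
  qed
  then obtain l where l: "(\<lambda>n. ctr (\<xi> n)) \<longlonglongrightarrow> l" using Cauchy_convergent convergentD by blast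
  have l_in: "l \<in> closure (C (\<xi> n))" for n
    by (rule Lim_in_closed_set[OF _ _ _ l]) (auto simp: eventually_sequentially intro: in_cl)
  have uniq: "x = y" if "\<And>n. x \<in> closure (C (\<xi> n))" "\<And>n. y \<in> closure (C (\<xi> n))" for x y
  proof -
    have "dist x y \<le> c4 * \<delta> ^ n" for n using dist_closure_C[OF lay that] .
    then have "dist x y \<le> 0" using delta_to_0[of c4] by (intro LIMSEQ_le_const) auto
    then show ?thesis by simp
  qed
  have Lam: "Lam \<xi> = l" unfolding boundary_map_def
    by (rule the_equality) (use l_in uniq in blast)+
  then show "Lam \<xi> \<in> closure (C (\<xi> n))" using l_in by simp
  show "(\<And>n. x \<in> closure (C (\<xi> n))) \<Longrightarrow> x = Lam \<xi>" using uniq l_in Lam by simp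
qed

lemma Lam_dist: "\<xi> \<in> bd \<Longrightarrow> x \<in> closure (C (\<xi> n)) \<Longrightarrow> dist x (Lam \<xi>) \<le> c4 * \<delta> ^ n"
  using dist_closure_C[of "\<xi> n" n x "Lam \<xi>"] ray_layer ray_limit(1) by blast

text \<open>Presents the end point of a ray as a limit of functions of single vertices, from which
  measurability is obtained in \<open>flow_measure\<close>.\<close>

lemma Lam_tendsto: "\<xi> \<in> bd \<Longrightarrow> (\<lambda>n. ctr (\<xi> n)) \<longlonglongrightarrow> Lam \<xi>"
proof (rule metric_tendsto_imp_tendsto[OF delta_to_0[of c4]])
  assume \<xi>: "\<xi> \<in> bd"
  show "\<forall>\<^sub>F n in sequentially. dist (ctr (\<xi> n)) (Lam \<xi>) \<le> dist (c4 * \<delta> ^ n) 0"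
    using Lam_dist[OF \<xi> ctr_in_closure[OF ray_layer[OF \<xi>]]] 
    by (auto intro!: always_eventually order_trans[OF _ abs_ge_self])
qed

text \<open>Descend through children whose closures contain the point. Because closures are used,
  this reaches also the points that lie in no open cube of some layer.\<close>

lemma Lam_surj: obtains \<xi> where "\<xi> \<in> bd" "Lam \<xi> = x"
proof -
  have "\<exists>\<xi>. \<forall>n. (\<xi> n \<in> layer n \<and> x \<in> closure (C (\<xi> n))) \<and> \<xi> (Suc n) \<in> desc (Suc n) (\<xi> n)"
  proof (rule dependent_nat_choice)
    show "\<exists>v. v \<in> layer 0 \<and> x \<in> closure (C v)" by (simp add: layer_0 C_root)
    fix v n assume "v \<in> layer n \<and> x \<in> closure (C v)"
    then show "\<exists>w. (w \<in> layer (Suc n) \<and> x \<in> closure (C w)) \<and> w \<in> desc (Suc n) v"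
      using closure_C_children desc_layer(1) by metis
  qed
  then obtain \<xi> where \<xi>: "\<And>n. \<xi> n \<in> layer n" "\<And>n. x \<in> closure (C (\<xi> n))"
    "\<And>n. \<xi> (Suc n) \<in> desc (Suc n) (\<xi> n)" by blast
  have "\<xi> 0 = (0, rt)" using \<xi>(1)[of 0] by (simp add: layer_0)
  then have "\<xi> \<in> bd" using \<xi>(3) by (intro rayI)
  then show thesis using that ray_limit(2)[of \<xi> x] \<xi>(2) by metis
qed

lemma ray_anc: "\<xi> \<in> bd \<Longrightarrow> k \<le> n \<Longrightarrow> anc k (\<xi> n) = \<xi> k"
  by (intro anc_eqI[of _ n] ray_layer ray_mono)

lemma ray_agree: "\<xi> \<in> bd \<Longrightarrow> \<eta> \<in> bd \<Longrightarrow> \<xi> n = \<eta> n \<Longrightarrow> k \<le> n \<Longrightarrow> \<xi> k = \<eta> k"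
  by (metis ray_anc)

section \<open>Closed sets of rays and the topology of the boundary\<close>

text \<open>Closedness in \<open>boundary_topology\<close>, stated level by level: the shadows of
  the vertices of a ray form a neighbourhood base at it, and two rays that agree at level
  \<open>n\<close> agree at all earlier levels.\<close>

definition closed_rays :: "'i ray set \<Rightarrow> bool" where
  "closed_rays K \<longleftrightarrow> K \<subseteq> bd \<and> (\<forall>\<xi>\<in>bd. (\<forall>n. \<exists>\<eta>\<in>K. \<eta> n = \<xi> n) \<longrightarrow> \<xi> \<in> K)"

text \<open>Rays with a common vertex at level \<open>n\<close> have end points at distance at most
  \<open>c4 * \<delta> ^ n\<close>.\<close>

lemma closed_rays_vimage:
  assumes "closed F" shows "closed_rays {\<xi> \<in> bd. Lam \<xi> \<in> F}"
  unfolding closed_rays_def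
proof (intro conjI ballI impI)
  fix \<xi> assume \<xi>: "\<xi> \<in> bd" "\<forall>n. \<exists>\<eta>\<in>{\<xi> \<in> bd. Lam \<xi> \<in> F}. \<eta> n = \<xi> n"
  have "Lam \<xi> \<in> closure F" unfolding closure_approachable
  proof (intro allI impI)
    fix e :: real assume "0 < e"
    then obtain n where n: "c4 * \<delta> ^ n < e"
      using order_tendstoD(2)[OF delta_to_0, of e c4] by (auto simp: eventually_sequentially)
    obtain \<eta> where \<eta>: "\<eta> \<in> bd" "Lam \<eta> \<in> F" "\<eta> n = \<xi> n" using \<xi>(2) by blast
    have "dist (Lam \<eta>) (Lam \<xi>) \<le> c4 * \<delta> ^ n"
      using Lam_dist[OF \<xi>(1)] ray_limit(1)[OF \<eta>(1), of n] \<eta>(3) by simp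
    then show "\<exists>y\<in>F. dist y (Lam \<xi>) < e" using \<eta> n by force
  qed
  then show "\<xi> \<in> {\<xi> \<in> bd. Lam \<xi> \<in> F}" using \<xi> assms by simp
qed auto

abbreviation shadow :: "'i vertex \<Rightarrow> 'i ray set" where "shadow \<equiv> boundary_shadow I Q rt"

lemma in_shadow_iff: "v \<in> layer n \<Longrightarrow> \<xi> \<in> shadow v \<longleftrightarrow> \<xi> \<in> bd \<and> \<xi> n = v"
  using ray_layer layerD unfolding boundary_shadow_def by (metis (mono_tags, lifting) mem_Collect_eq rangeE rangeI)

lemma openin_shadow: "v \<in> tree I \<Longrightarrow> openin (boundary_topology I Q rt) (shadow v)"
  unfolding boundary_topology_def by (intro topology_generated_by_Basis) auto

lemma topspace_boundary: "topspace (boundary_topology I Q rt) = bd"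
proof
  show "topspace (boundary_topology I Q rt) \<subseteq> bd"
    by (auto simp: boundary_topology_def topology_generated_by_topspace boundary_shadow_def)
  show "bd \<subseteq> topspace (boundary_topology I Q rt)"
  proof
    fix \<xi> assume "\<xi> \<in> bd"
    then have "\<xi> \<in> shadow (\<xi> 0)" "\<xi> 0 \<in> tree I" using in_shadow_iff ray_layer layer_tree by blast+
    then show "\<xi> \<in> topspace (boundary_topology I Q rt)"
      using openin_shadow openin_subset by blast
  qed
qed

lemma continuous_Lam: "continuous_map (boundary_topology I Q rt) euclidean Lam"
  unfolding continuous_map
proof (intro conjI allI impI)
  fix U :: "'a set" assume U: "openin euclidean U"
  show "openin (boundary_topology I Q rt) {\<xi> \<in> topspace (boundary_topology I Q rt). Lam \<xi> \<in> U}"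
  proof (subst openin_subopen, intro ballI)
    fix \<xi> assume "\<xi> \<in> {\<xi> \<in> topspace (boundary_topology I Q rt). Lam \<xi> \<in> U}"
    then have \<xi>: "\<xi> \<in> bd" "Lam \<xi> \<in> U" by (auto simp: topspace_boundary)
    then obtain e where e: "0 < e" "ball (Lam \<xi>) e \<subseteq> U" using U by (auto elim: openE)
    then obtain n where n: "c4 * \<delta> ^ n < e"
      using order_tendstoD(2)[OF delta_to_0, of e c4] by (auto simp: eventually_sequentially)
    have lay: "\<xi> n \<in> layer n" using \<xi> ray_layer by blast
    have "Lam \<eta> \<in> U" if "\<eta> \<in> bd" "\<eta> n = \<xi> n" for \<eta>
    proof -
      have "dist (Lam \<xi>) (Lam \<eta>) \<le> c4 * \<delta> ^ n"
        using Lam_dist[OF that(1)] ray_limit(1)[OF \<xi>(1), of n] that(2) by simp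
      then show ?thesis using e n by auto
    qed
    then show "\<exists>T. openin (boundary_topology I Q rt) T \<and> \<xi> \<in> T \<and>
        T \<subseteq> {\<xi> \<in> topspace (boundary_topology I Q rt). Lam \<xi> \<in> U}"
      using in_shadow_iff[OF lay] openin_shadow[OF layer_tree[OF lay]] \<xi>
      by (intro exI[of _ "shadow (\<xi> n)"]) (auto simp: topspace_boundary)
  qed
qed auto

lemma closed_Lam_image: "compactin (boundary_topology I Q rt) K \<Longrightarrow> closed (Lam ` K)"
  using image_compactin[OF _ continuous_Lam] by (auto intro: compact_imp_closed)

text \<open>If \<open>\<xi>\<close> were outside \<open>K\<close>, the open sets \<open>V n\<close>
  of rays that differ from \<open>\<xi>\<close> at level \<open>n\<close>, which increase with
  \<open>n\<close>, would cover \<open>K\<close>. A finite subcover misses the rays of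
  \<open>K\<close> that follow \<open>\<xi>\<close> up to its largest index.\<close>

lemma closed_rays_compact:
  assumes K: "compactin (boundary_topology I Q rt) K" shows "closed_rays K"
  unfolding closed_rays_def
proof (intro conjI ballI impI)
  show Ksub: "K \<subseteq> bd" using compactin_subset_topspace[OF K] by (simp add: topspace_boundary)
  fix \<xi> assume \<xi>: "\<xi> \<in> bd" "\<forall>n. \<exists>\<eta>\<in>K. \<eta> n = \<xi> n"
  define V where "V n = bd - shadow (\<xi> n)" for n
  have V_iff: "\<eta> \<in> V n \<longleftrightarrow> \<eta> \<in> bd \<and> \<eta> n \<noteq> \<xi> n" for \<eta> n
    using in_shadow_iff[OF ray_layer[OF \<xi>(1)]] by (auto simp: V_def)
  have op: "openin (boundary_topology I Q rt) (V n)" for n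
  proof (subst openin_subopen, intro ballI)
    fix \<eta> assume \<eta>: "\<eta> \<in> V n"
    then have lay: "\<eta> n \<in> layer n" using ray_layer V_iff by blast
    show "\<exists>T. openin (boundary_topology I Q rt) T \<and> \<eta> \<in> T \<and> T \<subseteq> V n"
      using openin_shadow[OF layer_tree[OF lay]] \<eta>
      by (intro exI[of _ "shadow (\<eta> n)"]) (auto simp: V_iff in_shadow_iff[OF lay])
  qed
  show "\<xi> \<in> K"
  proof (rule ccontr)
    assume "\<xi> \<notin> K"
    have "K \<subseteq> \<Union> (range V)"
    proof
      fix \<eta> assume "\<eta> \<in> K"
      then have "\<eta> \<noteq> \<xi>" "\<eta> \<in> bd" using \<open>\<xi> \<notin> K\<close> Ksub by auto
      then show "\<eta> \<in> \<Union> (range V)" using V_iff by (auto simp: fun_eq_iff)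
    qed
    then obtain \<F> where \<F>: "finite \<F>" "\<F> \<subseteq> range V" "K \<subseteq> \<Union> \<F>"
      using K op unfolding compactin_def by (metis (no_types, lifting) imageE)
    then obtain N where N: "finite N" "\<F> = V ` N" by (meson finite_subset_image)
    \<comment> \<open>Inserting 0 keeps \<open>Max\<close> meaningful in case the subcover is
      empty.\<close>
    obtain \<eta> where \<eta>: "\<eta> \<in> K" "\<eta> (Max (insert 0 N)) = \<xi> (Max (insert 0 N))" using \<xi>(2) by blast
    then obtain n where n: "n \<in> N" "\<eta> \<in> V n" using \<F> N by blast
    have "\<eta> n = \<xi> n" using ray_agree[of \<eta> \<xi>, OF _ \<xi>(1) \<eta>(2), of n] \<eta>(1) Ksub n N by auto
    then show False using n V_iff by blast
  qed
qed

section \<open>From flows on the tree to measures on the space\<close>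

abbreviation chd :: "'i vertex \<Rightarrow> 'i vertex set" where
  "chd v \<equiv> desc (Suc (level v)) v"

lemma chd_tree: "w \<in> chd v \<Longrightarrow> w \<in> tree I"
  using desc_layer(1) layer_tree by blast

abbreviation root :: "'i vertex" where "root \<equiv> (0, rt)"

text \<open>A unit flow from the root, that is, a probability measure on the boundary recorded
  through the masses of shadows.\<close>

definition tree_flow :: "('i vertex \<Rightarrow> real) \<Rightarrow> bool" where
  "tree_flow \<mu> \<longleftrightarrow> \<mu> root = 1 \<and> (\<forall>v\<in>tree I. 0 \<le> \<mu> v \<and> (\<Sum>w\<in>chd v. \<mu> w) = \<mu> v)"

lemma flow_sum_desc:
  assumes "tree_flow \<mu>" "v \<in> layer k" "k \<le> n"
  shows "(\<Sum>w\<in>desc n v. \<mu> w) = \<mu> v"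
  using assms(3)
proof (induction n rule: dec_induct)
  case base
  then show ?case using desc_self[OF assms(2)] by simp
next
  case (step n)
  have "(\<Sum>w\<in>desc (Suc n) v. \<mu> w) = (\<Sum>u\<in>desc n v. \<Sum>w\<in>desc (Suc n) u. \<mu> w)"
    using step by (intro sum_desc_desc[OF assms(2)]) auto
  also have "\<dots> = (\<Sum>u\<in>desc n v. \<mu> u)"
  proof (rule sum.cong[OF refl])
    fix u assume "u \<in> desc n v"
    then have "u \<in> tree I" "level u = n" using desc_layer(1) layerD by blast+
    then show "(\<Sum>w\<in>desc (Suc n) u. \<mu> w) = \<mu> u" using assms(1) by (auto simp only: tree_flow_def)
  qed
  finally show ?case using step by simp
qed

text \<open>The flow cuts the unit interval into intervals of length \<open>\<mu> v\<close> indexed by the vertices of a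
  layer, refining as the level grows; a point of the unit interval thus picks out a ray.\<close>

lemma flow_partition:
  assumes \<mu>: "tree_flow \<mu>"
  shows "\<exists>V. \<forall>n. ((\<forall>t\<in>{0..<1}. V n t \<in> layer n) \<and>
      (\<forall>v\<in>layer n. \<exists>y. {t \<in> {0..<1}. V n t = v} = {y..<y + \<mu> v})) \<and>
      (\<forall>t\<in>{0..<1::real}. V (Suc n) t \<in> desc (Suc n) (V n t))"
proof (rule dependent_nat_choice)
  show "\<exists>V. (\<forall>t\<in>{0..<1::real}. V t \<in> layer 0) \<and>
      (\<forall>v\<in>layer 0. \<exists>y. {t \<in> {0..<1}. V t = v} = {y..<y + \<mu> v})"
  proof (intro exI[of _ "\<lambda>_. root"] conjI ballI)
    fix v assume "v \<in> layer 0"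
    then have v: "v = root" by (simp add: layer_0)
    have "{t \<in> {0..<1}. root = v} = {0..<0 + \<mu> v}" using \<mu> by (auto simp: v tree_flow_def)
    then show "\<exists>y. {t \<in> {0..<1}. root = v} = {y..<y + \<mu> v}" by blast
  qed (simp add: layer_0)
next
  fix V :: "real \<Rightarrow> 'i vertex" and n
  assume "(\<forall>t\<in>{0..<1}. V t \<in> layer n) \<and> (\<forall>v\<in>layer n. \<exists>y. {t \<in> {0..<1}. V t = v} = {y..<y + \<mu> v})"
  then have V: "\<And>t. t \<in> {0..<1} \<Longrightarrow> V t \<in> layer n"
    and "\<forall>v\<in>layer n. \<exists>y. {t \<in> {0..<1}. V t = v} = {y..<y + \<mu> v}" by blast+
  then obtain y where y: "\<And>v. v \<in> layer n \<Longrightarrow> {t \<in> {0..<1}. V t = v} = {y v..<y v + \<mu> v}" by metis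
  have sum: "sum \<mu> (desc (Suc n) v) = \<mu> v" if "v \<in> layer n" for v
    using flow_sum_desc[OF \<mu> that, of "Suc n"] by simp
  have "\<forall>v\<in>layer n. \<exists>f. (\<forall>t\<in>{y v..<y v + \<mu> v}. f t \<in> desc (Suc n) v) \<and>
    (\<forall>w\<in>desc (Suc n) v. \<exists>x. {t \<in> {y v..<y v + \<mu> v}. f t = w} = {x..<x + \<mu> w})"
  proof
    fix v assume v: "v \<in> layer n"
    have "0 \<le> \<mu> w" if "w \<in> desc (Suc n) v" for w
      using \<mu> that desc_layer(1) layer_tree unfolding tree_flow_def by blast
    from interval_partition[where A = "desc (Suc n) v" and \<mu> = \<mu> and x = "y v", OF finite_desc this]
    show "\<exists>f. (\<forall>t\<in>{y v..<y v + \<mu> v}. f t \<in> desc (Suc n) v) \<and>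
      (\<forall>w\<in>desc (Suc n) v. \<exists>x. {t \<in> {y v..<y v + \<mu> v}. f t = w} = {x..<x + \<mu> w})"
      unfolding sum[OF v] by blast
  qed
  from bchoice[OF this] obtain f where "\<forall>v\<in>layer n. (\<forall>t\<in>{y v..<y v + \<mu> v}. f v t \<in> desc (Suc n) v) \<and>
    (\<forall>w\<in>desc (Suc n) v. \<exists>x. {t \<in> {y v..<y v + \<mu> v}. f v t = w} = {x..<x + \<mu> w})" ..
  then have f: "\<And>v t. v \<in> layer n \<Longrightarrow> t \<in> {y v..<y v + \<mu> v} \<Longrightarrow> f v t \<in> desc (Suc n) v"
    "\<And>v w. v \<in> layer n \<Longrightarrow> w \<in> desc (Suc n) v \<Longrightarrow> \<exists>x. {t \<in> {y v..<y v + \<mu> v}. f v t = w} = {x..<x + \<mu> w}"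
    by blast+
  define V' where "V' t = f (V t) t" for t
  have V': "V' t \<in> desc (Suc n) (V t)" if "t \<in> {0..<1}" for t
  proof -
    have "t \<in> {y (V t)..<y (V t) + \<mu> (V t)}" using y[OF V[OF that]] that by blast
    then show ?thesis using f(1)[OF V[OF that]] by (simp add: V'_def)
  qed
  have "\<exists>x. {t \<in> {0..<1}. V' t = w} = {x..<x + \<mu> w}" if w: "w \<in> layer (Suc n)" for w
  proof -
    \<comment> \<open>\<open>V' t = w\<close> forces \<open>V t\<close> to be the parent of
      \<open>w\<close>, so the cell of \<open>w\<close> is cut out of a single cell of the previous
      layer, where it is an interval.\<close>
    define v where "v = anc n w"
    have v: "v \<in> layer n" "C w \<subseteq> C v" using anc[OF w, of n] by (simp_all add: v_def)
    have wv: "w \<in> desc (Suc n) v" using w v by (simp add: desc_def)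
    have "V t = v" if "t \<in> {0..<1}" "V' t = w" for t
      using anc_eqI[OF w _ V[OF that(1)]] V'[OF that(1)] that(2) desc_layer(2)[of w] by (simp add: v_def)
    then have "{t \<in> {0..<1}. V' t = w} = {t \<in> {t \<in> {0..<1}. V t = v}. f v t = w}"
      by (auto simp: V'_def)
    also have "\<dots> = {t \<in> {y v..<y v + \<mu> v}. f v t = w}" by (simp only: y[OF v(1)])
    finally show ?thesis using f(2)[OF v(1) wv] by simp
  qed
  then show "\<exists>V'. ((\<forall>t\<in>{0..<1}. V' t \<in> layer (Suc n)) \<and>
      (\<forall>v\<in>layer (Suc n). \<exists>y. {t \<in> {0..<1}. V' t = v} = {y..<y + \<mu> v})) \<and>
      (\<forall>t\<in>{0..<1::real}. V' t \<in> desc (Suc n) (V t))"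
    using V' desc_layer(1) by (intro exI[of _ V'] conjI ballI) blast+
qed

text \<open>The last conclusion is only an inequality: a point on the boundary of several cubes lies
  in all their closures, whereas the ray that produces it passes through just one of them.\<close>

lemma flow_measure:
  assumes \<mu>: "tree_flow \<mu>" and K: "closed_rays K"
    and tr: "\<And>v. v \<in> tree I \<Longrightarrow> 0 < \<mu> v \<Longrightarrow> \<exists>\<xi>\<in>K. \<xi> (level v) = v"
  obtains \<omega> :: "'a measure" where "sets \<omega> = sets borel" "emeasure \<omega> UNIV = 1"
    "\<And>A. A \<in> sets borel \<Longrightarrow> A \<inter> Lam ` K = {} \<Longrightarrow> emeasure \<omega> A = 0"
    "\<And>A N n. A \<in> sets borel \<Longrightarrow> N \<subseteq> layer n \<Longrightarrow>
      (\<And>v. v \<in> layer n \<Longrightarrow> closure (C v) \<inter> A \<noteq> {} \<Longrightarrow> v \<in> N) \<Longrightarrow>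
      emeasure \<omega> A \<le> ennreal (\<Sum>v\<in>N. \<mu> v)"
proof -
  from flow_partition[OF \<mu>] obtain V where V: "\<And>n t. t \<in> {0..<1::real} \<Longrightarrow> V n t \<in> layer n"
    "\<And>n v. v \<in> layer n \<Longrightarrow> \<exists>y. {t \<in> {0..<1}. V n t = v} = {y..<y + \<mu> v}"
    "\<And>n t. t \<in> {0..<1} \<Longrightarrow> V (Suc n) t \<in> desc (Suc n) (V n t)" by blast
  define ray where "ray t = (\<lambda>n. V n t)" for t
  have ray_bd: "ray t \<in> bd" if t: "t \<in> {0..<1}" for t
  proof (rule rayI)
    show "ray t 0 = root" using V(1)[OF t, of 0] by (simp add: ray_def layer_0)
    show "ray t (Suc n) \<in> desc (Suc n) (ray t n)" for n using V(3)[OF t] by (simp add: ray_def)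
  qed
  \<comment> \<open>The cell of \<open>V n t\<close> contains \<open>t\<close>, so it has positive
    length and the flow there is positive; by \<open>tr\<close> the set \<open>K\<close> passes
    through every vertex of the ray, and closedness puts the ray itself into
    \<open>K\<close>.\<close>
  have ray_K: "ray t \<in> K" if t: "t \<in> {0..<1}" for t
  proof -
    have "\<exists>\<eta>\<in>K. \<eta> n = ray t n" for n
    proof -
      have lay: "V n t \<in> layer n" using V(1)[OF t] .
      obtain y where "{u \<in> {0..<1}. V n u = V n t} = {y..<y + \<mu> (V n t)}" using V(2)[OF lay] by blast
      then have "t \<in> {y..<y + \<mu> (V n t)}" using t by blast
      then have "0 < \<mu> (V n t)" by simp
      then obtain \<eta> where "\<eta> \<in> K" "\<eta> (level (V n t)) = V n t" using tr[OF layer_tree[OF lay]] by blast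
      then show ?thesis using layerD[OF lay] by (auto simp: ray_def)
    qed
    then show ?thesis using K ray_bd[OF t] unfolding closed_rays_def by blast
  qed
  define M where "M = restrict_space lborel {0..<1::real}"
  have spM: "space M = {0..<1}" by (simp add: M_def space_restrict_space)
  have M_iff: "J \<in> sets M" if "J \<subseteq> {0..<1}" "J \<in> sets borel" for J
    using that by (auto simp: M_def sets_restrict_space)
  have cell: "{t \<in> {0..<1}. V n t = v} \<in> sets M \<and> emeasure M {t \<in> {0..<1}. V n t = v} = ennreal (\<mu> v)"
    if v: "v \<in> layer n" for n v
  proof -
    obtain y where y: "{t \<in> {0..<1}. V n t = v} = {y..<y + \<mu> v}" using V(2)[OF v] by blast
    have mu: "0 \<le> \<mu> v" using \<mu> layer_tree[OF v] by (simp only: tree_flow_def)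
    have sub: "{y..<y + \<mu> v} \<subseteq> {0..<1}" unfolding y[symmetric] by blast
    have "emeasure M {y..<y + \<mu> v} = emeasure lborel {y..<y + \<mu> v}"
      unfolding M_def using sub by (intro emeasure_restrict_space) auto
    then show ?thesis unfolding y using M_iff[OF sub] mu by simp
  qed
  define lam where "lam t = Lam (ray t)" for t
  \<comment> \<open>Each approximating map takes finitely many values, each on an interval.\<close>
  have lam: "lam \<in> borel_measurable M"
  proof (rule borel_measurable_LIMSEQ_metric)
    show "(\<lambda>n. ctr (V n t)) \<longlonglongrightarrow> lam t" if "t \<in> space M" for t
      using Lam_tendsto[OF ray_bd] that by (simp add: lam_def ray_def spM)
    show "(\<lambda>t. ctr (V n t)) \<in> borel_measurable M" for n
    proof (rule measurable_compose[of "V n" M "count_space (layer n)"])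
      have "V n -` {v} \<inter> space M = {t \<in> {0..<1}. V n t = v}" for v by (auto simp: spM)
      then show "V n \<in> M \<rightarrow>\<^sub>M count_space (layer n)"
        unfolding measurable_count_space_eq2[OF finite_layer] using V(1) cell spM by auto
    qed simp
  qed
  define \<omega> where "\<omega> = distr M borel lam"
  have em: "emeasure \<omega> A = emeasure M {t \<in> {0..<1}. lam t \<in> A}" if "A \<in> sets borel" for A
  proof -
    have "lam -` A \<inter> space M = {t \<in> {0..<1}. lam t \<in> A}" by (auto simp: spM)
    then show ?thesis using that lam by (simp add: \<omega>_def emeasure_distr)
  qed
  show thesis
  proof (rule that[of \<omega>])
    show "sets \<omega> = sets borel" by (simp add: \<omega>_def)
    have "{t \<in> {0..<1}. V 0 t = root} = {0..<1}" using V(1)[of _ 0] by (auto simp: layer_0)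
    then have "emeasure M {0..<1} = 1" using cell[of root 0] \<mu> by (simp add: layer_0 tree_flow_def)
    then show "emeasure \<omega> UNIV = 1" using em[of UNIV] by (simp del: atLeastLessThan_iff)
  next
    fix A :: "'a set" assume "A \<in> sets borel" "A \<inter> Lam ` K = {}"
    moreover have "{t \<in> {0..<1}. lam t \<in> A} = {}" using calculation(2) ray_K unfolding lam_def by blast
    ultimately show "emeasure \<omega> A = 0" using em[of A] by (simp only: emeasure_empty)
  next
    fix A :: "'a set" and N n
    assume A: "A \<in> sets borel" and N: "N \<subseteq> layer n"
      "\<And>v. v \<in> layer n \<Longrightarrow> closure (C v) \<inter> A \<noteq> {} \<Longrightarrow> v \<in> N"
    have fin: "finite N" using N(1) finite_layer finite_subset by blast
    have "{t \<in> {0..<1}. lam t \<in> A} \<subseteq> (\<Union>v\<in>N. {t \<in> {0..<1}. V n t = v})"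
    proof
      fix t assume t: "t \<in> {t \<in> {0..<1}. lam t \<in> A}"
      then have "lam t \<in> closure (C (V n t))" using ray_limit(1)[OF ray_bd, of t n] by (simp add: lam_def ray_def)
      then have "V n t \<in> N" using N(2)[OF V(1)[of t n]] t by blast
      then show "t \<in> (\<Union>v\<in>N. {t \<in> {0..<1}. V n t = v})" using t by blast
    qed
    then have "emeasure \<omega> A \<le> emeasure M (\<Union>v\<in>N. {t \<in> {0..<1}. V n t = v})"
      unfolding em[OF A] using fin N(1) cell by (intro emeasure_mono sets.finite_UN) auto
    also have "\<dots> \<le> (\<Sum>v\<in>N. emeasure M {t \<in> {0..<1}. V n t = v})"
      using fin N(1) cell by (intro emeasure_subadditive_finite) auto
    also have "\<dots> = (\<Sum>v\<in>N. ennreal (\<mu> v))" using N(1) cell by (intro sum.cong refl) blast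
    also have "\<dots> = ennreal (\<Sum>v\<in>N. \<mu> v)"
    proof (rule sum_ennreal)
      fix v assume "v \<in> N"
      then have "v \<in> tree I" using N(1) layer_tree by blast
      then show "0 \<le> \<mu> v" using \<mu> by (simp only: tree_flow_def)
    qed
    finally show "emeasure \<omega> A \<le> ennreal (\<Sum>v\<in>N. \<mu> v)" .
  qed
qed

end

section \<open>The capacity of the space is dominated by that of the tree\<close>

locale dyadic_capacity = dyadic_space m D c1 c2 I Q z rt \<delta> a0 c4
  for m :: "'a::complete_space measure" and D c1 c2 :: real
    and I :: "nat \<Rightarrow> 'i set" and Q :: "nat \<Rightarrow> 'i \<Rightarrow> 'a set" and z :: "nat \<Rightarrow> 'i \<Rightarrow> 'a"
    and rt :: 'i and \<delta> a0 c4 :: real +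
  fixes p q s :: real
  assumes p: "1 < p" and pq: "1 / p + 1 / q = 1" and s: "0 < s" "s < 1"
begin

abbreviation wt :: "'i vertex \<Rightarrow> real" where "wt \<equiv> dyadic_weight m Q s q"
abbreviation ker :: "'a \<Rightarrow> 'a \<Rightarrow> ennreal" where "ker \<equiv> kernel m s"

text \<open>The factor by which the kernel, of size \<open>dist x y powr - (s * D)\<close>, grows
  when the distance shrinks by \<open>\<delta>\<close>.\<close>

definition \<beta> :: real where "\<beta> = \<delta> powr - (s * D)"

lemma q: "1 < q" "q = p / (p - 1)" "q - 1 = 1 / (p - 1)" "(q - 1) * (p - 1) = 1" "p / q = p - 1"
proof -
  have q0: "q \<noteq> 0" using pq p by auto
  then have "q + p = p * q" using pq p by (simp add: field_simps)
  then have "q * (p - 1) = p" by (simp add: algebra_simps)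
  then show 2: "q = p / (p - 1)" using p by (simp add: field_simps)
  show "1 < q" "q - 1 = 1 / (p - 1)" "(q - 1) * (p - 1) = 1" "p / q = p - 1"
    unfolding 2 using p by (simp_all add: field_simps)
qed

lemma beta_gt_1: "1 < \<beta>"
proof -
  have "\<beta> = 1 / \<delta> powr (s * D)" by (simp add: \<beta>_def powr_minus_divide)
  moreover have "\<delta> powr (s * D) < 1" using S.constants s c12 powr_less_mono'[of \<delta> 0 "s * D"] by simp
  ultimately show ?thesis using S.constants by simp
qed

lemma beta_pow: "\<beta> ^ n = (\<delta> ^ n) powr - (s * D)"
  using S.constants by (simp add: \<beta>_def powr_realpow[symmetric] powr_powr mult.commute)

section \<open>Kernel and weight at a given scale\<close>

lemma kernel_eq:
  assumes "x \<noteq> y"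
  obtains t where "ker x y = ennreal (t powr - s)" "2 * c1 * dist x y powr D \<le> t" "t \<le> 2 * c2 * dist x y powr D"
proof -
  define t where "t = measure m (cball x (dist x y)) + measure m (cball y (dist x y))"
  have t: "2 * c1 * dist x y powr D \<le> t" "t \<le> 2 * c2 * dist x y powr D"
    using measure_cball_ge[of "dist x y" x] measure_cball_ge[of "dist x y" y]
      measure_cball_le[of "dist x y" x] measure_cball_le[of "dist x y" y] dist_le_R[of x y]
    unfolding t_def by auto
  have "0 < 2 * c1 * dist x y powr D" using assms c12 by simp
  then have "0 < t" using t by linarith
  then have "ker x y = ennreal (t powr - s)"
    unfolding kernel_def
    by (simp add: M.emeasure_eq_measure ennreal_plus[symmetric] t_def[symmetric] ennpow_ennreal
        inverse_ennreal powr_minus del: ennreal_plus)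
  then show thesis using t that by blast
qed

text \<open>Regularity at radius 0 makes points null sets, because
  \<open>0 powr D = 0\<close>.\<close>

lemma kernel_diag: "ker x x = \<infinity>"
  using A.regular[of 0 x] A.diameter_pos by (simp add: kernel_def ennpow_def)

lemma kernel_ge: "x \<noteq> y \<Longrightarrow> ennreal ((2 * c2) powr - s * dist x y powr - (s * D)) \<le> ker x y"
proof -
  assume xy: "x \<noteq> y"
  from kernel_eq[OF this] obtain t where
    t: "ker x y = ennreal (t powr - s)" "2 * c1 * dist x y powr D \<le> t" "t \<le> 2 * c2 * dist x y powr D" .
  have "0 < 2 * c1 * dist x y powr D" using xy c12 by simp
  then have "(2 * c2 * dist x y powr D) powr - s \<le> t powr - s"
    using t s by (intro powr_mono2') auto
  then show ?thesis using c12 t(1) by (simp add: powr_mult powr_powr mult.commute)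
qed

lemma kernel_le: "x \<noteq> y \<Longrightarrow> ker x y \<le> ennreal ((2 * c1) powr - s * dist x y powr - (s * D))"
proof -
  assume xy: "x \<noteq> y"
  from kernel_eq[OF this] obtain t where
    t: "ker x y = ennreal (t powr - s)" "2 * c1 * dist x y powr D \<le> t" "t \<le> 2 * c2 * dist x y powr D" .
  have "0 < 2 * c1 * dist x y powr D" using xy c12 by simp
  then have "t powr - s \<le> (2 * c1 * dist x y powr D) powr - s"
    using t s by (intro powr_mono2') auto
  then show ?thesis using c12 t(1) by (simp add: powr_mult powr_powr mult.commute)
qed

text \<open>The factor \<open>q - 1\<close> in the exponent of the weight cancels under duality.
  What remains, \<open>1 - s * q\<close>, is one power of the measure of the cube and
  \<open>q\<close> powers of the kernel at its scale, as \<open>beta_power_scale\<close>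
  shows.\<close>

lemma weight_dual: "wt v powr (1 - q) = measure m (closure (C v)) powr (1 - s * q)"
proof -
  have "(s * q - 1) / (q - 1) * (1 - q) = 1 - s * q" using q(1) by (simp add: field_simps)
  then show ?thesis by (simp add: dyadic_weight_def powr_powr)
qed

lemma measure_closure_ge: "v \<in> layer n \<Longrightarrow> c1 * a powr D * (\<delta> ^ n) powr D \<le> measure m (closure (C v))"
  using measure_C_ge[of v n] measure_C_le_closure[OF layer_tree[of v n]] by linarith

lemma weight_pos: "v \<in> tree I \<Longrightarrow> 0 < wt v"
proof -
  assume v: "v \<in> tree I"
  have "0 < c1 * a powr D * (\<delta> ^ level v) powr D" using c12 a_pos S.constants by simp
  then have "0 < measure m (closure (C v))" using measure_closure_ge[OF tree_layer[OF v]] by linarith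
  then show ?thesis by (simp add: dyadic_weight_def)
qed

lemma beta_power_scale: "(\<beta> ^ n) powr q * (\<delta> ^ n) powr D = ((\<delta> ^ n) powr D) powr (1 - s * q)"
  using S.constants by (simp add: beta_pow powr_powr powr_add[symmetric] algebra_simps)

lemma weight_dual_bounds:
  obtains k1 k2 where "0 < k1" "0 < k2"
    "\<And>n v. v \<in> layer n \<Longrightarrow> k1 * ((\<beta> ^ n) powr q * (\<delta> ^ n) powr D) \<le> wt v powr (1 - q)"
    "\<And>n v. v \<in> layer n \<Longrightarrow> wt v powr (1 - q) \<le> k2 * ((\<beta> ^ n) powr q * (\<delta> ^ n) powr D)"
proof
  let ?A = "c1 * a powr D" and ?B = "c2 * c4 powr D" and ?e = "1 - s * q"
  have pos: "0 < ?A" "0 < ?B" using c12 a_pos S.constants by auto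
  show "0 < min (?A powr ?e) (?B powr ?e)" "0 < max (?A powr ?e) (?B powr ?e)"
    using pos by (auto simp: less_max_iff_disj)
  fix n v assume v: "v \<in> layer n"
  have u: "0 < (\<delta> ^ n) powr D" using S.constants by simp
  note * = powr_two_sided[OF pos(1) u measure_closure_ge[OF v] measure_closure_C_le[OF v], of ?e]
  show "min (?A powr ?e) (?B powr ?e) * ((\<beta> ^ n) powr q * (\<delta> ^ n) powr D) \<le> wt v powr (1 - q)"
    "wt v powr (1 - q) \<le> max (?A powr ?e) (?B powr ?e) * ((\<beta> ^ n) powr q * (\<delta> ^ n) powr D)"
    using * unfolding beta_power_scale weight_dual .
qed

text \<open>The factors come from the lower kernel bound, from the diameter
  \<open>c4 * \<delta> ^ n\<close> of a cube, and from summing a geometric series of ratio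
  \<open>1 / \<beta>\<close>.\<close>

definition \<kappa> :: real where
  "\<kappa> = (2 * c2) powr - s * c4 powr - (s * D) * (1 - 1 / \<beta>)"

lemma kappa_pos: "0 < \<kappa>"
  using c12 S.constants beta_gt_1 by (simp add: \<kappa>_def)

text \<open>The asymmetry is deliberate: \<open>x\<close> in open cubes means at most one cube per
  level, so the sum is geometric; \<open>y\<close> in closures means that no mass of
  \<open>\<omega>\<close> is lost later, and still bounds the distance by the diameter.\<close>

lemma sum_le_kernel:
  assumes F: "finite F" "F \<subseteq> tree I"
  shows "ennreal (\<kappa> * (\<Sum>v\<in>F. \<beta> ^ level v * indicator (C v) x * indicator (closure (C v)) y)) \<le> ker x y"
proof (cases "x = y")
  case True then show ?thesis by (simp add: kernel_diag)
next
  case False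
  define F' where "F' = {v \<in> F. x \<in> C v \<and> y \<in> closure (C v)}"
  have eq: "(\<Sum>v\<in>F. \<beta> ^ level v * indicator (C v) x * indicator (closure (C v)) y) = (\<Sum>v\<in>F'. \<beta> ^ level v)"
    unfolding F'_def using F by (intro sum.mono_neutral_cong_right) (auto simp: indicator_def)
  have fin: "finite F'" using F by (simp add: F'_def)
  have "(\<Sum>v\<in>F'. \<beta> ^ level v) \<le> 1 / (1 - 1 / \<beta>) * (dist x y / c4) powr - (s * D)"
  proof (cases "F' = {}")
    case True then show ?thesis using beta_gt_1 by simp
  next
    case ne: False
    have "inj_on level F'"
    proof (rule inj_onI)
      fix v w assume vw: "v \<in> F'" "w \<in> F'" "level v = level w"
      then have *: "v \<in> tree I" "w \<in> tree I" "x \<in> C v" "x \<in> C w"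
        using F by (auto simp only: F'_def)
      then have "v \<in> layer (level w)" "w \<in> layer (level w)"
        using tree_layer[of v] tree_layer[of w] vw(3) by simp_all
      then show "v = w" using C_eq * by blast
    qed
    then have "(\<Sum>v\<in>F'. \<beta> ^ level v) = (\<Sum>n\<in>level ` F'. \<beta> ^ n)"
      by (simp add: sum.reindex)
    \<comment> \<open>Since \<open>\<beta> > 1\<close> the deepest common level \<open>N\<close>
      dominates; counting levels downwards from \<open>N\<close> gives a geometric series of ratio
      \<open>1 / \<beta>\<close>.\<close>
    also define N where "N = Max (level ` F')"
    have "(\<Sum>n\<in>level ` F'. \<beta> ^ n) = (\<Sum>n\<in>level ` F'. \<beta> ^ N * (1/\<beta>) ^ (N - n))"
    proof (rule sum.cong)
      fix n assume "n \<in> level ` F'"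
      then have "n \<le> N" using fin by (auto simp: N_def)
      then show "\<beta> ^ n = \<beta> ^ N * (1/\<beta>) ^ (N - n)"
        using beta_gt_1 by (simp add: power_divide field_simps power_add[symmetric])
    qed simp
    also have "\<dots> = \<beta> ^ N * (\<Sum>k\<in>(\<lambda>n. N - n) ` level ` F'. (1/\<beta>) ^ k)"
    proof -
      have "inj_on (\<lambda>n. N - n) (level ` F')"
      proof (rule inj_onI)
        fix i j assume ij: "i \<in> level ` F'" "j \<in> level ` F'" "N - i = N - j"
        then have "i \<le> N" "j \<le> N" using fin by (auto simp: N_def)
        then show "i = j" using ij(3) by simp
      qed
      then show ?thesis by (simp add: sum.reindex sum_distrib_left)
    qed
    also have "\<dots> \<le> \<beta> ^ N * (1 / (1 - 1 / \<beta>))"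
      using beta_gt_1 fin by (intro mult_left_mono sum_power_le_geometric) auto
    also have "\<beta> ^ N \<le> (dist x y / c4) powr - (s * D)"
    proof -
      have "N \<in> level ` F'" using ne fin unfolding N_def by (intro Max_in) auto
      then obtain v where v: "v \<in> F'" "level v = N" by auto
      then have "dist x y \<le> c4 * \<delta> ^ N"
        using F closure_subset[of "C v"] tree_layer[of v]
        by (intro dist_closure_C[of v]) (auto simp only: F'_def)
      then have "dist x y / c4 \<le> \<delta> ^ N" using S.constants by (simp add: field_simps)
      then show ?thesis unfolding beta_pow using S.constants False s c12 by (intro powr_mono2') auto
    qed
    finally show ?thesis using beta_gt_1 by (simp add: mult.commute divide_right_mono)
  qed
  then have "\<kappa> * (\<Sum>v\<in>F'. \<beta> ^ level v) \<le> \<kappa> * (1 / (1 - 1 / \<beta>) * (dist x y / c4) powr - (s * D))"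
    using kappa_pos by (intro mult_left_mono) auto
  also have "\<dots> = (2 * c2) powr - s * dist x y powr - (s * D)"
    using beta_gt_1 S.constants by (simp add: \<kappa>_def powr_divide)
  finally show ?thesis unfolding eq using kernel_ge[OF False] order_trans[OF ennreal_leI] by blast
qed

text \<open>Integrating \<open>sum_le_kernel\<close> in \<open>\<omega>\<close> bounds the potential
  below by a finite combination of indicators of cubes. Superadditivity of the power
  \<open>q\<close> discards the interaction of different cubes and keeps the diagonal terms.\<close>

lemma energy_ge_sum:
  assumes \<omega>: "sets \<omega> = sets borel" "finite_measure \<omega>" and F: "finite F" "F \<subseteq> tree I"
  shows "ennreal (\<Sum>v\<in>F. (\<kappa> * \<beta> ^ level v * measure \<omega> (closure (C v))) powr q * measure m (C v))
    \<le> space_energy m s q \<omega>"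
proof -
  interpret W: finite_measure \<omega> by fact
  have cl[measurable]: "closure (C v) \<in> sets \<omega>" for v using \<omega> by simp
  have Cm[measurable]: "C v \<in> sets m" if "v \<in> F" for v using F that open_C[of v] by (intro borel_m(1)) blast
  define h where "h v = \<kappa> * \<beta> ^ level v * measure \<omega> (closure (C v))" for v
  have h0: "0 \<le> h v" for v using kappa_pos beta_gt_1 by (simp add: h_def)
  have inner: "ennreal (\<Sum>v\<in>F. h v * indicator (C v) x) \<le> (\<integral>\<^sup>+y. ker x y \<partial>\<omega>)" for x
  proof -
    have c0: "0 \<le> \<kappa> * \<beta> ^ level v * indicator (C v) x" for v using kappa_pos beta_gt_1 by simp
    have "ennreal (\<Sum>v\<in>F. h v * indicator (C v) x)
      = (\<Sum>v\<in>F. ennreal (\<kappa> * \<beta> ^ level v * indicator (C v) x) * emeasure \<omega> (closure (C v)))"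
      using c0 h0 by (subst sum_ennreal[symmetric]) (auto simp: h_def W.emeasure_eq_measure ennreal_mult[symmetric] mult_ac)
    also have "\<dots> = (\<Sum>v\<in>F. \<integral>\<^sup>+y. ennreal (\<kappa> * \<beta> ^ level v * indicator (C v) x) * indicator (closure (C v)) y \<partial>\<omega>)"
      by (simp add: nn_integral_cmult_indicator cl)
    also have "\<dots> = (\<integral>\<^sup>+y. (\<Sum>v\<in>F. ennreal (\<kappa> * \<beta> ^ level v * indicator (C v) x) * indicator (closure (C v)) y) \<partial>\<omega>)"
      by (intro nn_integral_sum[symmetric] borel_measurable_times_ennreal borel_measurable_indicator cl) simp
    also have "\<dots> = (\<integral>\<^sup>+y. ennreal (\<kappa> * (\<Sum>v\<in>F. \<beta> ^ level v * indicator (C v) x * indicator (closure (C v)) y)) \<partial>\<omega>)"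
    proof (intro nn_integral_cong)
      fix y
      have "(\<Sum>v\<in>F. ennreal (\<kappa> * \<beta> ^ level v * indicator (C v) x) * indicator (closure (C v)) y)
        = (\<Sum>v\<in>F. ennreal (\<kappa> * \<beta> ^ level v * indicator (C v) x * indicator (closure (C v)) y))"
        by (intro sum.cong) (auto simp: indicator_def)
      also have "\<dots> = ennreal (\<kappa> * (\<Sum>v\<in>F. \<beta> ^ level v * indicator (C v) x * indicator (closure (C v)) y))"
      proof (subst sum_ennreal)
        show "0 \<le> \<kappa> * \<beta> ^ level v * indicator (C v) x * indicator (closure (C v)) y" for v
          by (intro mult_nonneg_nonneg c0) simp
      qed (simp add: sum_distrib_left mult_ac)
      finally show "(\<Sum>v\<in>F. ennreal (\<kappa> * \<beta> ^ level v * indicator (C v) x) * indicator (closure (C v)) y)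
        = ennreal (\<kappa> * (\<Sum>v\<in>F. \<beta> ^ level v * indicator (C v) x * indicator (closure (C v)) y))" .
    qed
    also have "\<dots> \<le> (\<integral>\<^sup>+y. ker x y \<partial>\<omega>)"
      by (intro nn_integral_mono sum_le_kernel F)
    finally show ?thesis .
  qed
  have "ennreal (\<Sum>v\<in>F. h v powr q * measure m (C v)) = (\<Sum>v\<in>F. ennreal (h v powr q) * emeasure m (C v))"
    by (subst sum_ennreal[symmetric]) (auto simp: M.emeasure_eq_measure ennreal_mult)
  also have "\<dots> = (\<Sum>v\<in>F. \<integral>\<^sup>+x. ennreal (h v powr q) * indicator (C v) x \<partial>m)"
    using Cm by (intro sum.cong) (auto simp: nn_integral_cmult_indicator)
  also have "\<dots> = (\<integral>\<^sup>+x. (\<Sum>v\<in>F. ennreal (h v powr q) * indicator (C v) x) \<partial>m)"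
    using Cm by (intro nn_integral_sum[symmetric] borel_measurable_times_ennreal borel_measurable_indicator) auto
  also have "\<dots> \<le> (\<integral>\<^sup>+x. ennpow (\<integral>\<^sup>+y. ker x y \<partial>\<omega>) q \<partial>m)"
  proof (intro nn_integral_mono)
    fix x
    have "(\<Sum>v\<in>F. ennreal (h v powr q) * indicator (C v) x) = (\<Sum>v\<in>F. ennreal ((h v * indicator (C v) x) powr q))"
      by (intro sum.cong) (auto simp: indicator_def)
    also have "\<dots> = ennreal (\<Sum>v\<in>F. (h v * indicator (C v) x) powr q)"
      by (intro sum_ennreal) auto
    also have "\<dots> \<le> ennreal ((\<Sum>v\<in>F. h v * indicator (C v) x) powr q)"
      using q F h0 by (intro ennreal_leI powr_sum_superadditive) auto
    also have "\<dots> = ennpow (ennreal (\<Sum>v\<in>F. h v * indicator (C v) x)) q"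
      using h0 by (intro ennpow_ennreal[symmetric] sum_nonneg) auto
    also have "\<dots> \<le> ennpow (\<integral>\<^sup>+y. ker x y \<partial>\<omega>) q"
      using q inner by (intro ennpow_mono) auto
    finally show "(\<Sum>v\<in>F. ennreal (h v powr q) * indicator (C v) x) \<le> ennpow (\<integral>\<^sup>+y. ker x y \<partial>\<omega>) q" .
  qed
  finally show ?thesis by (simp add: h_def space_energy_def)
qed

lemma tree_energy_le:
  obtains c where "0 < c" 
    "\<And>\<omega> F. sets \<omega> = sets borel \<Longrightarrow> finite_measure \<omega> \<Longrightarrow> finite F \<Longrightarrow> F \<subseteq> tree I \<Longrightarrow>
      ennreal (\<Sum>v\<in>F. measure \<omega> (closure (C v)) powr q * wt v powr (1 - q)) \<le> ennreal c * space_energy m s q \<omega>"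
proof -
  from weight_dual_bounds obtain k2 where k2: "0 < k2"
    "\<And>n v. v \<in> layer n \<Longrightarrow> wt v powr (1 - q) \<le> k2 * ((\<beta> ^ n) powr q * (\<delta> ^ n) powr D)" by metis
  define A where "A = c1 * a powr D"
  have A: "0 < A" using c12 a_pos by (simp add: A_def)
  \<comment> \<open>\<open>k2\<close> passes from the dual weight to the scale, \<open>A\<close>
    from the scale to the measure of the open cube, and \<open>\<kappa> powr q\<close> is the factor
    present in \<open>energy_ge_sum\<close>.\<close>
  define c where "c = k2 / (A * \<kappa> powr q)"
  have c: "0 < c" using k2 A kappa_pos by (simp add: c_def)
  show thesis
  proof (rule that[OF c])
    fix \<omega> :: "'a measure" and F
    assume \<omega>: "sets \<omega> = sets borel" "finite_measure \<omega>" and F: "finite F" "F \<subseteq> tree I"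
    let ?\<mu> = "\<lambda>v. measure \<omega> (closure (C v))"
    have "(\<Sum>v\<in>F. ?\<mu> v powr q * wt v powr (1 - q)) \<le> (\<Sum>v\<in>F. c * ((\<kappa> * \<beta> ^ level v * ?\<mu> v) powr q * measure m (C v)))"
    proof (rule sum_mono)
      fix v assume "v \<in> F"
      then have v: "v \<in> layer (level v)" using F tree_layer by blast
      have "wt v powr (1 - q) \<le> k2 * ((\<beta> ^ level v) powr q * (\<delta> ^ level v) powr D)" using k2(2)[OF v] .
      also have "\<dots> \<le> k2 * ((\<beta> ^ level v) powr q * (measure m (C v) / A))"
        using measure_C_ge[OF v] k2(1) A by (intro mult_left_mono) (auto simp: A_def field_simps)
      finally have "?\<mu> v powr q * wt v powr (1 - q) \<le> ?\<mu> v powr q * (k2 * ((\<beta> ^ level v) powr q * (measure m (C v) / A)))"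
        by (intro mult_left_mono) auto
      also have "\<dots> = c * ((\<kappa> * \<beta> ^ level v * ?\<mu> v) powr q * measure m (C v))"
        using kappa_pos beta_gt_1 by (simp add: c_def powr_mult field_simps)
      finally show "?\<mu> v powr q * wt v powr (1 - q) \<le> c * ((\<kappa> * \<beta> ^ level v * ?\<mu> v) powr q * measure m (C v))" .
    qed
    then have "ennreal (\<Sum>v\<in>F. ?\<mu> v powr q * wt v powr (1 - q)) \<le> ennreal (c * (\<Sum>v\<in>F. (\<kappa> * \<beta> ^ level v * ?\<mu> v) powr q * measure m (C v)))"
      by (simp add: sum_distrib_left ennreal_leI)
    also have "\<dots> = ennreal c * ennreal (\<Sum>v\<in>F. (\<kappa> * \<beta> ^ level v * ?\<mu> v) powr q * measure m (C v))"
      using c by (intro ennreal_mult) (auto intro: sum_nonneg)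
    also have "\<dots> \<le> ennreal c * space_energy m s q \<omega>"
      by (intro mult_left_mono energy_ge_sum \<omega> F) auto
    finally show "ennreal (\<Sum>v\<in>F. ?\<mu> v powr q * wt v powr (1 - q)) \<le> ennreal c * space_energy m s q \<omega>" .
  qed
qed

section \<open>Finite truncations and the duality estimate\<close>

definition below :: "nat \<Rightarrow> 'i vertex set" where
  "below N = (\<Union>n\<le>N. layer n)"

lemma finite_below: "finite (below N)" and below_tree: "below N \<subseteq> tree I"
  and incseq_below: "incseq below"
  using finite_layer layer_tree by (auto simp: below_def incseq_def) force

lemma infsum_le_SUP_below:
  fixes f :: "'i vertex \<Rightarrow> ennreal"
  assumes "A \<subseteq> tree I" shows "infsum f A \<le> (SUP N. sum f (A \<inter> below N))"
proof -
  have "sum f F \<le> (SUP N. sum f (A \<inter> below N))" if F: "finite F" "F \<subseteq> A" for F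
  proof -
    define N where "N = Max (insert 0 (level ` F))"
    have "F \<subseteq> below N"
    proof
      fix v assume v: "v \<in> F"
      then have "v \<in> layer (level v)" using F assms tree_layer by blast
      moreover have "level v \<le> N" using v F by (auto simp: N_def)
      ultimately show "v \<in> below N" by (auto simp: below_def)
    qed
    then have "sum f F \<le> sum f (A \<inter> below N)" using F finite_below by (intro sum_mono2) auto
    then show ?thesis by (rule order_trans) (intro SUP_upper UNIV_I)
  qed
  then show ?thesis by (subst nonneg_infsum_complete) (auto intro!: SUP_least)
qed

text \<open>A point of \<open>E\<close> lies in every closed cube along its ray, so
  \<open>\<phi>\<close> summed over all closed cubes containing the point is at least 1. Integrating
  this pointwise bound avoids a measurable choice of rays, that is, a lift of
  \<open>\<omega>\<close> to the boundary.\<close>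

lemma measure_le_potential_sum:
  assumes \<omega>: "sets \<omega> = sets borel" "finite_measure \<omega>" and E: "E \<in> sets \<omega>"
    and \<phi>: "\<And>v. v \<in> tree I \<Longrightarrow> 0 \<le> \<phi> v"
    and pot: "\<And>x. x \<in> E \<Longrightarrow> \<exists>\<xi>\<in>bd. Lam \<xi> = x \<and> 1 \<le> tree_potential I Q rt \<phi> (Inr \<xi>)"
  shows "emeasure \<omega> E \<le> (SUP N. ennreal (\<Sum>v\<in>below N. \<phi> v * measure \<omega> (closure (C v))))"
proof -
  interpret W: finite_measure \<omega> by fact
  have cl[measurable]: "closure (C v) \<in> sets \<omega>" for v using \<omega> by simp
  define f where "f N x = (\<Sum>v\<in>below N. ennreal (\<phi> v) * indicator (closure (C v)) x)" for N x
  have f[measurable]: "f N \<in> borel_measurable \<omega>" for N 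
    unfolding f_def by (intro borel_measurable_sum borel_measurable_times_ennreal borel_measurable_indicator cl) simp
  have inc: "incseq f"
    using incseq_below finite_below by (auto simp: incseq_def f_def le_fun_def intro!: sum_mono2)
  have "emeasure \<omega> E = (\<integral>\<^sup>+x. indicator E x \<partial>\<omega>)" using E by simp
  also have "\<dots> \<le> (\<integral>\<^sup>+x. (SUP N. f N x) \<partial>\<omega>)"
  proof (intro nn_integral_mono)
    fix x
    show "indicator E x \<le> (SUP N. f N x)"
    proof (cases "x \<in> E")
      case True
      then obtain \<xi> where \<xi>: "\<xi> \<in> bd" "Lam \<xi> = x" "1 \<le> tree_potential I Q rt \<phi> (Inr \<xi>)" using pot by blast
      have "range \<xi> \<subseteq> tree I" using ray_layer[OF \<xi>(1)] layer_tree by blast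
      then have "1 \<le> (SUP N. sum (\<lambda>v. ennreal (\<phi> v)) (range \<xi> \<inter> below N))"
        using order_trans[OF \<xi>(3)] infsum_le_SUP_below by (simp add: tree_potential_def)
      also have "\<dots> \<le> (SUP N. f N x)"
      proof (rule SUP_mono, intro bexI)
        fix N
        have "sum (\<lambda>v. ennreal (\<phi> v)) (range \<xi> \<inter> below N)
          = (\<Sum>v\<in>range \<xi> \<inter> below N. ennreal (\<phi> v) * indicator (closure (C v)) x)"
          using ray_limit(1)[OF \<xi>(1)] \<xi>(2) by (intro sum.cong) auto
        also have "\<dots> \<le> f N x" unfolding f_def using finite_below by (intro sum_mono2) auto
        finally show "sum (\<lambda>v. ennreal (\<phi> v)) (range \<xi> \<inter> below N) \<le> f N x" .
      qed simp
      finally show ?thesis using True by simp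
    qed simp
  qed
  also have "\<dots> = (SUP N. \<integral>\<^sup>+x. f N x \<partial>\<omega>)"
    using inc f by (rule nn_integral_monotone_convergence_SUP)
  also have "\<dots> = (SUP N. ennreal (\<Sum>v\<in>below N. \<phi> v * measure \<omega> (closure (C v))))"
  proof (rule SUP_cong)
    fix N
    have "(\<integral>\<^sup>+x. f N x \<partial>\<omega>) = (\<Sum>v\<in>below N. \<integral>\<^sup>+x. ennreal (\<phi> v) * indicator (closure (C v)) x \<partial>\<omega>)"

      unfolding f_def by (intro nn_integral_sum borel_measurable_times_ennreal borel_measurable_indicator cl) simp
    also have "\<dots> = (\<Sum>v\<in>below N. ennreal (\<phi> v * measure \<omega> (closure (C v))))"
      using \<phi> below_tree cl by (intro sum.cong)
       (auto simp: nn_integral_cmult_indicator W.emeasure_eq_measure ennreal_mult[symmetric] subset_iff)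
    also have "\<dots> = ennreal (\<Sum>v\<in>below N. \<phi> v * measure \<omega> (closure (C v)))"
      using \<phi> below_tree by (intro sum_ennreal) (auto simp: subset_iff)
    finally show "(\<integral>\<^sup>+x. f N x \<partial>\<omega>) = ennreal (\<Sum>v\<in>below N. \<phi> v * measure \<omega> (closure (C v)))" .
  qed simp
  finally show ?thesis .
qed

lemma space_cap_le_tree_cap:
  obtains c where "0 < c"
    "\<And>E K. K \<subseteq> bd \<Longrightarrow> E \<subseteq> Lam ` K \<Longrightarrow>
      space_cap m s p q E \<le> ennreal c * tree_cap I Q rt p wt (Inr ` K)"
proof (rule tree_energy_le)
  fix b assume b: "0 < b"
    "\<And>\<omega> F. sets \<omega> = sets borel \<Longrightarrow> finite_measure \<omega> \<Longrightarrow> finite F \<Longrightarrow> F \<subseteq> tree I \<Longrightarrow>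
      ennreal (\<Sum>v\<in>F. measure \<omega> (closure (C v)) powr q * wt v powr (1 - q)) \<le> ennreal b * space_energy m s q \<omega>"
  have c: "0 < b powr (p - 1)" using b by simp
  show thesis
  proof (rule that[OF c])
    fix E K assume K: "K \<subseteq> bd" and EK: "E \<subseteq> Lam ` K"
    show "space_cap m s p q E \<le> ennreal (b powr (p - 1)) * tree_cap I Q rt p wt (Inr ` K)"
      unfolding space_cap_def tree_cap_def
    proof (intro SUP_least ennreal_le_mult_INF[OF c])
      fix \<omega> :: "'a measure" and \<phi> :: "'i vertex \<Rightarrow> real"
      assume "\<omega> \<in> {\<omega>. sets \<omega> = sets borel \<and> finite_measure \<omega> \<and> emeasure \<omega> (space \<omega>) \<noteq> 0 \<and> measure_support \<omega> \<subseteq> E}"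
      then have \<omega>: "sets \<omega> = sets borel" "finite_measure \<omega>" by auto
      interpret W: finite_measure \<omega> by fact
      assume "\<phi> \<in> {\<phi>. (\<forall>x\<in>tree I. 0 \<le> \<phi> x) \<and> (\<forall>\<xi>\<in>Inr ` K. 1 \<le> tree_potential I Q rt \<phi> \<xi>)}"
      then have \<phi>: "\<And>v. v \<in> tree I \<Longrightarrow> 0 \<le> \<phi> v" "\<And>\<xi>. \<xi> \<in> K \<Longrightarrow> 1 \<le> tree_potential I Q rt \<phi> (Inr \<xi>)"
        by auto
      let ?S = "\<Sum>\<^sub>\<infinity>x\<in>tree I. ennreal (\<phi> x powr p * wt x)"
      let ?e = "space_energy m s q \<omega>"
      show "ennpow (emeasure \<omega> E) p / ennpow ?e (p - 1) \<le> ennreal (b powr (p - 1)) * ?S"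
      \<comment> \<open>\<open>E\<close> is arbitrary here; if it is not measurable,
        \<open>emeasure\<close> gives it the value 0. Infinite energy makes the quotient 0, and
        infinite cost makes the right-hand side infinite.\<close>
      proof (cases "E \<in> sets \<omega> \<and> ?e \<noteq> \<infinity> \<and> ?S \<noteq> \<infinity>")
        case False
        then consider "E \<notin> sets \<omega>" | "?e = \<infinity>" | "?S = \<infinity>" by blast
        then show ?thesis
        proof cases
          case 1 then show ?thesis by (simp add: emeasure_notin_sets ennpow_def)
        next
          case 2 then show ?thesis by (simp add: ennpow_def W.emeasure_eq_measure)
        next
          case 3 then show ?thesis using b by (simp add: ennreal_mult_top)
        qed
      next
        case True
        define e where "e = enn2real ?e"
        define S where "S = enn2real ?S"
        have e: "?e = ennreal e" "0 \<le> e" and S: "?S = ennreal S" "0 \<le> S"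
          using True by (simp_all add: e_def S_def ennreal_enn2real_if)
        have fin: "(\<Sum>v\<in>below N. \<phi> v * measure \<omega> (closure (C v))) \<le> S powr (1/p) * (b * e) powr (1/q)" for N
        proof -
          have pos: "0 < wt v" if "v \<in> below N" for v using that below_tree weight_pos by blast
          \<comment> \<open>The weight is distributed so that Hoelder's inequality produces the cost
            of \<open>\<phi>\<close> in one factor and, since \<open>- (1/p) * q = 1 - q\<close>,
            the tree energy in the other.\<close>
          have "(\<Sum>v\<in>below N. \<phi> v * measure \<omega> (closure (C v)))
            = (\<Sum>v\<in>below N. (\<phi> v * wt v powr (1/p)) * (measure \<omega> (closure (C v)) * wt v powr - (1/p)))"
          proof (intro sum.cong refl)
            fix v assume "v \<in> below N"
            then have "wt v powr (1/p) * wt v powr - (1/p) = 1"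
              using pos[of v] by (simp add: powr_add[symmetric])
            then show "\<phi> v * measure \<omega> (closure (C v))
              = (\<phi> v * wt v powr (1/p)) * (measure \<omega> (closure (C v)) * wt v powr - (1/p))"
              by (metis (no_types, opaque_lifting) mult.assoc mult.left_commute mult.right_neutral)
          qed
          also have "\<dots> \<le> (\<Sum>v\<in>below N. (\<phi> v * wt v powr (1/p)) powr p) powr (1/p)
            * (\<Sum>v\<in>below N. (measure \<omega> (closure (C v)) * wt v powr - (1/p)) powr q) powr (1/q)"
            using p pq finite_below \<phi>(1) below_tree by (intro Hoelder_sum) (auto simp: subset_iff)
          also have "(\<Sum>v\<in>below N. (\<phi> v * wt v powr (1/p)) powr p) = (\<Sum>v\<in>below N. \<phi> v powr p * wt v)"
            using pos p \<phi>(1) below_tree by (intro sum.cong) (auto simp: powr_mult powr_powr subset_iff less_imp_le)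
          also have "(\<Sum>v\<in>below N. (measure \<omega> (closure (C v)) * wt v powr - (1/p)) powr q)
            = (\<Sum>v\<in>below N. measure \<omega> (closure (C v)) powr q * wt v powr (1 - q))"
          proof -
            have "- (1/p) * q = 1 - q" using q p by (simp add: field_simps)
            then show ?thesis by (intro sum.cong) (auto simp: powr_mult powr_powr)
          qed
          also have "(\<Sum>v\<in>below N. \<phi> v powr p * wt v) powr (1/p)
              * (\<Sum>v\<in>below N. measure \<omega> (closure (C v)) powr q * wt v powr (1 - q)) powr (1/q)
            \<le> S powr (1/p) * (b * e) powr (1/q)"
          proof (intro mult_mono powr_mono2)
            have "ennreal (\<Sum>v\<in>below N. \<phi> v powr p * wt v) = (\<Sum>v\<in>below N. ennreal (\<phi> v powr p * wt v))"
              using pos by (intro sum_ennreal[symmetric]) (auto simp: less_imp_le)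
            also have "\<dots> \<le> ?S" using finite_below below_tree by (rule sum_le_infsum_ennreal)
            finally show "(\<Sum>v\<in>below N. \<phi> v powr p * wt v) \<le> S" using S by simp
            have "ennreal (\<Sum>v\<in>below N. measure \<omega> (closure (C v)) powr q * wt v powr (1 - q)) \<le> ennreal (b * e)"
              using b(2)[OF \<omega> finite_below below_tree] e b(1) by (simp add: ennreal_mult)
            then show "(\<Sum>v\<in>below N. measure \<omega> (closure (C v)) powr q * wt v powr (1 - q)) \<le> b * e"
              using e b(1) by simp
            show "0 \<le> (\<Sum>v\<in>below N. \<phi> v powr p * wt v)" using pos by (intro sum_nonneg) (auto simp: less_imp_le)
          qed (use p q in \<open>auto intro: sum_nonneg\<close>)
          finally show ?thesis .
        qed
        have "emeasure \<omega> E \<le> (SUP N. ennreal (\<Sum>v\<in>below N. \<phi> v * measure \<omega> (closure (C v))))"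
        proof (rule measure_le_potential_sum[OF \<omega> _ \<phi>(1)])
          fix x assume "x \<in> E"
          then show "\<exists>\<xi>\<in>bd. Lam \<xi> = x \<and> 1 \<le> tree_potential I Q rt \<phi> (Inr \<xi>)" using EK K \<phi>(2) by blast
        qed (use True in auto)
        also have "\<dots> \<le> ennreal (S powr (1/p) * (b * e) powr (1/q))"
          using fin by (intro SUP_least ennreal_leI)
        finally have "ennpow (emeasure \<omega> E) p \<le> ennpow (ennreal (S powr (1/p) * (b * e) powr (1/q))) p"
          using p by (intro ennpow_mono) auto
        also have "\<dots> = ennreal ((S powr (1/p) * (b * e) powr (1/q)) powr p)"
          by (intro ennpow_ennreal) simp
        also have "(S powr (1/p) * (b * e) powr (1/q)) powr p = b powr (p - 1) * S * e powr (p - 1)"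
          using p q(5) S(2) e(2) b(1) by (simp add: powr_mult powr_powr)
        finally have main: "ennpow (emeasure \<omega> E) p \<le> ennreal (b powr (p - 1) * S * e powr (p - 1))" .
        show ?thesis
        \<comment> \<open>If the energy vanishes, \<open>main\<close> forces the numerator to be 0,
          and \<open>0 / 0 = 0\<close> on \<open>ennreal\<close>.\<close>
        proof (cases "e = 0")
          case True
          then show ?thesis using main by simp
        next
          case False
          have "ennpow (emeasure \<omega> E) p / ennpow ?e (p - 1) \<le> ennreal (b powr (p - 1) * S * e powr (p - 1)) / ennreal (e powr (p - 1))"
            using main e by (simp add: ennpow_ennreal divide_right_mono_ennreal)
          also have "\<dots> = ennreal (b powr (p - 1) * S)"
            using False e(2) S(2) by (simp add: divide_ennreal)
          also have "\<dots> = ennreal (b powr (p - 1)) * ?S" using S by (simp add: ennreal_mult)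
          finally show ?thesis .
        qed
      qed
    qed
  qed
qed

section \<open>Capacities and equilibrium flows on the tree\<close>

text \<open>The series law: \<open>ser_powr\<close> shows that the resistances
  \<open>x powr (1 - q)\<close> add. The closed formula also gives the right value 0 at
  \<open>y = 0\<close>, where a negative power in HOL would be 0 instead of infinite.\<close>

definition ser :: "real \<Rightarrow> real \<Rightarrow> real" where
  "ser x y = x * y / (x powr (q - 1) + y powr (q - 1)) powr (p - 1)"

lemma ser_0 [simp]: "ser x 0 = 0"
  by (simp add: ser_def)

lemma ser_nonneg: "0 < x \<Longrightarrow> 0 \<le> y \<Longrightarrow> 0 \<le> ser x y"
  by (simp add: ser_def)

lemma ser_commute: "ser x y = ser y x"
  by (simp add: ser_def mult.commute add.commute)

lemma ser_le: assumes "0 < x" "0 \<le> y" shows "ser x y \<le> x" "ser x y \<le> y"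
proof -
  have *: "x * y / (x powr (q - 1) + y powr (q - 1)) powr (p - 1) \<le> x" if "0 \<le> x" "0 \<le> y" for x y
  proof (cases "y = 0")
    case False
    have "y = (y powr (q - 1)) powr (p - 1)" using that q by (simp add: powr_powr)
    also have "\<dots> \<le> (x powr (q - 1) + y powr (q - 1)) powr (p - 1)"
      using p by (intro powr_mono2) auto
    finally have "y / (x powr (q - 1) + y powr (q - 1)) powr (p - 1) \<le> 1"
      using that False by (simp add: divide_le_eq_1)
    from mult_left_mono[OF this that(1)] show ?thesis by simp
  qed (use that in simp)
  show "ser x y \<le> x" using *[of x y] assms by (simp add: ser_def)
  show "ser x y \<le> y" using *[of y x] assms by (subst ser_commute) (simp add: ser_def)
qed

lemma ser_powr: assumes "0 < x" "0 < y" shows "0 < ser x y" "ser x y powr (1 - q) = x powr (1 - q) + y powr (1 - q)"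
proof -
  let ?T = "x powr (q - 1) + y powr (q - 1)"
  have T: "0 < ?T" using assms by (simp add: add_pos_pos)
  show "0 < ser x y" using assms T by (simp add: ser_def)
  have "(p - 1) * (1 - q) = - 1" using q(4) by (simp add: algebra_simps)
  then have "ser x y powr (1 - q) = x powr (1 - q) * y powr (1 - q) * ?T"
    using assms T by (simp add: ser_def powr_divide powr_mult powr_powr powr_minus field_simps)
  also have "\<dots> = x powr (1 - q) + y powr (1 - q)"
    using assms by (simp add: distrib_left powr_add[symmetric] mult.assoc mult.left_commute[of _ "y powr _"])
  finally show "ser x y powr (1 - q) = x powr (1 - q) + y powr (1 - q)" .
qed

lemma ser_mono: assumes "0 < x" "0 \<le> y" "y \<le> y'" shows "ser x y \<le> ser x y'"
proof (cases "y = 0")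
  case False
  then have y: "0 < y" "0 < y'" using assms by auto
  show ?thesis
  proof (rule ccontr)
    assume "\<not> ser x y \<le> ser x y'"
    then have "ser x y powr (1 - q) < ser x y' powr (1 - q)"
      using ser_powr(1)[OF assms(1) y(2)] q(1) by (intro powr_less_mono2_neg) auto
    moreover have "y' powr (1 - q) \<le> y powr (1 - q)" using y assms q(1) by (intro powr_mono2') auto
    ultimately show False using ser_powr(2)[OF assms(1)] y by simp
  qed
qed (use assms ser_nonneg in simp)

definition trace :: "'i ray set \<Rightarrow> 'i vertex set" where
  "trace K = {v. \<exists>\<xi>\<in>K. \<xi> (level v) = v}"

lemma trace_desc: assumes "K \<subseteq> bd" "v \<in> layer k" "w \<in> desc n v" "k \<le> n" "w \<in> trace K" shows "v \<in> trace K"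
proof -
  have w: "w \<in> layer n" "C w \<subseteq> C v" using assms(3) by (simp_all add: desc_def)
  obtain \<xi> where \<xi>: "\<xi> \<in> K" "\<xi> (level w) = w" using assms(5) by (auto simp: trace_def)
  have "level w = n" "level v = k" using w assms(2) layerD by blast+
  then have "anc k w = \<xi> k" using ray_anc[of \<xi> k n] \<xi> assms(1,4) by auto
  moreover have "anc k w = v" using anc_eqI[OF w(1) assms(4,2) w(2)] .
  ultimately show ?thesis using \<xi>(1) \<open>level v = k\<close> by (auto simp: trace_def)
qed

text \<open>The capacity of the part of \<open>K\<close> below \<open>v\<close>, computed in the finite tree of height \<open>h\<close> with
  root \<open>v\<close>: a vertex is in series with the parallel connection of its children.\<close>

primrec cp :: "'i ray set \<Rightarrow> nat \<Rightarrow> 'i vertex \<Rightarrow> real" where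
  "cp K 0 v = (if v \<in> trace K then wt v else 0)"
| "cp K (Suc h) v = ser (wt v) (\<Sum>w\<in>chd v. cp K h w)"

lemma cp_nonneg: "v \<in> tree I \<Longrightarrow> 0 \<le> cp K h v"
proof (induction h arbitrary: v)
  case 0 then show ?case using weight_pos by (simp add: less_imp_le)
next
  case (Suc h)
  then have "0 \<le> (\<Sum>w\<in>chd v. cp K h w)" using chd_tree by (intro sum_nonneg) blast
  then show ?case using ser_nonneg[OF weight_pos[OF Suc.prems]] by simp
qed

text \<open>In the truncated tree a traced vertex of the last layer acts with its weight alone; one
  more generation puts a further element in series, which can only lower the conductance. A vertex
  off the trace has all its children off the trace. Monotonicity of \<open>ser\<close> carries the
  comparison up to the root.\<close>

lemma cp_decreasing: assumes "K \<subseteq> bd" shows "v \<in> tree I \<Longrightarrow> cp K (Suc h) v \<le> cp K h v"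
proof (induction h arbitrary: v)
  case 0
  show ?case
  proof (cases "v \<in> trace K")
    case True
    have "0 \<le> (\<Sum>w\<in>chd v. cp K 0 w)" by (intro sum_nonneg cp_nonneg chd_tree)
    then show ?thesis using ser_le(1)[OF weight_pos[OF 0]] True by simp
  next
    case False
    then have "cp K 0 w = 0" if "w \<in> chd v" for w
      using trace_desc[OF assms tree_layer[OF 0] that] by auto
    then have "(\<Sum>w\<in>chd v. cp K 0 w) = 0" by (rule sum.neutral[rule_format])
    then show ?thesis using False by simp
  qed
next
  case (Suc h)
  show ?case unfolding cp.simps(2)[of K "Suc h"] cp.simps(2)[of K h v]
    by (intro ser_mono weight_pos sum_nonneg sum_mono cp_nonneg Suc.IH Suc.prems) (erule chd_tree)+
qed

text \<open>Decreasing in the height, so the infimum is a limit. At the root it dominates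
  \<open>tree_cap\<close> (\<open>tree_cap_le_lcp\<close>) and controls the energy of the flow
  (\<open>flow_energy\<close>).\<close>

definition lcp :: "'i ray set \<Rightarrow> 'i vertex \<Rightarrow> real" where
  "lcp K v = (INF h. cp K h v)"

lemma lcp:
  assumes "K \<subseteq> bd" "v \<in> tree I"
  shows "(\<lambda>h. cp K h v) \<longlonglongrightarrow> lcp K v" "lcp K v \<le> cp K h v" "0 \<le> lcp K v"
proof -
  have bdd: "bdd_below (range (\<lambda>h. cp K h v))" using cp_nonneg[OF assms(2)] by (intro bdd_belowI) auto
  have "decseq (\<lambda>h. cp K h v)" using cp_decreasing[OF assms] by (intro decseq_SucI) auto
  then show "(\<lambda>h. cp K h v) \<longlonglongrightarrow> lcp K v" unfolding lcp_def by (intro LIMSEQ_decseq_INF bdd)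
  show "lcp K v \<le> cp K h v" unfolding lcp_def by (intro cINF_lower bdd) simp
  show "0 \<le> lcp K v" unfolding lcp_def using cp_nonneg[OF assms(2)] by (intro cINF_greatest) auto
qed

lemma lcp_pos_trace: "K \<subseteq> bd \<Longrightarrow> v \<in> tree I \<Longrightarrow> 0 < lcp K v \<Longrightarrow> v \<in> trace K"
  using lcp(2)[of K v 0] by (auto split: if_splits)

text \<open>Limit of the series law at finite height. The lower bound \<open>lcp K v <= S h\<close>
  keeps the sums over the children away from 0, where \<open>powr (1 - q)\<close> is not
  continuous.\<close>

lemma lcp_series:
  assumes K: "K \<subseteq> bd" and v: "v \<in> tree I" and pos: "0 < lcp K v"
  shows "0 < (\<Sum>w\<in>chd v. lcp K w)"
    "wt v powr (1 - q) + (\<Sum>w\<in>chd v. lcp K w) powr (1 - q) \<le> lcp K v powr (1 - q)"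
proof -
  let ?S = "\<Sum>w\<in>chd v. lcp K w"
  define S where "S h = (\<Sum>w\<in>chd v. cp K h w)" for h
  have lim: "S \<longlonglongrightarrow> ?S" unfolding S_def by (intro tendsto_sum lcp(1) K chd_tree)
  have S0: "0 \<le> S h" for h unfolding S_def by (intro sum_nonneg cp_nonneg chd_tree)
  have le: "lcp K v \<le> ser (wt v) (S h)" for h using lcp(2)[OF K v, of "Suc h"] by (simp add: S_def)
  then have leS: "lcp K v \<le> S h" for h using ser_le(2)[OF weight_pos[OF v] S0] order_trans by blast
  then have "lcp K v \<le> ?S" using lim by (intro LIMSEQ_le_const) auto
  then show S: "0 < ?S" using pos by linarith
  have "wt v powr (1 - q) + S h powr (1 - q) \<le> lcp K v powr (1 - q)" for h
  proof -
    have "0 < S h" using leS[of h] pos by linarith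
    then have "wt v powr (1 - q) + S h powr (1 - q) = ser (wt v) (S h) powr (1 - q)"
      using ser_powr(2) weight_pos[OF v] by simp
    also have "\<dots> \<le> lcp K v powr (1 - q)" using le pos q(1) by (intro powr_mono2') auto
    finally show ?thesis .
  qed
  moreover have "(\<lambda>h. wt v powr (1 - q) + S h powr (1 - q)) \<longlonglongrightarrow> wt v powr (1 - q) + ?S powr (1 - q)"
    using S by (intro tendsto_intros lim) auto
  ultimately show "wt v powr (1 - q) + ?S powr (1 - q) \<le> lcp K v powr (1 - q)"
    by (intro LIMSEQ_le_const2) auto
qed

section \<open>The equilibrium flow and its energy\<close>

text \<open>The parallel law: the flow through a vertex divides among its children in proportion to
  their capacities.\<close>

primrec flw :: "'i ray set \<Rightarrow> nat \<Rightarrow> 'i vertex \<Rightarrow> real" where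
  "flw K 0 w = 1"
| "flw K (Suc n) w = flw K n (anc n w) * lcp K w / (\<Sum>u\<in>desc (Suc n) (anc n w). lcp K u)"

definition flow :: "'i ray set \<Rightarrow> 'i vertex \<Rightarrow> real" where
  "flow K v = flw K (level v) v"

lemma root_tree: "root \<in> tree I"
  using layer_tree[of root 0] by (simp add: layer_0)

lemma flow_root: "flow K root = 1"
  by (simp add: flow_def)

lemma flow_child:
  assumes "v \<in> tree I" "w \<in> chd v"
  shows "flow K w = flow K v * lcp K w / (\<Sum>u\<in>chd v. lcp K u)"
proof -
  have w: "w \<in> layer (Suc (level v))" "C w \<subseteq> C v" using desc_layer assms(2) by blast+
  have "anc (level v) w = v" by (rule anc_eqI[OF w(1) _ tree_layer[OF assms(1)] w(2)]) simp
  then show ?thesis using layerD[OF w(1)] by (simp add: flow_def)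
qed

lemma layer_Suc_parent: assumes "w \<in> layer (Suc n)" 
  obtains v where "v \<in> layer n" "level v = n" "w \<in> chd v"
proof -
  have "anc n w \<in> layer n" "C w \<subseteq> C (anc n w)" using anc[OF assms, of n] by simp_all
  then show thesis using that[of "anc n w"] assms layerD[of "anc n w" n] by (simp add: desc_def)
qed

lemma flow_nonneg: assumes "K \<subseteq> bd" shows "v \<in> layer n \<Longrightarrow> 0 \<le> flow K v"
proof (induction n arbitrary: v)
  case 0 then show ?case by (simp add: layer_0 flow_root)
next
  case (Suc n)
  from layer_Suc_parent[OF Suc.prems] obtain u where u: "u \<in> layer n" "level u = n" "v \<in> chd u" .
  have "0 \<le> (\<Sum>x\<in>chd u. lcp K x)" by (intro sum_nonneg lcp(3) assms chd_tree)
  then show ?case unfolding flow_child[OF layer_tree[OF u(1)] u(3)]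
    using Suc.IH[OF u(1)] lcp(3)[OF assms chd_tree[OF u(3)]] by simp
qed

lemma flow_pos: assumes "K \<subseteq> bd" "0 < lcp K root" "v \<in> layer n" "0 < flow K v" shows "0 < lcp K v"
proof (cases n)
  case 0 then show ?thesis using assms by (simp add: layer_0)
next
  case (Suc k)
  with assms obtain u where u: "u \<in> layer k" "v \<in> chd u" by (blast elim: layer_Suc_parent)
  have "lcp K v \<noteq> 0" using assms(4) flow_child[OF layer_tree[OF u(1)] u(2), of K] by auto
  then show ?thesis using lcp(3)[OF assms(1) layer_tree[OF assms(3)]] by simp
qed

lemma flow_sum:
  assumes "K \<subseteq> bd" "0 < lcp K root" "v \<in> tree I"
  shows "(\<Sum>w\<in>chd v. flow K w) = flow K v"
proof (cases "flow K v = 0")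
  case True
  then have "flow K w = 0" if "w \<in> chd v" for w using flow_child[OF assms(3) that, of K] by simp
  then have "(\<Sum>w\<in>chd v. flow K w) = 0" by (rule sum.neutral[rule_format])
  then show ?thesis using True by simp
next
  case False
  then have "0 < lcp K v"
    using flow_nonneg[OF assms(1) tree_layer[OF assms(3)]] flow_pos[OF assms(1,2) tree_layer[OF assms(3)]] by simp
  then have S: "0 < (\<Sum>w\<in>chd v. lcp K w)" using lcp_series assms by blast
  have "(\<Sum>w\<in>chd v. flow K w) = (\<Sum>w\<in>chd v. flow K v * lcp K w / (\<Sum>u\<in>chd v. lcp K u))"
    by (intro sum.cong refl flow_child assms)
  also have "\<dots> = flow K v * (\<Sum>w\<in>chd v. lcp K w) / (\<Sum>u\<in>chd v. lcp K u)"
    by (simp add: sum_distrib_left sum_divide_distrib)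
  finally show ?thesis using S by simp
qed

lemma sum_below: "(\<Sum>v\<in>below n. f v) = (\<Sum>k\<le>n. \<Sum>v\<in>layer k. f v)" for f :: "'i vertex \<Rightarrow> real"
  unfolding below_def by (rule sum.UNION_disjoint) (use finite_layer layerD in \<open>blast+\<close>)

text \<open>\<open>E k\<close> is the energy that the flow would need from layer \<open>k\<close> on
  if every subtree were replaced by a single resistance \<open>lcp K v powr (1 - q)\<close>. By
  \<open>lcp_series\<close> it drops from layer \<open>k\<close> to the next by at least the energy
  spent in layer \<open>k\<close>, and it starts at the claimed bound.\<close>

lemma flow_energy:
  assumes K: "K \<subseteq> bd" "0 < lcp K root"
  shows "(\<Sum>v\<in>below n. flow K v powr q * wt v powr (1 - q)) \<le> lcp K root powr (1 - q)"
proof -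
  define E where "E k = (\<Sum>v\<in>layer k. flow K v powr q * lcp K v powr (1 - q))" for k
  have step: "(\<Sum>v\<in>layer k. flow K v powr q * wt v powr (1 - q)) + E (Suc k) \<le> E k" for k
  proof -
    have "E (Suc k) = (\<Sum>v\<in>layer k. \<Sum>w\<in>desc (Suc k) v. flow K w powr q * lcp K w powr (1 - q))"
      unfolding E_def by (rule sum_layer_desc) simp
    also have "\<dots> + (\<Sum>v\<in>layer k. flow K v powr q * wt v powr (1 - q)) \<le> E k"
      unfolding E_def sum.distrib[symmetric]
    proof (rule sum_mono)
      fix v assume v: "v \<in> layer k"
      then have vt: "v \<in> tree I" and lev: "level v = k" using layerD by blast+
      let ?S = "\<Sum>w\<in>chd v. lcp K w"
      show "(\<Sum>w\<in>desc (Suc k) v. flow K w powr q * lcp K w powr (1 - q)) + flow K v powr q * wt v powr (1 - q)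
          \<le> flow K v powr q * lcp K v powr (1 - q)"
      proof (cases "flow K v = 0")
        case True
        then have "flow K w = 0" if "w \<in> chd v" for w using flow_child[OF vt that, of K] by simp
        then have "(\<Sum>w\<in>chd v. flow K w powr q * lcp K w powr (1 - q)) = 0"
          by (intro sum.neutral) simp
        then show ?thesis using True lev by simp
      next
        case False
        then have fpos: "0 < flow K v" using flow_nonneg[OF K(1) v] by simp
        then have "0 < lcp K v" using flow_pos[OF K v] by blast
        note ser = lcp_series[OF K(1) vt this]
        \<comment> \<open>Proportional splitting makes each summand linear in
          \<open>lcp K w\<close>, so that the children together act as one resistance
          \<open>?S powr (1 - q)\<close>.\<close>
        have "(\<Sum>w\<in>chd v. flow K w powr q * lcp K w powr (1 - q))
          = (\<Sum>w\<in>chd v. flow K v powr q * ?S powr (- q) * lcp K w)"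
        proof (rule sum.cong[OF refl])
          fix w assume w: "w \<in> chd v"
          have l0: "0 \<le> lcp K w" using lcp(3)[OF K(1) chd_tree[OF w]] .
          show "flow K w powr q * lcp K w powr (1 - q) = flow K v powr q * ?S powr (- q) * lcp K w"
          proof (cases "lcp K w = 0")
            case True then show ?thesis using flow_child[OF vt w, of K] by simp
          next
            case False
            then have "lcp K w powr q * lcp K w powr (1 - q) = lcp K w"
              using l0 by (simp add: powr_add[symmetric])
            then show ?thesis unfolding flow_child[OF vt w]
              using fpos ser(1) l0 by (simp add: powr_mult powr_divide powr_minus_divide)
          qed
        qed
        also have "\<dots> = flow K v powr q * (?S powr (- q) * ?S)"
          by (simp add: sum_distrib_left mult.assoc)
        also have "?S powr (- q) * ?S = ?S powr (1 - q)"
          using ser(1) by (simp add: powr_diff powr_minus_divide)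
        finally have "(\<Sum>w\<in>chd v. flow K w powr q * lcp K w powr (1 - q)) = flow K v powr q * ?S powr (1 - q)" .
        then have "(\<Sum>w\<in>desc (Suc k) v. flow K w powr q * lcp K w powr (1 - q)) + flow K v powr q * wt v powr (1 - q)
          = flow K v powr q * (wt v powr (1 - q) + ?S powr (1 - q))" using lev by (simp add: algebra_simps)
        also have "\<dots> \<le> flow K v powr q * lcp K v powr (1 - q)" using ser(2) by (intro mult_left_mono) auto
        finally show ?thesis .
      qed
    qed
    finally show ?thesis by (simp add: add.commute)
  qed
  have "(\<Sum>k\<le>n. \<Sum>v\<in>layer k. flow K v powr q * wt v powr (1 - q)) + E (Suc n) \<le> E 0"
  proof (induction n)
    case 0 then show ?case using step[of 0] by simp
  next
    case (Suc n) then show ?case using step[of "Suc n"] by simp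
  qed
  moreover have "0 \<le> E (Suc n)" unfolding E_def by (intro sum_nonneg) simp
  moreover have "E 0 = lcp K root powr (1 - q)" by (simp add: E_def layer_0 flow_root)
  ultimately show ?thesis unfolding sum_below by linarith
qed

text \<open>The fraction of the remaining potential that the extremal function of the tree of height
  \<open>n\<close> spends at \<open>v\<close>.\<close>

definition frac :: "'i ray set \<Rightarrow> nat \<Rightarrow> 'i vertex \<Rightarrow> real" where
  "frac K n v = (if level v = n then (if v \<in> trace K then 1 else 0)
     else let b = \<Sum>w\<in>chd v. cp K (n - Suc (level v)) w in
       b powr (q - 1) / (wt v powr (q - 1) + b powr (q - 1)))"

primrec remn :: "'i ray set \<Rightarrow> nat \<Rightarrow> nat \<Rightarrow> 'i vertex \<Rightarrow> real" where
  "remn K n 0 v = 1"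
| "remn K n (Suc k) w = remn K n k (anc k w) * (1 - frac K n (anc k w))"

definition extr :: "'i ray set \<Rightarrow> nat \<Rightarrow> 'i vertex \<Rightarrow> real" where
  "extr K n v = (if level v \<le> n then remn K n (level v) v * frac K n v else 0)"

lemma frac_bounds: "0 \<le> frac K n v" "frac K n v \<le> 1"
proof -
  have "x / (y + x) \<le> 1" if "0 \<le> x" "0 \<le> y" for x y :: real
    using that by (cases "y + x = 0") (auto simp: divide_le_eq_1)
  then show "0 \<le> frac K n v" "frac K n v \<le> 1" by (auto simp: frac_def Let_def)
qed

lemma remn_nonneg: "0 \<le> remn K n k v"
  by (induction k arbitrary: v) (auto simp: frac_bounds)

lemma extr_nonneg: "0 \<le> extr K n v"
  by (simp add: extr_def frac_bounds remn_nonneg)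

text \<open>Along a ray the sum telescopes to 1 minus the remainder; at level \<open>n\<close> the
  fraction is 1 on the trace, so the last vertex takes all that is left.\<close>

lemma extr_potential:
  assumes "K \<subseteq> bd" "\<xi> \<in> K"
  shows "(\<Sum>k\<le>n. extr K n (\<xi> k)) = 1"
proof -
  have \<xi>: "\<xi> \<in> bd" using assms by blast
  have lev: "level (\<xi> k) = k" for k using ray_layer[OF \<xi>] layerD by blast
  have "(\<Sum>k<j. extr K n (\<xi> k)) = 1 - remn K n j (\<xi> j)" if "j \<le> n" for j
    using that
  proof (induction j)
    case (Suc j)
    have "anc j (\<xi> (Suc j)) = \<xi> j" using ray_anc[OF \<xi>] by simp
    then show ?case using Suc by (simp add: extr_def lev algebra_simps)
  qed simp
  from this[of n] have "(\<Sum>k<n. extr K n (\<xi> k)) = 1 - remn K n n (\<xi> n)" by simp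
  moreover have "\<xi> n \<in> trace K" using assms(2) lev by (auto simp: trace_def)
  then have "extr K n (\<xi> n) = remn K n n (\<xi> n)" by (simp add: extr_def lev frac_def)
  ultimately show ?thesis by (simp add: lessThan_Suc_atMost[symmetric])
qed

text \<open>\<open>E k\<close> is the cost of spending optimally, below layer \<open>k\<close>, the
  potential that remains there. By \<open>powr_real_combination\<close> the cost of layer
  \<open>k\<close> together with \<open>E (Suc k)\<close> is exactly \<open>E k\<close>; at height 0
  the capacity of a traced vertex is its weight.\<close>

lemma extr_cost:
  shows "(\<Sum>v\<in>below n. extr K n v powr p * wt v) = cp K n root"
proof -
  define E where "E k = (\<Sum>v\<in>layer k. remn K n k v powr p * cp K (n - k) v)" for k
  have step: "E k = (\<Sum>v\<in>layer k. extr K n v powr p * wt v) + E (Suc k)" if k: "k < n" for k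
  proof -
    have "E (Suc k) = (\<Sum>v\<in>layer k. \<Sum>w\<in>desc (Suc k) v. remn K n (Suc k) w powr p * cp K (n - Suc k) w)"
      unfolding E_def by (rule sum_layer_desc) simp
    then have "(\<Sum>v\<in>layer k. extr K n v powr p * wt v) + E (Suc k)
      = (\<Sum>v\<in>layer k. extr K n v powr p * wt v
          + (\<Sum>w\<in>desc (Suc k) v. remn K n (Suc k) w powr p * cp K (n - Suc k) w))"
      by (simp add: sum.distrib)
    also have "\<dots> = E k" unfolding E_def
    proof (rule sum.cong[OF refl])
      fix v assume v: "v \<in> layer k"
      then have vt: "v \<in> tree I" and lev: "level v = k" using layerD by blast+
      define b where "b = (\<Sum>w\<in>chd v. cp K (n - Suc k) w)"
      have b0: "0 \<le> b" unfolding b_def by (intro sum_nonneg cp_nonneg chd_tree)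
      let ?t = "frac K n v" and ?r = "remn K n k v"
      have t: "?t = b powr (q - 1) / (wt v powr (q - 1) + b powr (q - 1))"
        using k lev by (simp add: frac_def b_def)
      have "(\<Sum>w\<in>desc (Suc k) v. remn K n (Suc k) w powr p * cp K (n - Suc k) w)
        = (\<Sum>w\<in>desc (Suc k) v. (?r * (1 - ?t)) powr p * cp K (n - Suc k) w)"
      proof (rule sum.cong[OF refl])
        fix w assume "w \<in> desc (Suc k) v"
        then have "anc k w = v" using desc_layer v anc_eqI[of w "Suc k" k v] by simp
        then show "remn K n (Suc k) w powr p * cp K (n - Suc k) w = (?r * (1 - ?t)) powr p * cp K (n - Suc k) w"
          by simp
      qed
      also have "\<dots> = ?r powr p * ((1 - ?t) powr p * b)"
        using frac_bounds[of K n v] remn_nonneg[of K n k v] lev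
        by (simp add: b_def sum_distrib_left[symmetric] powr_mult mult.assoc)
      finally have "extr K n v powr p * wt v + (\<Sum>w\<in>desc (Suc k) v. remn K n (Suc k) w powr p * cp K (n - Suc k) w)
        = ?r powr p * (?t powr p * wt v + (1 - ?t) powr p * b)"
        using k lev frac_bounds[of K n v] remn_nonneg[of K n k v]
        by (simp add: extr_def powr_mult algebra_simps)
      also have "?t powr p * wt v + (1 - ?t) powr p * b = ser (wt v) b"
        using powr_real_combination[OF weight_pos[OF vt] b0 p] unfolding t ser_def q(3) .
      also have "ser (wt v) b = cp K (n - k) v"
      proof -
        have "n - k = Suc (n - Suc k)" using k by simp
        then show ?thesis by (simp add: b_def lev)
      qed
      finally show "extr K n v powr p * wt v + (\<Sum>w\<in>desc (Suc k) v. remn K n (Suc k) w powr p * cp K (n - Suc k) w)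
        = ?r powr p * cp K (n - k) v" .
    qed
    finally show ?thesis by simp
  qed
  have "(\<Sum>k<j. \<Sum>v\<in>layer k. extr K n v powr p * wt v) + E j = E 0" if "j \<le> n" for j
    using that by (induction j) (use step in auto)
  from this[of n] have "(\<Sum>k<n. \<Sum>v\<in>layer k. extr K n v powr p * wt v) + E n = E 0" by simp
  moreover have "E n = (\<Sum>v\<in>layer n. extr K n v powr p * wt v)" unfolding E_def
  proof (rule sum.cong[OF refl])
    fix v assume "v \<in> layer n"
    then have "level v = n" using layerD by blast
    then show "remn K n n v powr p * cp K (n - n) v = extr K n v powr p * wt v"
      by (simp add: extr_def frac_def)
  qed
  moreover have "E 0 = cp K n root" by (simp add: E_def layer_0)
  ultimately show ?thesis unfolding sum_below by (simp add: lessThan_Suc_atMost[symmetric])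
qed

lemma tree_cap_le_cp:
  assumes K: "K \<subseteq> bd"
  shows "tree_cap I Q rt p wt (Inr ` K) \<le> ennreal (cp K n root)"
proof -
  have "tree_cap I Q rt p wt (Inr ` K) \<le> (\<Sum>\<^sub>\<infinity>x\<in>tree I. ennreal (extr K n x powr p * wt x))"
    unfolding tree_cap_def
  proof (rule INF_lower, intro CollectI conjI ballI)
    fix x :: "'i vertex + 'i ray" assume "x \<in> Inr ` K"
    then obtain \<xi> where \<xi>: "\<xi> \<in> K" "x = Inr \<xi>" by blast
    have lev: "level (\<xi> k) = k" for k using ray_layer \<xi>(1) K layerD by blast
    have inj: "inj_on \<xi> {..n}" by (rule inj_onI) (metis lev)
    have "1 = ennreal (\<Sum>k\<le>n. extr K n (\<xi> k))" using extr_potential[OF K \<xi>(1)] by simp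
    also have "\<dots> = (\<Sum>k\<le>n. ennreal (extr K n (\<xi> k)))" by (intro sum_ennreal[symmetric] extr_nonneg)
    also have "\<dots> = (\<Sum>v\<in>\<xi> ` {..n}. ennreal (extr K n v))" using inj by (simp add: sum.reindex)
    also have "\<dots> \<le> tree_potential I Q rt (extr K n) x"
      unfolding tree_potential_def \<xi>(2) geodesic_vertices.simps by (intro sum_le_infsum_ennreal) auto
    finally show "1 \<le> tree_potential I Q rt (extr K n) x" .
  qed (rule extr_nonneg)
  also have "\<dots> = (\<Sum>\<^sub>\<infinity>x\<in>below n. ennreal (extr K n x powr p * wt x))"
  proof (rule infsum_cong_neutral)
    fix v assume "v \<in> tree I - below n"
    then have "\<not> level v \<le> n" using tree_layer[of v] by (auto simp: below_def)
    then show "ennreal (extr K n v powr p * wt v) = 0" by (simp add: extr_def)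
  qed (use below_tree in auto)
  also have "\<dots> = (\<Sum>x\<in>below n. ennreal (extr K n x powr p * wt x))" using finite_below by simp
  also have "\<dots> = ennreal (\<Sum>x\<in>below n. extr K n x powr p * wt x)"
  proof (intro sum_ennreal)
    fix v assume "v \<in> below n"
    then have "0 < wt v" using below_tree weight_pos by blast
    then show "0 \<le> extr K n v powr p * wt v" by simp
  qed
  also have "\<dots> = ennreal (cp K n root)" by (simp add: extr_cost)
  finally show ?thesis .
qed

lemma tree_cap_le_lcp:
  assumes K: "K \<subseteq> bd"
  shows "tree_cap I Q rt p wt (Inr ` K) \<le> ennreal (lcp K root)"
  using lcp(1)[OF K root_tree] tree_cap_le_cp[OF K]
  by (intro tendsto_lowerbound[OF tendsto_ennrealI[of _ "lcp K root" sequentially]]) auto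

section \<open>The tree energy controls the energy of the measure\<close>

text \<open>Double counting: by symmetry of the neighbour relation each \<open>u\<close> is counted
  for at most \<open>N0\<close> vertices \<open>w\<close>.\<close>

lemma sum_nbrs_le:
  fixes g :: "'i vertex \<Rightarrow> real"
  assumes A: "A \<subseteq> layer n" and B: "B \<subseteq> layer n" "\<And>w. w \<in> A \<Longrightarrow> nbrs w \<subseteq> B"
    and g: "\<And>u. u \<in> B \<Longrightarrow> 0 \<le> g u"
  shows "(\<Sum>w\<in>A. \<Sum>u\<in>nbrs w. g u) \<le> N0 * (\<Sum>u\<in>B. g u)"
proof -
  have fin: "finite A" "finite B" using A B finite_layer finite_subset by blast+
  have "(\<Sum>w\<in>A. \<Sum>u\<in>nbrs w. g u) = (\<Sum>w\<in>A. \<Sum>u\<in>B. if u \<in> nbrs w then g u else 0)"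
  proof (rule sum.cong[OF refl])
    fix w assume "w \<in> A"
    then have "B \<inter> nbrs w = nbrs w" using B(2) by blast
    then show "(\<Sum>u\<in>nbrs w. g u) = (\<Sum>u\<in>B. if u \<in> nbrs w then g u else 0)"
      using sum.inter_restrict[OF fin(2), of g "nbrs w"] by simp
  qed
  also have "\<dots> = (\<Sum>u\<in>B. \<Sum>w\<in>A. if u \<in> nbrs w then g u else 0)" by (rule sum.swap)
  also have "\<dots> \<le> (\<Sum>u\<in>B. N0 * g u)"
  proof (rule sum_mono)
    fix u assume u: "u \<in> B"
    have ut: "u \<in> tree I" using u B(1) layer_tree by blast
    have "(\<Sum>w\<in>A. if u \<in> nbrs w then g u else 0) = (\<Sum>w\<in>{w \<in> A. u \<in> nbrs w}. g u)"
      by (rule sum.inter_filter[OF fin(1), symmetric])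
    also have "\<dots> = real (card {w \<in> A. u \<in> nbrs w}) * g u" by simp
    also have "\<dots> \<le> N0 * g u"
    proof (rule mult_right_mono)
      have "{w \<in> A. u \<in> nbrs w} \<subseteq> nbrs u" using A layer_tree nbrs_sym by blast
      then have "card {w \<in> A. u \<in> nbrs w} \<le> card (nbrs u)" using card_nbrs(1)[OF ut] by (intro card_mono)
      then show "real (card {w \<in> A. u \<in> nbrs w}) \<le> N0" using card_nbrs(2)[OF ut] by linarith
    qed (rule g[OF u])
    finally show "(\<Sum>w\<in>A. if u \<in> nbrs w then g u else 0) \<le> N0 * g u" .
  qed
  finally show ?thesis by (simp add: sum_distrib_left)
qed

text \<open>Bounds the mass that the transported measure gives to a ball of radius
  \<open>R * \<delta> ^ level v\<close> about any point of \<open>C v\<close>.\<close>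

definition nbsum :: "('i vertex \<Rightarrow> real) \<Rightarrow> 'i vertex \<Rightarrow> real" where
  "nbsum \<mu> v = (\<Sum>w\<in>nbrs v. \<mu> w)"

definition dens :: "('i vertex \<Rightarrow> real) \<Rightarrow> 'i vertex \<Rightarrow> real" where
  "dens \<mu> v = \<beta> ^ level v * nbsum \<mu> v"

lemma nbrs_layer: "w \<in> nbrs v \<Longrightarrow> w \<in> layer (level v)"
  by (simp add: nbrs_def)

lemma nbsum_nonneg: "tree_flow \<mu> \<Longrightarrow> 0 \<le> nbsum \<mu> v"
  unfolding nbsum_def tree_flow_def by (intro sum_nonneg) (use nbrs_layer layer_tree in blast)

lemma dens_nonneg: "tree_flow \<mu> \<Longrightarrow> 0 \<le> dens \<mu> v"
  unfolding dens_def using nbsum_nonneg beta_gt_1 by simp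

lemma nbsum_desc:
  assumes \<mu>: "tree_flow \<mu>" and v: "v \<in> layer j" and jn: "j \<le> n"
  shows "(\<Sum>w\<in>desc n v. nbsum \<mu> w) \<le> N0 * nbsum \<mu> v"
proof -
  have lev: "level v = j" using v layerD by blast
  define B where "B = (\<Union>v'\<in>nbrs v. desc n v')"
  have nbj: "u \<in> layer j" if "u \<in> nbrs v" for u using nbrs_layer[OF that] lev by simp
  have B: "B \<subseteq> layer n" unfolding B_def using desc_layer(1) by blast
  have "(\<Sum>w\<in>desc n v. nbsum \<mu> w) \<le> N0 * (\<Sum>u\<in>B. \<mu> u)"
    unfolding nbsum_def
  proof (rule sum_nbrs_le[OF _ B])
    show "desc n v \<subseteq> layer n" using desc_layer(1) by blast
    fix w assume "w \<in> desc n v"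
    then have w: "w \<in> layer n" "C w \<subseteq> C v" by (rule desc_layer)+
    show "nbrs w \<subseteq> B"
    proof
      fix u assume u: "u \<in> nbrs w"
      have lw: "level w = n" using w layerD by blast
      have un: "u \<in> layer n" using nbrs_layer[OF u] lw by simp
      obtain x y where xy: "x \<in> closure (C w)" "y \<in> closure (C u)" "dist x y \<le> R * \<delta> ^ n"
        using u lw by (auto simp: nbrs_def)
      have an: "anc j u \<in> layer j" "C u \<subseteq> C (anc j u)" using anc[OF un jn] .
      have "x \<in> closure (C v)" "y \<in> closure (C (anc j u))"
        using xy(1,2) closure_mono[OF w(2)] closure_mono[OF an(2)] by blast+
      moreover have "dist x y \<le> R * \<delta> ^ j"
      proof -
        have "\<delta> ^ n \<le> \<delta> ^ j" using jn S.constants by (intro power_decreasing) auto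
        then show ?thesis using xy(3) R_pos order_trans mult_left_mono less_imp_le by metis
      qed
      ultimately have "anc j u \<in> nbrs v" using an(1) lev unfolding nbrs_def by blast
      then show "u \<in> B" using un an(2) by (auto simp: B_def desc_def)
    qed
  next
    fix u assume "u \<in> B"
    then show "0 \<le> \<mu> u" using \<mu> B layer_tree unfolding tree_flow_def by blast
  qed
  also have "(\<Sum>u\<in>B. \<mu> u) = (\<Sum>v'\<in>nbrs v. \<Sum>u\<in>desc n v'. \<mu> u)"
    unfolding B_def
  proof (rule sum.UNION_disjoint)
    show "finite (nbrs v)" using card_nbrs(1)[OF layer_tree[OF v]] .
    show "\<forall>i\<in>nbrs v. finite (desc n i)" using finite_desc by blast
    show "\<forall>i\<in>nbrs v. \<forall>k\<in>nbrs v. i \<noteq> k \<longrightarrow> desc n i \<inter> desc n k = {}"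
    proof (intro ballI impI)
      fix i k assume ik: "i \<in> nbrs v" "k \<in> nbrs v" "i \<noteq> k"
      have False if "u \<in> desc n i" "u \<in> desc n k" for u
        using anc_eqI[OF desc_layer(1)[OF that(1)] jn nbj[OF ik(1)] desc_layer(2)[OF that(1)]]
          anc_eqI[OF desc_layer(1)[OF that(2)] jn nbj[OF ik(2)] desc_layer(2)[OF that(2)]] ik(3) by simp
      then show "desc n i \<inter> desc n k = {}" by blast
    qed
  qed
  also have "\<dots> = nbsum \<mu> v"
    unfolding nbsum_def using flow_sum_desc[OF \<mu> nbj jn] by (intro sum.cong) auto
  finally show ?thesis .
qed

section \<open>Wolff's inequality\<close>

text \<open>Up to a constant, a bound for the contribution of scale \<open>n\<close> to the
  potential of the transported measure, constant on each cube of the layer.\<close>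

definition Fn :: "('i vertex \<Rightarrow> real) \<Rightarrow> nat \<Rightarrow> 'a \<Rightarrow> real" where
  "Fn \<mu> n x = (\<Sum>v\<in>layer n. dens \<mu> v * indicator (C v) x)"

lemma sum_layer_indicator:
  fixes g :: "'i vertex \<Rightarrow> real"
  assumes "v \<in> layer n" "x \<in> C v"
  shows "(\<Sum>w\<in>layer n. g w * indicator (C w) x) = g v"
proof -
  have "g w * indicator (C w) x = (if w = v then g v else 0)" if "w \<in> layer n" for w
  proof (cases "w = v")
    case True then show ?thesis using assms(2) by simp
  next
    case False
    then have "x \<notin> C w" using C_eq[OF that assms(1) _ assms(2)] by blast
    then show ?thesis using False by simp
  qed
  then have "(\<Sum>w\<in>layer n. g w * indicator (C w) x) = (\<Sum>w\<in>layer n. if w = v then g v else 0)"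
    by (rule sum.cong[OF refl])
  then show ?thesis using finite_layer assms by (simp add: sum.delta)
qed

lemmas Fn_eq = sum_layer_indicator[where g = "dens _", folded Fn_def]

lemma Fn_nonneg: "tree_flow \<mu> \<Longrightarrow> 0 \<le> Fn \<mu> n x"
  unfolding Fn_def using dens_nonneg by (intro sum_nonneg) auto

lemma C_sets: "v \<in> layer n \<Longrightarrow> C v \<in> sets m"
  using open_C[OF layer_tree] by (intro borel_m(1))

lemma borel_measurable_Fn: "Fn \<mu> n \<in> borel_measurable m"
  unfolding Fn_def
  by (intro borel_measurable_sum borel_measurable_times borel_measurable_const borel_measurable_indicator C_sets)

text \<open>Equal to \<open>\<delta> powr ((1 - s) * D)\<close>: from one scale to the next the
  kernel gains \<open>\<beta>\<close> and the measure of a cube loses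
  \<open>\<delta> powr D\<close>.\<close>

definition \<theta> :: real where "\<theta> = \<beta> * \<delta> powr D"

lemma theta: "0 < \<theta>" "\<theta> < 1" "\<theta> ^ k = \<beta> ^ k * (\<delta> ^ k) powr D"
proof -
  have eq: "\<theta> = \<delta> powr ((1 - s) * D)" by (simp add: \<theta>_def \<beta>_def powr_add[symmetric] algebra_simps)
  have "\<delta> powr ((1 - s) * D) < \<delta> powr 0" using S.constants s c12 by (intro powr_less_mono') auto
  then show "0 < \<theta>" "\<theta> < 1" using eq S.constants by auto
  have "(\<delta> powr D) ^ k = (\<delta> ^ k) powr D"
    using S.constants by (simp add: powr_realpow[symmetric] powr_powr mult.commute)
  then show "\<theta> ^ k = \<beta> ^ k * (\<delta> ^ k) powr D" by (simp add: \<theta>_def power_mult_distrib)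
qed

text \<open>Up to constants the integral of \<open>Fn \<mu> j x powr q\<close>.\<close>

definition Wn :: "('i vertex \<Rightarrow> real) \<Rightarrow> nat \<Rightarrow> real" where
  "Wn \<mu> j = (\<Sum>v\<in>layer j. (\<delta> ^ j) powr D * dens \<mu> v powr q)"

text \<open>On a cube \<open>C v\<close> of level \<open>j\<close> the second factor is constant.
  The first integrates to at most a multiple of \<open>\<beta> ^ n * (\<delta> ^ n) powr D\<close>
  times the sum of \<open>nbsum\<close> over the descendants of \<open>v\<close>, which
  \<open>nbsum_desc\<close> reduces to \<open>v\<close> itself.\<close>

lemma integral_Fn_product:
  assumes \<mu>: "tree_flow \<mu>" and jn: "j \<le> n"
  shows "(\<integral>\<^sup>+x. ennreal (Fn \<mu> n x * Fn \<mu> j x powr (q - 1)) \<partial>m)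
    \<le> ennreal (c2 * c4 powr D * N0 * \<theta> ^ (n - j) * Wn \<mu> j)"
proof -
  let ?g = "\<lambda>w. dens \<mu> w * dens \<mu> (anc j w) powr (q - 1)"
  have g0: "0 \<le> ?g w" for w using dens_nonneg[OF \<mu>] by simp
  have *: "Fn \<mu> n x * Fn \<mu> j x powr (q - 1) = (\<Sum>w\<in>layer n. ?g w * indicator (C w) x)" for x
  proof (cases "\<exists>w\<in>layer n. x \<in> C w")
    case True
    then obtain w where w: "w \<in> layer n" "x \<in> C w" by blast
    have an: "anc j w \<in> layer j" "x \<in> C (anc j w)" using anc[OF w(1) jn] w(2) by blast+
    show ?thesis using sum_layer_indicator[OF w, of ?g] Fn_eq[OF w, of \<mu>] Fn_eq[OF an, of \<mu>] by simp
  next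
    case False
    then have "indicator (C w) x = (0::real)" if "w \<in> layer n" for w using that by simp
    then have "(\<Sum>w\<in>layer n. g w * indicator (C w) x) = 0" for g :: "'i vertex \<Rightarrow> real"
      by (intro sum.neutral) simp
    then show ?thesis by (simp add: Fn_def)
  qed
  have "(\<integral>\<^sup>+x. ennreal (Fn \<mu> n x * Fn \<mu> j x powr (q - 1)) \<partial>m)
    = (\<integral>\<^sup>+x. (\<Sum>w\<in>layer n. ennreal (?g w) * indicator (C w) x) \<partial>m)"
  proof (intro nn_integral_cong)
    fix x
    have "ennreal (\<Sum>w\<in>layer n. ?g w * indicator (C w) x) = (\<Sum>w\<in>layer n. ennreal (?g w * indicator (C w) x))"
      by (intro sum_ennreal[symmetric] mult_nonneg_nonneg g0) simp
    also have "\<dots> = (\<Sum>w\<in>layer n. ennreal (?g w) * indicator (C w) x)"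
      by (intro sum.cong refl) (simp add: indicator_def)
    finally show "ennreal (Fn \<mu> n x * Fn \<mu> j x powr (q - 1)) = (\<Sum>w\<in>layer n. ennreal (?g w) * indicator (C w) x)"
      unfolding * .
  qed
  also have "\<dots> = (\<Sum>w\<in>layer n. \<integral>\<^sup>+x. ennreal (?g w) * indicator (C w) x \<partial>m)"
    by (intro nn_integral_sum borel_measurable_times_ennreal borel_measurable_const borel_measurable_indicator C_sets)
  also have "\<dots> = (\<Sum>w\<in>layer n. ennreal (?g w * measure m (C w)))"
    using C_sets g0 by (intro sum.cong) (simp_all add: nn_integral_cmult_indicator M.emeasure_eq_measure ennreal_mult)
  also have "\<dots> = ennreal (\<Sum>w\<in>layer n. ?g w * measure m (C w))"
    using g0 by (intro sum_ennreal) simp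
  also have "\<dots> \<le> ennreal (c2 * c4 powr D * N0 * \<theta> ^ (n - j) * Wn \<mu> j)"
  proof (rule ennreal_leI)
    let ?c = "c2 * c4 powr D * (\<delta> ^ n) powr D"
    have "(\<Sum>w\<in>layer n. ?g w * measure m (C w)) \<le> (\<Sum>w\<in>layer n. ?g w * ?c)"
      using measure_C_le g0 by (intro sum_mono mult_left_mono) auto
    also have "\<dots> = (\<Sum>v\<in>layer j. \<Sum>w\<in>desc n v. ?g w * ?c)" by (rule sum_layer_desc[OF jn])
    also have "\<dots> \<le> (\<Sum>v\<in>layer j. c2 * c4 powr D * N0 * \<theta> ^ (n - j) * ((\<delta> ^ j) powr D * dens \<mu> v powr q))"
    proof (rule sum_mono)
      fix v assume v: "v \<in> layer j"
      have lev: "level v = j" using v layerD by blast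
      let ?h = "dens \<mu> v powr (q - 1)"
      have "(\<Sum>w\<in>desc n v. ?g w * ?c) = (\<Sum>w\<in>desc n v. ?h * ?c * \<beta> ^ n * nbsum \<mu> w)"
      proof (rule sum.cong[OF refl])
        fix w assume w: "w \<in> desc n v"
        have "anc j w = v" using anc_eqI[OF desc_layer(1)[OF w] jn v desc_layer(2)[OF w]] .
        moreover have "level w = n" using desc_layer(1)[OF w] layerD by blast
        ultimately show "?g w * ?c = ?h * ?c * \<beta> ^ n * nbsum \<mu> w" by (simp add: dens_def)
      qed
      also have "\<dots> = ?h * ?c * \<beta> ^ n * (\<Sum>w\<in>desc n v. nbsum \<mu> w)" by (simp add: sum_distrib_left)
      also have "\<dots> \<le> ?h * ?c * \<beta> ^ n * (N0 * nbsum \<mu> v)"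
        using c12 beta_gt_1 nbsum_desc[OF \<mu> v jn] by (intro mult_left_mono) auto
      also have "\<dots> = c2 * c4 powr D * N0 * \<theta> ^ (n - j) * ((\<delta> ^ j) powr D * (?h * dens \<mu> v))"
      proof -
        have b: "\<beta> ^ n = \<beta> ^ (n - j) * \<beta> ^ j" using jn by (simp add: power_add[symmetric])
        have d: "(\<delta> ^ n) powr D = (\<delta> ^ (n - j)) powr D * (\<delta> ^ j) powr D"
          using jn S.constants by (simp add: powr_mult[symmetric] power_add[symmetric])
        show ?thesis unfolding theta b d dens_def lev by (simp add: algebra_simps)
      qed
      also have "?h * dens \<mu> v = dens \<mu> v powr q"
        using dens_nonneg[OF \<mu>, of v] by (cases "dens \<mu> v = 0") (auto simp: powr_diff)
      finally show "(\<Sum>w\<in>desc n v. ?g w * ?c) \<le> c2 * c4 powr D * N0 * \<theta> ^ (n - j) * ((\<delta> ^ j) powr D * dens \<mu> v powr q)" .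
    qed
    also have "\<dots> = c2 * c4 powr D * N0 * \<theta> ^ (n - j) * Wn \<mu> j" by (simp add: Wn_def sum_distrib_left)
    finally show "(\<Sum>w\<in>layer n. ?g w * measure m (C w)) \<le> c2 * c4 powr D * N0 * \<theta> ^ (n - j) * Wn \<mu> j" .
  qed
  finally show ?thesis .
qed

lemma Wn_nonneg: "0 \<le> Wn \<mu> j"
  unfolding Wn_def by (intro sum_nonneg) simp

text \<open>The factor \<open>(\<beta> ^ j) powr q * (\<delta> ^ j) powr D\<close> depends on the
  level alone, so it can be moved from \<open>v\<close> to each neighbour \<open>u\<close> and
  exchanged there for the dual weight. One factor \<open>N0 powr q\<close> comes from the power of a
  neighbour sum, the other \<open>N0\<close> from double counting.\<close>

lemma Wn_le:
  obtains c where "0 \<le> c"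
    "\<And>\<mu> j. tree_flow \<mu> \<Longrightarrow> Wn \<mu> j \<le> c * (\<Sum>u\<in>layer j. \<mu> u powr q * wt u powr (1 - q))"
proof (rule weight_dual_bounds)
  fix k1 k2 :: real
  assume k1: "0 < k1" "\<And>n v. v \<in> layer n \<Longrightarrow> k1 * ((\<beta> ^ n) powr q * (\<delta> ^ n) powr D) \<le> wt v powr (1 - q)"
  let ?c = "N0 powr q / k1"
  show thesis
  proof (rule that[of "?c * N0"])
    show "0 \<le> ?c * N0" using N0_nonneg k1 by simp
    fix \<mu> :: "'i vertex \<Rightarrow> real" and j
    assume \<mu>: "tree_flow \<mu>"
    have \<mu>0: "0 \<le> \<mu> u" if "u \<in> layer j" for u using \<mu> layer_tree[OF that] unfolding tree_flow_def by blast
    have "Wn \<mu> j \<le> (\<Sum>v\<in>layer j. ?c * (\<Sum>u\<in>nbrs v. \<mu> u powr q * wt u powr (1 - q)))"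
      unfolding Wn_def
    proof (rule sum_mono)
      fix v assume v: "v \<in> layer j"
      have lev: "level v = j" using v layerD by blast
      have nb: "u \<in> layer j" if "u \<in> nbrs v" for u using nbrs_layer[OF that] lev by simp
      note card = card_nbrs[OF layer_tree[OF v]]
      have "(\<delta> ^ j) powr D * dens \<mu> v powr q = ((\<beta> ^ j) powr q * (\<delta> ^ j) powr D) * nbsum \<mu> v powr q"
        using beta_gt_1 nbsum_nonneg[OF \<mu>, of v] by (simp add: dens_def lev powr_mult)
      also have "\<dots> \<le> ((\<beta> ^ j) powr q * (\<delta> ^ j) powr D) * (N0 powr q * (\<Sum>u\<in>nbrs v. \<mu> u powr q))"
      proof (rule mult_left_mono)
        have "nbsum \<mu> v powr q \<le> real (card (nbrs v)) powr q * (\<Sum>u\<in>nbrs v. \<mu> u powr q)"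
          unfolding nbsum_def using q(1) card(1) \<mu>0 nb by (intro powr_sum_le_card) auto
        also have "\<dots> \<le> N0 powr q * (\<Sum>u\<in>nbrs v. \<mu> u powr q)"
          using card(2) q(1) by (intro mult_right_mono powr_mono2 sum_nonneg) auto
        finally show "nbsum \<mu> v powr q \<le> N0 powr q * (\<Sum>u\<in>nbrs v. \<mu> u powr q)" .
      qed simp
      also have "\<dots> = N0 powr q * (\<Sum>u\<in>nbrs v. \<mu> u powr q * ((\<beta> ^ j) powr q * (\<delta> ^ j) powr D))"
        by (simp add: sum_distrib_left sum_distrib_right mult_ac)
      also have "\<dots> \<le> N0 powr q * (\<Sum>u\<in>nbrs v. \<mu> u powr q * (wt u powr (1 - q) / k1))"
      proof (intro mult_left_mono sum_mono)
        fix u assume "u \<in> nbrs v"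
        then show "(\<beta> ^ j) powr q * (\<delta> ^ j) powr D \<le> wt u powr (1 - q) / k1"
          using k1(2)[OF nb] k1(1) by (simp add: field_simps)
      qed auto
      also have "\<dots> = ?c * (\<Sum>u\<in>nbrs v. \<mu> u powr q * wt u powr (1 - q))"
        by (simp add: sum_divide_distrib[symmetric])
      finally show "(\<delta> ^ j) powr D * dens \<mu> v powr q \<le> ?c * (\<Sum>u\<in>nbrs v. \<mu> u powr q * wt u powr (1 - q))" .
    qed
    also have "\<dots> = ?c * (\<Sum>v\<in>layer j. \<Sum>u\<in>nbrs v. \<mu> u powr q * wt u powr (1 - q))"
      by (simp only: sum_distrib_left)
    also have "\<dots> \<le> ?c * (N0 * (\<Sum>u\<in>layer j. \<mu> u powr q * wt u powr (1 - q)))"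
    proof (rule mult_left_mono[OF sum_nbrs_le])
      show "nbrs w \<subseteq> layer j" if "w \<in> layer j" for w
        using nbrs_layer[of _ w] layerD[OF that] by blast
    qed (use k1(1) in auto)
    finally show "Wn \<mu> j \<le> ?c * N0 * (\<Sum>u\<in>layer j. \<mu> u powr q * wt u powr (1 - q))"
      by (simp only: mult.assoc)
  qed
qed

text \<open>Wolff's inequality. Up to a geometrically growing weight the \<open>q\<close>-th power of a sum is
  controlled by the products \<open>a n * a j powr (q - 1)\<close> with \<open>j \<le> n\<close>; on a cube of level \<open>j\<close> the
  mean of \<open>Fn \<mu> n\<close> is at most \<open>\<theta> ^ (n - j)\<close> times the value of \<open>Fn \<mu> j\<close>, which beats the weight.\<close>

lemma wolff_partial:
  obtains c where "0 \<le> c"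
    "\<And>\<mu> N. tree_flow \<mu> \<Longrightarrow>
      (\<integral>\<^sup>+x. ennreal ((\<Sum>n<N. Fn \<mu> n x) powr q) \<partial>m) \<le> ennreal (c * (\<Sum>j<N. Wn \<mu> j))"
proof -
  \<comment> \<open>Half of the decay \<open>\<theta> ^ (n - j)\<close> cancels the weight
    \<open>\<tau> powr - real (n - j)\<close>, the other half leaves a convergent series;
    \<open>t\<close> is chosen so that \<open>t powr (q - 1) = \<tau>\<close>.\<close>
  define \<tau> where "\<tau> = \<theta> powr (1/2)"
  define t where "t = \<tau> powr (1 / (q - 1))"
  have \<tau>: "0 < \<tau>" "\<tau> < 1" "\<tau> * \<tau> = \<theta>"
    using theta(1,2) powr_less_mono2[of "1/2" \<theta> 1] by (auto simp: \<tau>_def powr_add[symmetric])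
  have t: "0 < t" "t < 1" "t powr (q - 1) = \<tau>"
    using \<tau> q(1) powr_less_mono2[of "1 / (q - 1)" \<tau> 1] by (auto simp: t_def powr_powr)
  define A where "A = c2 * c4 powr D * N0"
  have A: "0 \<le> A" using c12 N0_nonneg by (simp add: A_def)
  define B where "B = q * (1 / (1 - t)) powr (q - 1)"
  have B: "0 \<le> B" using q(1) by (simp add: B_def)
  show thesis
  proof (rule that[of "B * A / (1 - \<tau>)"])
    show "0 \<le> B * A / (1 - \<tau>)" using A B \<tau> by simp
    fix \<mu> :: "'i vertex \<Rightarrow> real" and N
    assume \<mu>: "tree_flow \<mu>"
    let ?P = "\<lambda>n j x. Fn \<mu> n x * Fn \<mu> j x powr (q - 1)"
    let ?w = "\<lambda>n j. B * \<tau> powr (- real (n - j))"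
    have P0: "0 \<le> ?P n j x" for n j x using Fn_nonneg[OF \<mu>] by simp
    have w0: "0 \<le> ?w n j" for n j using B by simp
    have "(\<integral>\<^sup>+x. ennreal ((\<Sum>n<N. Fn \<mu> n x) powr q) \<partial>m)
      \<le> (\<integral>\<^sup>+x. (\<Sum>n<N. \<Sum>j\<le>n. ennreal (?w n j) * ennreal (?P n j x)) \<partial>m)"
    proof (intro nn_integral_mono)
      fix x
      have "(\<Sum>n<N. Fn \<mu> n x) powr q \<le> B * (\<Sum>n<N. \<Sum>j\<le>n. \<tau> powr (- real (n - j)) * ?P n j x)"
        unfolding B_def t(3)[symmetric] by (rule powr_sum_le_double_sum[OF q(1) t(1,2) Fn_nonneg[OF \<mu>]])
      also have "\<dots> = (\<Sum>n<N. \<Sum>j\<le>n. ?w n j * ?P n j x)" by (simp add: sum_distrib_left mult.assoc)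
      finally have "ennreal ((\<Sum>n<N. Fn \<mu> n x) powr q) \<le> ennreal (\<Sum>n<N. \<Sum>j\<le>n. ?w n j * ?P n j x)"
        by (rule ennreal_leI)
      also have "\<dots> = (\<Sum>n<N. ennreal (\<Sum>j\<le>n. ?w n j * ?P n j x))"
        by (intro sum_ennreal[symmetric] sum_nonneg mult_nonneg_nonneg P0 w0)
      also have "\<dots> = (\<Sum>n<N. \<Sum>j\<le>n. ennreal (?w n j * ?P n j x))"
        by (intro sum.cong refl sum_ennreal[symmetric] mult_nonneg_nonneg P0 w0)
      also have "\<dots> = (\<Sum>n<N. \<Sum>j\<le>n. ennreal (?w n j) * ennreal (?P n j x))"
        by (intro sum.cong refl ennreal_mult P0 w0)
      finally show "ennreal ((\<Sum>n<N. Fn \<mu> n x) powr q)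
        \<le> (\<Sum>n<N. \<Sum>j\<le>n. ennreal (?w n j) * ennreal (?P n j x))" .
    qed
    also have "\<dots> = (\<Sum>n<N. \<Sum>j\<le>n. ennreal (?w n j) * (\<integral>\<^sup>+x. ennreal (?P n j x) \<partial>m))"
    proof -
      have [measurable]: "Fn \<mu> n \<in> borel_measurable m" for n by (rule borel_measurable_Fn)
      show ?thesis by (simp add: nn_integral_sum nn_integral_cmult)
    qed
    also have "\<dots> \<le> (\<Sum>n<N. \<Sum>j\<le>n. ennreal (?w n j) * ennreal (A * \<theta> ^ (n - j) * Wn \<mu> j))"
      using integral_Fn_product[OF \<mu>] by (intro sum_mono mult_left_mono) (auto simp: A_def)
    also have "\<dots> = (\<Sum>n<N. \<Sum>j\<le>n. ennreal (B * A * (\<tau> ^ (n - j) * Wn \<mu> j)))"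
    proof (intro sum.cong refl)
      fix n j
      have "\<tau> powr (- real k) * \<theta> ^ k = \<tau> ^ k" for k
        using \<tau>(1) unfolding \<tau>(3)[symmetric] by (simp add: powr_minus powr_realpow power_mult_distrib)
      then have "?w n j * (A * \<theta> ^ (n - j) * Wn \<mu> j) = B * A * (\<tau> ^ (n - j) * Wn \<mu> j)"
        by (metis (no_types, opaque_lifting) mult.assoc mult.left_commute)
      moreover have "0 \<le> A * \<theta> ^ (n - j) * Wn \<mu> j" using A theta(1) Wn_nonneg by simp
      ultimately show "ennreal (?w n j) * ennreal (A * \<theta> ^ (n - j) * Wn \<mu> j) = ennreal (B * A * (\<tau> ^ (n - j) * Wn \<mu> j))"
        using ennreal_mult[OF w0] by metis
    qed
    also have "\<dots> = ennreal (\<Sum>n<N. \<Sum>j\<le>n. B * A * (\<tau> ^ (n - j) * Wn \<mu> j))"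
      using A B \<tau> Wn_nonneg by (simp add: sum_nonneg)
    also have "\<dots> \<le> ennreal (B * A / (1 - \<tau>) * (\<Sum>j<N. Wn \<mu> j))"
    proof (rule ennreal_leI)
      have "(\<Sum>n<N. \<Sum>j\<le>n. \<tau> ^ (n - j) * Wn \<mu> j) = (\<Sum>n<N. \<Sum>j<N. if j \<le> n then \<tau> ^ (n - j) * Wn \<mu> j else 0)"
      proof (rule sum.cong[OF refl])
        fix n assume "n \<in> {..<N}"
        then have "{j \<in> {..<N}. j \<le> n} = {..n}" by auto
        then show "(\<Sum>j\<le>n. \<tau> ^ (n - j) * Wn \<mu> j) = (\<Sum>j<N. if j \<le> n then \<tau> ^ (n - j) * Wn \<mu> j else 0)"
          using sum.inter_filter[of "{..<N}" "\<lambda>j. \<tau> ^ (n - j) * Wn \<mu> j" "\<lambda>j. j \<le> n"] by simp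
      qed
      also have "\<dots> = (\<Sum>j<N. \<Sum>n<N. if j \<le> n then \<tau> ^ (n - j) * Wn \<mu> j else 0)" by (rule sum.swap)
      also have "\<dots> \<le> (\<Sum>j<N. 1 / (1 - \<tau>) * Wn \<mu> j)"
      proof (rule sum_mono)
        fix j
        have "(\<Sum>n<N. if j \<le> n then \<tau> ^ (n - j) * Wn \<mu> j else 0) = (\<Sum>n\<in>{n \<in> {..<N}. j \<le> n}. \<tau> ^ (n - j) * Wn \<mu> j)"
          by (rule sum.inter_filter[symmetric]) simp
        also have "\<dots> = (\<Sum>k\<in>(\<lambda>n. n - j) ` {n \<in> {..<N}. j \<le> n}. \<tau> ^ k) * Wn \<mu> j"
        proof -
          have "inj_on (\<lambda>n. n - j) {n \<in> {..<N}. j \<le> n}" by (auto simp: inj_on_def)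
          then show ?thesis by (simp add: sum.reindex sum_distrib_right)
        qed
        also have "\<dots> \<le> 1 / (1 - \<tau>) * Wn \<mu> j"
          using \<tau> Wn_nonneg by (intro mult_right_mono sum_power_le_geometric) auto
        finally show "(\<Sum>n<N. if j \<le> n then \<tau> ^ (n - j) * Wn \<mu> j else 0) \<le> 1 / (1 - \<tau>) * Wn \<mu> j" .
      qed
      finally have "B * A * (\<Sum>n<N. \<Sum>j\<le>n. \<tau> ^ (n - j) * Wn \<mu> j) \<le> B * A * (\<Sum>j<N. 1 / (1 - \<tau>) * Wn \<mu> j)"
        using A B by (intro mult_left_mono) auto
      then show "(\<Sum>n<N. \<Sum>j\<le>n. B * A * (\<tau> ^ (n - j) * Wn \<mu> j)) \<le> B * A / (1 - \<tau>) * (\<Sum>j<N. Wn \<mu> j)"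
        by (simp add: sum_distrib_left sum_divide_distrib mult_ac)
    qed
    finally show "(\<integral>\<^sup>+x. ennreal ((\<Sum>n<N. Fn \<mu> n x) powr q) \<partial>m) \<le> ennreal (B * A / (1 - \<tau>) * (\<Sum>j<N. Wn \<mu> j))" .
  qed
qed

section \<open>Upper bounds for the kernel and the space energy\<close>

text \<open>The extra factor \<open>\<beta>\<close> is the loss of one scale between
  \<open>R * \<delta> ^ Suc n < dist x y\<close> and the ball of radius
  \<open>R * \<delta> ^ n\<close>.\<close>

definition \<kappa>' :: real where
  "\<kappa>' = (2 * c1) powr - s * R powr - (s * D) * \<beta>"

lemma kappa'_pos: "0 < \<kappa>'"
  using c12 R_pos beta_gt_1 by (simp add: \<kappa>'_def)

text \<open>Off the diagonal a single term suffices, that of the last scale whose ball still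
  contains \<open>y\<close>. On the diagonal every ball contains \<open>y\<close> and the series
  diverges, matching the infinite kernel.\<close>

lemma kernel_le_suminf:
  "ker x y \<le> ennreal \<kappa>' * (\<Sum>n. ennreal (\<beta> ^ n) * indicator (cball x (R * \<delta> ^ n)) y)"
proof -
  let ?f = "\<lambda>n. ennreal (\<beta> ^ n) * indicator (cball x (R * \<delta> ^ n)) y :: ennreal"
  have "f n \<le> suminf f" for f :: "nat \<Rightarrow> ennreal" and n
    using sum_le_suminf[of f "{n}"] by simp
  note single = this[of ?f]
  show ?thesis
  proof (cases "x = y")
    case True
    have "suminf ?f = \<infinity>"
    proof (cases "suminf ?f")
      case (real r)
      obtain n where "r < \<beta> ^ n" using real_arch_pow[OF beta_gt_1] by blast
      moreover have "ennreal (\<beta> ^ n) \<le> ennreal r"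
        using single[of n] True R_pos S.constants real by (simp add: indicator_def)
      ultimately show ?thesis using real(1) by simp
    qed simp
    then show ?thesis using kappa'_pos by (simp add: ennreal_mult_top)
  next
    case False
    then have r: "0 < dist x y" by simp
    have "\<exists>n. R * \<delta> ^ Suc n < dist x y"
    proof -
      have "(\<lambda>n. R * \<delta> ^ Suc n) \<longlonglongrightarrow> 0" using delta_to_0[of "R * \<delta>"] by (simp add: mult.assoc)
      then show ?thesis using order_tendstoD(2)[of _ 0 sequentially "dist x y"] r
        by (auto simp: eventually_sequentially)
    qed
    \<comment> \<open>Minimality gives \<open>dist x y <= R * \<delta> ^ n\<close>; for
      \<open>n = 0\<close> this is the bound by the diameter.\<close>
    define n where "n = (LEAST n. R * \<delta> ^ Suc n < dist x y)"
    have n: "R * \<delta> ^ Suc n < dist x y"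
      unfolding n_def using \<open>\<exists>n. _ n\<close> by (rule LeastI_ex)
    have n': "dist x y \<le> R * \<delta> ^ n"
    proof (cases n)
      case 0 then show ?thesis using dist_le_R by simp
    next
      case (Suc k)
      then show ?thesis using not_less_Least[of k "\<lambda>n. R * \<delta> ^ Suc n < dist x y"] by (simp add: n_def)
    qed
    have "dist x y powr - (s * D) \<le> (R * \<delta> ^ Suc n) powr - (s * D)"
      using n R_pos S.constants s c12 by (intro powr_mono2') auto
    also have "\<dots> = R powr - (s * D) * \<beta> * \<beta> ^ n"
      using R_pos S.constants by (subst powr_mult) (simp_all add: beta_pow[symmetric] mult.assoc del: power_Suc, simp)
    finally have "(2 * c1) powr - s * dist x y powr - (s * D) \<le> \<kappa>' * \<beta> ^ n"
      by (simp add: \<kappa>'_def mult.assoc mult_left_mono)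
    then have "ker x y \<le> ennreal (\<kappa>' * \<beta> ^ n)"
      using kernel_le[OF False] order_trans ennreal_leI by blast
    also have "\<dots> = ennreal \<kappa>' * ?f n"
      using kappa'_pos beta_gt_1 n' by (simp add: ennreal_mult indicator_def)
    also have "\<dots> \<le> ennreal \<kappa>' * suminf ?f" by (intro mult_left_mono single) simp
    finally show ?thesis .
  qed
qed

text \<open>If \<open>x\<close> lies in \<open>C v\<close> at level \<open>n\<close>, the closed
  cubes of that layer met by the ball of radius \<open>R * \<delta> ^ n\<close> belong to
  \<open>nbrs v\<close>, so \<open>near\<close> bounds its mass by
  \<open>nbsum \<mu> v\<close>.\<close>

lemma potential_le_suminf:
  assumes \<mu>: "tree_flow \<mu>" and \<omega>: "sets \<omega> = sets borel"
    and near: "\<And>A N n. A \<in> sets borel \<Longrightarrow> N \<subseteq> layer n \<Longrightarrow>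
      (\<And>v. v \<in> layer n \<Longrightarrow> closure (C v) \<inter> A \<noteq> {} \<Longrightarrow> v \<in> N) \<Longrightarrow>
      emeasure \<omega> A \<le> ennreal (\<Sum>v\<in>N. \<mu> v)"
    and x: "\<And>n. x \<in> (\<Union>v\<in>layer n. C v)"
  shows "(\<integral>\<^sup>+y. ker x y \<partial>\<omega>) \<le> ennreal \<kappa>' * (\<Sum>n. ennreal (Fn \<mu> n x))"
proof -
  have B: "cball x r \<in> sets \<omega>" for r using \<omega> by simp
  have meas: "(\<lambda>y. ennreal c * indicator (cball x r) y) \<in> borel_measurable \<omega>" for c r
    by (intro borel_measurable_times_ennreal borel_measurable_const borel_measurable_indicator B)
  have "(\<integral>\<^sup>+y. ker x y \<partial>\<omega>)
    \<le> (\<integral>\<^sup>+y. ennreal \<kappa>' * (\<Sum>n. ennreal (\<beta> ^ n) * indicator (cball x (R * \<delta> ^ n)) y) \<partial>\<omega>)"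
    by (intro nn_integral_mono kernel_le_suminf)
  also have "\<dots> = ennreal \<kappa>' * (\<Sum>n. ennreal (\<beta> ^ n) * emeasure \<omega> (cball x (R * \<delta> ^ n)))"
    by (subst nn_integral_cmult) (use meas B in \<open>auto simp: nn_integral_suminf nn_integral_cmult_indicator intro!: borel_measurable_suminf_order\<close>)
  also have "\<dots> \<le> ennreal \<kappa>' * (\<Sum>n. ennreal (Fn \<mu> n x))"
  proof (intro mult_left_mono suminf_le)
    fix n
    obtain v where v: "v \<in> layer n" "x \<in> C v" using x[of n] by blast
    have lev: "level v = n" using v(1) layerD by blast
    have "emeasure \<omega> (cball x (R * \<delta> ^ n)) \<le> ennreal (\<Sum>u\<in>nbrs v. \<mu> u)"
    proof (rule near)
      show "nbrs v \<subseteq> layer n" using nbrs_layer lev by blast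
      fix u assume u: "u \<in> layer n" "closure (C u) \<inter> cball x (R * \<delta> ^ n) \<noteq> {}"
      then obtain y where "y \<in> closure (C u)" "dist x y \<le> R * \<delta> ^ n" by auto
      moreover have "x \<in> closure (C v)" using v(2) closure_subset by blast
      ultimately show "u \<in> nbrs v" using u(1) lev unfolding nbrs_def by blast
    qed simp
    then have "ennreal (\<beta> ^ n) * emeasure \<omega> (cball x (R * \<delta> ^ n)) \<le> ennreal (\<beta> ^ n) * ennreal (nbsum \<mu> v)"
      unfolding nbsum_def by (intro mult_left_mono) auto
    also have "\<dots> = ennreal (Fn \<mu> n x)"
      using Fn_eq[OF v, of \<mu>] beta_gt_1 nbsum_nonneg[OF \<mu>, of v] by (simp add: dens_def lev ennreal_mult)
    finally show "ennreal (\<beta> ^ n) * emeasure \<omega> (cball x (R * \<delta> ^ n)) \<le> ennreal (Fn \<mu> n x)" .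
  qed auto
  finally show ?thesis .
qed

lemma space_energy_le:
  obtains c where "0 < c"
    "\<And>\<mu> \<omega> G. tree_flow \<mu> \<Longrightarrow> sets \<omega> = sets borel \<Longrightarrow>
      (\<And>A N n. A \<in> sets borel \<Longrightarrow> N \<subseteq> layer n \<Longrightarrow>
        (\<And>v. v \<in> layer n \<Longrightarrow> closure (C v) \<inter> A \<noteq> {} \<Longrightarrow> v \<in> N) \<Longrightarrow>
        emeasure \<omega> A \<le> ennreal (\<Sum>v\<in>N. \<mu> v)) \<Longrightarrow>
      (\<And>n. (\<Sum>v\<in>below n. \<mu> v powr q * wt v powr (1 - q)) \<le> G) \<Longrightarrow>
      space_energy m s q \<omega> \<le> ennreal (c * G)"
proof (rule wolff_partial, rule Wn_le)
  fix b c :: real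
  assume b: "0 \<le> b" "\<And>\<mu> N. tree_flow \<mu> \<Longrightarrow>
      (\<integral>\<^sup>+x. ennreal ((\<Sum>n<N. Fn \<mu> n x) powr q) \<partial>m) \<le> ennreal (b * (\<Sum>j<N. Wn \<mu> j))"
  assume c: "0 \<le> c" "\<And>\<mu> j. tree_flow \<mu> \<Longrightarrow> Wn \<mu> j \<le> c * (\<Sum>u\<in>layer j. \<mu> u powr q * wt u powr (1 - q))"
  \<comment> \<open>The summand 1 makes the constant positive even if \<open>b\<close> or
    \<open>c\<close> is 0.\<close>
  define e where "e = \<kappa>' powr q * (b * c) + 1"
  show thesis
  proof (rule that[of e])
    show "0 < e" using b(1) c(1) by (simp add: e_def add_nonneg_pos)
    fix \<mu> :: "'i vertex \<Rightarrow> real" and \<omega> :: "'a measure" and G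
    assume \<mu>: "tree_flow \<mu>" and \<omega>: "sets \<omega> = sets borel"
      and near: "\<And>A N n. A \<in> sets borel \<Longrightarrow> N \<subseteq> layer n \<Longrightarrow>
        (\<And>v. v \<in> layer n \<Longrightarrow> closure (C v) \<inter> A \<noteq> {} \<Longrightarrow> v \<in> N) \<Longrightarrow>
        emeasure \<omega> A \<le> ennreal (\<Sum>v\<in>N. \<mu> v)"
      and G: "\<And>n. (\<Sum>v\<in>below n. \<mu> v powr q * wt v powr (1 - q)) \<le> G"
    have G0: "0 \<le> G" using order_trans[OF sum_nonneg G[of 0]] by simp
    define H where "H N x = \<kappa>' * (\<Sum>n<N. Fn \<mu> n x)" for N x
    have H0: "0 \<le> H N x" for N x unfolding H_def using kappa'_pos Fn_nonneg[OF \<mu>] by (simp add: sum_nonneg)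
    have Hmono: "H i x \<le> H j x" if "i \<le> j" for i j x
      unfolding H_def using that kappa'_pos Fn_nonneg[OF \<mu>] by (intro mult_left_mono sum_mono2) auto
    have [measurable]: "H N \<in> borel_measurable m" for N
      unfolding H_def by (intro borel_measurable_times borel_measurable_const borel_measurable_sum borel_measurable_Fn)
    have "space_energy m s q \<omega> \<le> (\<integral>\<^sup>+x. (SUP N. ennreal (H N x powr q)) \<partial>m)"
      unfolding space_energy_def
    proof (rule nn_integral_mono_AE)
      \<comment> \<open>Countably many null sets are discarded, one for each layer.\<close>
      have "AE x in m. \<forall>n. x \<in> (\<Union>v\<in>layer n. C v)" using AE_layer by (simp only: AE_all_countable) blast
      then show "AE x in m. ennpow (\<integral>\<^sup>+y. ker x y \<partial>\<omega>) q \<le> (SUP N. ennreal (H N x powr q))"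
      proof eventually_elim
        case (elim x)
        have "(\<integral>\<^sup>+y. ker x y \<partial>\<omega>) \<le> ennreal \<kappa>' * (\<Sum>n. ennreal (Fn \<mu> n x))"
        proof (rule potential_le_suminf[OF \<mu> \<omega>])
          show "emeasure \<omega> A \<le> ennreal (\<Sum>v\<in>N. \<mu> v)"
            if "A \<in> sets borel" "N \<subseteq> layer n"
              "\<And>v. v \<in> layer n \<Longrightarrow> closure (C v) \<inter> A \<noteq> {} \<Longrightarrow> v \<in> N" for A N n
            using that by (rule near)
        qed (use elim in blast)
        also have "\<dots> = (SUP N. ennreal \<kappa>' * (\<Sum>n<N. ennreal (Fn \<mu> n x)))"
          by (subst suminf_eq_SUP) (rule SUP_mult_left_ennreal)
        also have "\<dots> = (SUP N. ennreal (H N x))"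
        proof (rule SUP_cong[OF refl])
          fix N
          have "(\<Sum>n<N. ennreal (Fn \<mu> n x)) = ennreal (\<Sum>n<N. Fn \<mu> n x)"
            by (intro sum_ennreal Fn_nonneg[OF \<mu>])
          then show "ennreal \<kappa>' * (\<Sum>n<N. ennreal (Fn \<mu> n x)) = ennreal (H N x)"
            unfolding H_def using kappa'_pos Fn_nonneg[OF \<mu>] by (simp add: ennreal_mult sum_nonneg)
        qed
        finally have "ennpow (\<integral>\<^sup>+y. ker x y \<partial>\<omega>) q \<le> ennpow (SUP N. ennreal (H N x)) q"
          using q(1) by (intro ennpow_mono) auto
        also have "\<dots> \<le> (SUP N. ennpow (ennreal (H N x)) q)" using q(1) by (intro ennpow_SUP_le) simp
        finally show ?case by (simp add: ennpow_ennreal H0)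
      qed
    qed
    also have "\<dots> = (SUP N. \<integral>\<^sup>+x. ennreal (H N x powr q) \<partial>m)"
    proof (rule nn_integral_monotone_convergence_SUP)
      show "incseq (\<lambda>N x. ennreal (H N x powr q))"
        using H0 Hmono q(1) by (auto simp: incseq_def le_fun_def intro!: ennreal_leI powr_mono2)
    qed simp
    also have "\<dots> \<le> ennreal (e * G)"
    proof (rule SUP_least)
      fix N
      have "(\<integral>\<^sup>+x. ennreal (H N x powr q) \<partial>m)
        = (\<integral>\<^sup>+x. ennreal (\<kappa>' powr q) * ennreal ((\<Sum>n<N. Fn \<mu> n x) powr q) \<partial>m)"
        unfolding H_def using kappa'_pos Fn_nonneg[OF \<mu>]
        by (intro nn_integral_cong) (simp add: powr_mult sum_nonneg ennreal_mult)
      also have "\<dots> = ennreal (\<kappa>' powr q) * (\<integral>\<^sup>+x. ennreal ((\<Sum>n<N. Fn \<mu> n x) powr q) \<partial>m)"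
      proof -
        have [measurable]: "Fn \<mu> n \<in> borel_measurable m" for n by (rule borel_measurable_Fn)
        show ?thesis by (rule nn_integral_cmult) measurable
      qed
      also have "\<dots> \<le> ennreal (\<kappa>' powr q) * ennreal (b * (\<Sum>j<N. Wn \<mu> j))"
        by (intro mult_left_mono b(2)[OF \<mu>]) simp
      also have "\<dots> = ennreal (\<kappa>' powr q * (b * (\<Sum>j<N. Wn \<mu> j)))"
        by (intro ennreal_mult[symmetric] mult_nonneg_nonneg sum_nonneg b(1) Wn_nonneg) simp
      also have "\<dots> \<le> ennreal (e * G)"
      proof (rule ennreal_leI)
        have "(\<Sum>j<N. Wn \<mu> j) \<le> (\<Sum>j<N. c * (\<Sum>u\<in>layer j. \<mu> u powr q * wt u powr (1 - q)))"
          by (intro sum_mono c(2)[OF \<mu>])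
        also have "\<dots> = c * (\<Sum>j<N. \<Sum>u\<in>layer j. \<mu> u powr q * wt u powr (1 - q))"
          by (simp only: sum_distrib_left)
        also have "\<dots> \<le> c * (\<Sum>j\<le>N. \<Sum>u\<in>layer j. \<mu> u powr q * wt u powr (1 - q))"
          using c(1) by (intro mult_left_mono sum_mono2) (auto intro: sum_nonneg)
        also have "\<dots> \<le> c * G" using G[of N] c(1) by (intro mult_left_mono) (simp_all add: sum_below)
        finally have "\<kappa>' powr q * (b * (\<Sum>j<N. Wn \<mu> j)) \<le> \<kappa>' powr q * (b * (c * G))"
          using b(1) by (intro mult_left_mono) auto
        also have "\<dots> \<le> e * G" using G0 by (simp add: e_def algebra_simps)
        finally show "\<kappa>' powr q * (b * (\<Sum>j<N. Wn \<mu> j)) \<le> e * G" .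
      qed
      finally show "(\<integral>\<^sup>+x. ennreal (H N x powr q) \<partial>m) \<le> ennreal (e * G)" .
    qed
    finally show "space_energy m s q \<omega> \<le> ennreal (e * G)" .
  qed
qed

lemma tree_flow_flow:
  assumes "K \<subseteq> bd" "0 < lcp K root" shows "tree_flow (flow K)"
  unfolding tree_flow_def
  using flow_root flow_nonneg[OF assms(1) tree_layer] flow_sum[OF assms] by blast

lemma tree_cap_le_space_cap:
  obtains c where "0 < c"
    "\<And>K F. closed_rays K \<Longrightarrow> closed F \<Longrightarrow> Lam ` K \<subseteq> F \<Longrightarrow>
      tree_cap I Q rt p wt (Inr ` K) \<le> ennreal c * space_cap m s p q F"
proof (rule space_energy_le)
  fix c :: real
  assume c: "0 < c" "\<And>\<mu> \<omega> G. tree_flow \<mu> \<Longrightarrow> sets \<omega> = sets borel \<Longrightarrow>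
      (\<And>A N n. A \<in> sets borel \<Longrightarrow> N \<subseteq> layer n \<Longrightarrow>
        (\<And>v. v \<in> layer n \<Longrightarrow> closure (C v) \<inter> A \<noteq> {} \<Longrightarrow> v \<in> N) \<Longrightarrow>
        emeasure \<omega> A \<le> ennreal (\<Sum>v\<in>N. \<mu> v)) \<Longrightarrow>
      (\<And>n. (\<Sum>v\<in>below n. \<mu> v powr q * wt v powr (1 - q)) \<le> G) \<Longrightarrow>
      space_energy m s q \<omega> \<le> ennreal (c * G)"
  let ?b = "c powr (p - 1)"
  show thesis
  proof (rule that[of ?b])
    show "0 < ?b" using c(1) by simp
    fix K F assume K: "closed_rays K" and F: "closed F" and KF: "Lam ` K \<subseteq> F"
    have Kbd: "K \<subseteq> bd" using K by (simp add: closed_rays_def)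
    let ?L = "lcp K root"
    have L0: "0 \<le> ?L" using lcp(3)[OF Kbd root_tree] .
    have cap: "tree_cap I Q rt p wt (Inr ` K) \<le> ennreal ?L" by (rule tree_cap_le_lcp[OF Kbd])
    show "tree_cap I Q rt p wt (Inr ` K) \<le> ennreal ?b * space_cap m s p q F"
    \<comment> \<open>A flow exists only for positive \<open>lcp K root\<close>; otherwise
      \<open>cap\<close> makes the tree capacity 0.\<close>
    proof (cases "?L = 0")
      case True then show ?thesis using cap by simp
    next
      case False
      then have L: "0 < ?L" using L0 by simp
      note fl = tree_flow_flow[OF Kbd L]
      have tr: "\<exists>\<xi>\<in>K. \<xi> (level v) = v" if v: "v \<in> tree I" "0 < flow K v" for v
        using lcp_pos_trace[OF Kbd v(1) flow_pos[OF Kbd L tree_layer[OF v(1)] v(2)]] by (simp add: trace_def)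
      show ?thesis
      proof (rule flow_measure[OF fl K tr])
        fix \<omega> :: "'a measure"
        assume \<omega>: "sets \<omega> = sets borel" "emeasure \<omega> UNIV = 1"
          and null: "\<And>A. A \<in> sets borel \<Longrightarrow> A \<inter> Lam ` K = {} \<Longrightarrow> emeasure \<omega> A = 0"
          and near: "\<And>A N n. A \<in> sets borel \<Longrightarrow> N \<subseteq> layer n \<Longrightarrow>
            (\<And>v. v \<in> layer n \<Longrightarrow> closure (C v) \<inter> A \<noteq> {} \<Longrightarrow> v \<in> N) \<Longrightarrow>
            emeasure \<omega> A \<le> ennreal (\<Sum>v\<in>N. flow K v)"
        have sp: "space \<omega> = UNIV" using sets_eq_imp_space_eq[OF \<omega>(1)] by simp
        have fin: "finite_measure \<omega>" by (rule finite_measureI) (simp add: sp \<omega>(2))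
        have nullF: "emeasure \<omega> (- F) = 0" using F KF by (intro null) auto
        have "emeasure \<omega> UNIV \<le> emeasure \<omega> F + emeasure \<omega> (- F)"
          using emeasure_subadditive[of F \<omega> "- F"] F \<omega>(1) by (simp add: Compl_partition)
        moreover have "emeasure \<omega> F \<le> emeasure \<omega> UNIV" using \<omega>(1) by (intro emeasure_mono) auto
        ultimately have one: "emeasure \<omega> F = 1" using nullF \<omega>(2) by (simp add: order_antisym)
        have supp: "measure_support \<omega> \<subseteq> F"
        proof
          fix x assume "x \<in> measure_support \<omega>"
          then have "\<not> (open (- F) \<and> x \<in> - F)" using nullF unfolding measure_support_def by blast
          then show "x \<in> F" using F by auto
        qed
        have "space_energy m s q \<omega> \<le> ennreal (c * ?L powr (1 - q))"
          by (rule c(2)[OF fl \<omega>(1) near flow_energy[OF Kbd L]])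
        then have "ennpow (space_energy m s q \<omega>) (p - 1) \<le> ennpow (ennreal (c * ?L powr (1 - q))) (p - 1)"
          using p by (intro ennpow_mono) auto
        also have "\<dots> = ennreal ((c * ?L powr (1 - q)) powr (p - 1))"
          using c(1) by (intro ennpow_ennreal) simp
        \<comment> \<open>The exponents are dual: \<open>(1 - q) * (p - 1) = - 1\<close> turns the
          energy bound for the unit flow into the reciprocal of the capacity.\<close>
        also have "(c * ?L powr (1 - q)) powr (p - 1) = ?b / ?L"
        proof -
          have "(1 - q) * (p - 1) = - 1" using q(4) by (simp add: algebra_simps)
          then show ?thesis using c(1) L by (simp add: powr_mult powr_powr powr_minus divide_inverse)
        qed
        finally have E: "ennpow (space_energy m s q \<omega>) (p - 1) \<le> ennreal (?b / ?L)" .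
        have "ennreal ?L = ennreal ?b * (1 / ennreal (?b / ?L))"
          using c(1) L by (simp add: divide_ennreal[of 1, simplified] ennreal_mult[symmetric])
        also have "\<dots> \<le> ennreal ?b * (1 / ennpow (space_energy m s q \<omega>) (p - 1))"
          using E by (simp add: divide_ennreal_def ennreal_inverse_antimono mult_left_mono)
        also have "1 = ennpow (emeasure \<omega> F) p" using ennpow_ennreal[of 1 p] by (simp add: one)
        also have "ennpow (emeasure \<omega> F) p / ennpow (space_energy m s q \<omega>) (p - 1) \<le> space_cap m s p q F"
          unfolding space_cap_def using \<omega> fin supp sp by (intro SUP_upper) auto
        finally have "ennreal ?L \<le> ennreal ?b * space_cap m s p q F" by (simp add: mult_left_mono)
        then show ?thesis using cap by (rule order_trans[rotated])
      qed
    qed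
  qed
qed

end

theorem theorem25:
  fixes m :: "'a::complete_space measure"
    and I :: "nat \<Rightarrow> 'i set" and Q :: "nat \<Rightarrow> 'i \<Rightarrow> 'a set" and z :: "nat \<Rightarrow> 'i \<Rightarrow> 'a"
    and rt :: 'i and D c1 c2 \<delta> a0 c4 p p' s :: real
  assumes "ahlfors_regular m D c1 c2"
    and "dyadic_system m I Q z rt \<delta> a0 c4"
    and "1 < p" and "1 / p + 1 / p' = 1"
    and "0 < s" and "s < 1"
  shows "\<exists>C1 C2 :: real. 0 < C1 \<and> C1 < C2 \<and>
    (\<forall>K. compactin (boundary_topology I Q rt) K \<longrightarrow>
       ennreal C1 * tree_cap I Q rt p (dyadic_weight m Q s p') (Inr ` K)
         \<le> space_cap m s p p' (boundary_map Q ` K) \<and>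
       space_cap m s p p' (boundary_map Q ` K)
         \<le> ennreal C2 * tree_cap I Q rt p (dyadic_weight m Q s p') (Inr ` K)) \<and>
    (\<forall>F. closed F \<longrightarrow>
       ennreal C1 * tree_cap I Q rt p (dyadic_weight m Q s p')
           (Inr ` {\<xi> \<in> tree_boundary I Q rt. boundary_map Q \<xi> \<in> F})
         \<le> space_cap m s p p' F \<and>
       space_cap m s p p' F
         \<le> ennreal C2 * tree_cap I Q rt p (dyadic_weight m Q s p')
           (Inr ` {\<xi> \<in> tree_boundary I Q rt. boundary_map Q \<xi> \<in> F}))"
proof -
  interpret dyadic_capacity m D c1 c2 I Q z rt \<delta> a0 c4 p p' s
    using assms by (simp add: dyadic_capacity_def dyadic_capacity_axioms_def dyadic_space_def)
  show ?thesis
  proof (rule space_cap_le_tree_cap, rule tree_cap_le_space_cap)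
    fix b c :: real
    assume b: "0 < b" "\<And>E K. K \<subseteq> bd \<Longrightarrow> E \<subseteq> Lam ` K \<Longrightarrow>
        space_cap m s p p' E \<le> ennreal b * tree_cap I Q rt p wt (Inr ` K)"
    assume c: "0 < c" "\<And>K F. closed_rays K \<Longrightarrow> closed F \<Longrightarrow> Lam ` K \<subseteq> F \<Longrightarrow>
        tree_cap I Q rt p wt (Inr ` K) \<le> ennreal c * space_cap m s p p' F"
    \<comment> \<open>The lower constant will be \<open>1 / c\<close>; adding it to \<open>b\<close>
      makes the inequality between the two constants strict.\<close>
    define C2 where "C2 = b + 1 / c"
    have up: "space_cap m s p p' E \<le> ennreal C2 * tree_cap I Q rt p wt (Inr ` K)"
      if "K \<subseteq> bd" "E \<subseteq> Lam ` K" for E K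
      using b(2)[OF that] by (rule order_trans) (use b c in \<open>auto simp: C2_def intro!: mult_right_mono ennreal_leI\<close>)
    have low: "ennreal (1 / c) * tree_cap I Q rt p wt (Inr ` K) \<le> space_cap m s p p' F"
      if "closed_rays K" "closed F" "Lam ` K \<subseteq> F" for K F
    proof -
      have "ennreal (1 / c) * tree_cap I Q rt p wt (Inr ` K) \<le> ennreal (1 / c) * (ennreal c * space_cap m s p p' F)"
        using c(2)[OF that] by (rule mult_left_mono) simp
      also have "\<dots> = space_cap m s p p' F"
        using c(1) by (simp add: mult.assoc[symmetric] ennreal_mult[symmetric])
      finally show ?thesis .
    qed
    show ?thesis
    proof (rule exI[of _ "1 / c"], rule exI[of _ C2], intro conjI allI impI)
      show "0 < 1 / c" "1 / c < C2" using b c by (auto simp: C2_def)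
      fix K assume K: "compactin (boundary_topology I Q rt) K"
      have "K \<subseteq> bd" using closed_rays_compact[OF K] by (simp add: closed_rays_def)
      then show "space_cap m s p p' (Lam ` K) \<le> ennreal C2 * tree_cap I Q rt p wt (Inr ` K)"
        by (rule up) simp
      show "ennreal (1 / c) * tree_cap I Q rt p wt (Inr ` K) \<le> space_cap m s p p' (Lam ` K)"
        by (rule low[OF closed_rays_compact[OF K] closed_Lam_image[OF K]]) simp
    next
      fix F :: "'a set" assume F: "closed F"
      show "ennreal (1 / c) * tree_cap I Q rt p wt (Inr ` {\<xi> \<in> bd. Lam \<xi> \<in> F}) \<le> space_cap m s p p' F"
        by (rule low[OF closed_rays_vimage[OF F] F]) auto
      show "space_cap m s p p' F \<le> ennreal C2 * tree_cap I Q rt p wt (Inr ` {\<xi> \<in> bd. Lam \<xi> \<in> F})"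
      proof (rule up)
        show "F \<subseteq> Lam ` {\<xi> \<in> bd. Lam \<xi> \<in> F}"
        proof
          fix x assume "x \<in> F"
          then show "x \<in> Lam ` {\<xi> \<in> bd. Lam \<xi> \<in> F}" by (rule_tac Lam_surj[of x]) force
        qed
      qed auto
    qed
  qed
qed

end
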